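(* There is a natural bijection between the isomorphism classes of systems $(R,J_{1},\ldots,J_{n})$, where $R$ is a countable Boolean ring and $J_{1},\ldots,J_{n}$ are ideals of $R$ such that the system is $\omega$-categorical, and the isomorphism classes of tuples $[P,L,f,Q_{1},\ldots,Q_{n}]$ such that $[P,L,f]$ is a finite-crowded extended PO system, each $Q_{i}$ is a lower subset of $P$, and $\langle Q_{1},\ldots,Q_{n},^{\prime}\rangle=2^{P}$.
   Context: Boolean rings need not have an identity. A system $(R,J_{1},\ldots,J_{n})$ is a structure in the language of Boolean rings with $n$ unary predicates; it is $\omega$-categorical if its first-order theory has, up to isomorphism, exactly one countable model; two systems $(R,J_{1},\ldots,J_{n})$ and $(S,K_{1},\ldots,K_{n})$ are isomorphic if there is a ring isomorphism $R\to S$ mapping $J_{i}$ onto $K_{i}$ for each $i$. A PO system is a set $P$ with an antisymmetric transitive relation $<$ (possibly $p<p$); $p\leqslant q$ means $p<q$ or $p=q$; $P^{d}=\{p\in P\mid p\not<p\}$. A lower subset $L$ of $P$ is one with $p\in L,\ q<p\Rightarrow q\in L$; $L_{\min}$ denotes the set of minimal elements of $(L,\leqslant)$ and $L_{\min}^{d}=L_{\min}\cap P^{d}$. An extended PO system is a triple $[P,L,f]$ with $P$ a PO system, $L$ a lower subset of $P$ and $f\colon L_{\min}^{d}\to\mathbb{N}_{+}$; it is finite-crowded if $P$ is finite and $P^{d}\subseteq L_{\min}$. $(2^{P},^{\prime})$ is the topological Boolean algebra of subsets of $P$ with $Q^{\prime}=\{p\in P\mid p<q\text{ for some }q\in Q\}$,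 and $\langle Q_{1},\ldots,Q_{n},^{\prime}\rangle$ is the smallest Boolean subalgebra of $2^{P}$ containing $Q_{1},\ldots,Q_{n}$ and closed under $^{\prime}$. Two tuples $[P_{1},L_{1},f_{1},Q_{11},\ldots,Q_{1n}]$ and $[P_{2},L_{2},f_{2},Q_{21},\ldots,Q_{2n}]$ are isomorphic if there is a bijection $\theta\colon P_{1}\to P_{2}$ preserving and reflecting $<$ such that $L_{1}\theta=L_{2}$, $Q_{1j}\theta=Q_{2j}$ for all $j$, and $f_{2}(p\theta)=f_{1}(p)$ for $p$ in the domain of $f_{1}$. *)

theory Defs
  imports "HOL-Analysis.Analysis" "HOL-Algebra.Group"
begin

section \<open>Boolean rings with distinguished ideals\<close>

text \<open>A structure in the language of Boolean rings (no constant for an identity) with a list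
  of unary predicates.\<close>

record 'a bsystem =
  sys_carrier :: "'a set"
  sys_add :: "'a \<Rightarrow> 'a \<Rightarrow> 'a"
  sys_mult :: "'a \<Rightarrow> 'a \<Rightarrow> 'a"
  sys_zero :: 'a
  sys_preds :: "'a set list"

definition is_structure :: "nat \<Rightarrow> 'a bsystem \<Rightarrow> bool" where
  "is_structure n M \<longleftrightarrow>
     sys_zero M \<in> sys_carrier M \<and>
     (\<forall>x\<in>sys_carrier M. \<forall>y\<in>sys_carrier M.
        sys_add M x y \<in> sys_carrier M \<and> sys_mult M x y \<in> sys_carrier M) \<and>
     length (sys_preds M) = n \<and> (\<forall>J\<in>set (sys_preds M). J \<subseteq> sys_carrier M)"

definition additive_group :: "'a bsystem \<Rightarrow> 'a monoid" where
  "additive_group M = \<lparr>carrier = sys_carrier M, monoid.mult = sys_add M, one = sys_zero M\<rparr>"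

text \<open>The library's rings with explicit carriers are unital, hence not usable here.\<close>

definition boolean_ring :: "'a bsystem \<Rightarrow> bool" where
  "boolean_ring M \<longleftrightarrow>
     comm_group (additive_group M) \<and>
     (\<forall>x\<in>sys_carrier M. \<forall>y\<in>sys_carrier M. sys_mult M x y \<in> sys_carrier M) \<and>
     (\<forall>x\<in>sys_carrier M. \<forall>y\<in>sys_carrier M. \<forall>z\<in>sys_carrier M.
        sys_mult M (sys_mult M x y) z = sys_mult M x (sys_mult M y z) \<and>
        sys_mult M x (sys_add M y z) = sys_add M (sys_mult M x y) (sys_mult M x z) \<and>
        sys_mult M (sys_add M x y) z = sys_add M (sys_mult M x z) (sys_mult M y z)) \<and>
     (\<forall>x\<in>sys_carrier M. sys_mult M x x = x)"

definition ring_ideal :: "'a bsystem \<Rightarrow> 'a set \<Rightarrow> bool" where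
  "ring_ideal M J \<longleftrightarrow>
     subgroup J (additive_group M) \<and>
     (\<forall>a\<in>J. \<forall>x\<in>sys_carrier M. sys_mult M x a \<in> J \<and> sys_mult M a x \<in> J)"

definition system_iso :: "'a bsystem \<Rightarrow> 'b bsystem \<Rightarrow> ('a \<Rightarrow> 'b) \<Rightarrow> bool" where
  "system_iso M N h \<longleftrightarrow>
     bij_betw h (sys_carrier M) (sys_carrier N) \<and>
     (\<forall>x\<in>sys_carrier M. \<forall>y\<in>sys_carrier M.
        h (sys_add M x y) = sys_add N (h x) (h y) \<and>
        h (sys_mult M x y) = sys_mult N (h x) (h y)) \<and>
     h (sys_zero M) = sys_zero N \<and>
     map (\<lambda>J. h ` J) (sys_preds M) = sys_preds N"

definition systems_isomorphic :: "'a bsystem \<Rightarrow> 'b bsystem \<Rightarrow> bool" where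
  "systems_isomorphic M N \<longleftrightarrow> (\<exists>h. system_iso M N h)"


section \<open>First-order theories and countable categoricity\<close>

datatype bterm = Var nat | Zero | Add bterm bterm | Mult bterm bterm

datatype bform =
  Equal bterm bterm | Pred nat bterm | Neg bform | Conj bform bform | Forall nat bform

fun term_val :: "'a bsystem \<Rightarrow> (nat \<Rightarrow> 'a) \<Rightarrow> bterm \<Rightarrow> 'a" where
  "term_val M e (Var v) = e v"
| "term_val M e Zero = sys_zero M"
| "term_val M e (Add s t) = sys_add M (term_val M e s) (term_val M e t)"
| "term_val M e (Mult s t) = sys_mult M (term_val M e s) (term_val M e t)"

fun satisfies :: "'a bsystem \<Rightarrow> (nat \<Rightarrow> 'a) \<Rightarrow> bform \<Rightarrow> bool" where
  "satisfies M e (Equal s t) \<longleftrightarrow> term_val M e s = term_val M e t"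
| "satisfies M e (Pred i t) \<longleftrightarrow> term_val M e t \<in> sys_preds M ! i"
| "satisfies M e (Neg A) \<longleftrightarrow> \<not> satisfies M e A"
| "satisfies M e (Conj A B) \<longleftrightarrow> satisfies M e A \<and> satisfies M e B"
| "satisfies M e (Forall v A) \<longleftrightarrow> (\<forall>x\<in>sys_carrier M. satisfies M (e(v := x)) A)"

fun term_vars :: "bterm \<Rightarrow> nat set" where
  "term_vars (Var v) = {v}"
| "term_vars Zero = {}"
| "term_vars (Add s t) = term_vars s \<union> term_vars t"
| "term_vars (Mult s t) = term_vars s \<union> term_vars t"

fun free_vars :: "bform \<Rightarrow> nat set" where
  "free_vars (Equal s t) = term_vars s \<union> term_vars t"
| "free_vars (Pred i t) = term_vars t"
| "free_vars (Neg A) = free_vars A"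
| "free_vars (Conj A B) = free_vars A \<union> free_vars B"
| "free_vars (Forall v A) = free_vars A - {v}"

fun pred_symbols :: "bform \<Rightarrow> nat set" where
  "pred_symbols (Equal s t) = {}"
| "pred_symbols (Pred i t) = {i}"
| "pred_symbols (Neg A) = pred_symbols A"
| "pred_symbols (Conj A B) = pred_symbols A \<union> pred_symbols B"
| "pred_symbols (Forall v A) = pred_symbols A"

definition sentences :: "nat \<Rightarrow> bform set" where
  "sentences n = {A. free_vars A = {} \<and> pred_symbols A \<subseteq> {..<n}}"

definition true_in :: "'a bsystem \<Rightarrow> bform \<Rightarrow> bool" where
  "true_in M A \<longleftrightarrow> (\<forall>e. range e \<subseteq> sys_carrier M \<longrightarrow> satisfies M e A)"

definition first_order_theory :: "nat \<Rightarrow> 'a bsystem \<Rightarrow> bform set" where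
  "first_order_theory n M = {A \<in> sentences n. true_in M A}"

definition countable_model :: "nat \<Rightarrow> bform set \<Rightarrow> 'a bsystem \<Rightarrow> bool" where
  "countable_model n T M \<longleftrightarrow>
     is_structure n M \<and> countable (sys_carrier M) \<and> (\<forall>A\<in>T. true_in M A)"

text \<open>Countable includes finite. Every countable structure is isomorphic to one whose carrier
  is a subset of the natural numbers, so it suffices to let models range over such structures.\<close>

definition omega_categorical :: "nat \<Rightarrow> 'a bsystem \<Rightarrow> bool" where
  "omega_categorical n M \<longleftrightarrow>
     (\<exists>N :: nat bsystem. countable_model n (first_order_theory n M) N \<and>
        (\<forall>N' :: nat bsystem.
           countable_model n (first_order_theory n M) N' \<longrightarrow> systems_isomorphic N' N))"

definition omega_categorical_systems :: "nat \<Rightarrow> 'a bsystem set" where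
  "omega_categorical_systems n =
     {M. is_structure n M \<and> boolean_ring M \<and> countable (sys_carrier M) \<and>
         (\<forall>J\<in>set (sys_preds M). ring_ideal M J) \<and> omega_categorical n M}"

definition system_iso_rel :: "nat \<Rightarrow> 'a bsystem rel" where
  "system_iso_rel n =
     {(M, N). M \<in> omega_categorical_systems n \<and> N \<in> omega_categorical_systems n \<and>
              systems_isomorphic M N}"


section \<open>Extended PO systems with lower subsets\<close>

text \<open>The tuple \<open>[P, L, f, Q\<^sub>1, \<dots>, Q\<^sub>n]\<close>; the values of \<open>f\<close> outside its
  intended domain \<open>L\<^sub>m\<^sub>i\<^sub>n\<^sup>d\<close> are irrelevant and are ignored throughout.\<close>

record 'p potuple =
  po_points :: "'p set"
  po_less :: "'p rel"
  po_L :: "'p set"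
  po_f :: "'p \<Rightarrow> nat"
  po_Qs :: "'p set list"

definition po_system :: "'p set \<Rightarrow> 'p rel \<Rightarrow> bool" where
  "po_system P r \<longleftrightarrow> r \<subseteq> P \<times> P \<and> antisym r \<and> trans r"

definition po_le :: "'p rel \<Rightarrow> 'p \<Rightarrow> 'p \<Rightarrow> bool" where
  "po_le r p q \<longleftrightarrow> (p, q) \<in> r \<or> p = q"

definition discrete_part :: "'p set \<Rightarrow> 'p rel \<Rightarrow> 'p set" where
  "discrete_part P r = {p \<in> P. (p, p) \<notin> r}"

definition lower_subset :: "'p set \<Rightarrow> 'p rel \<Rightarrow> 'p set \<Rightarrow> bool" where
  "lower_subset P r L \<longleftrightarrow> L \<subseteq> P \<and> (\<forall>p\<in>L. \<forall>q\<in>P. (q, p) \<in> r \<longrightarrow> q \<in> L)"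

definition minimal_elements :: "'p rel \<Rightarrow> 'p set \<Rightarrow> 'p set" where
  "minimal_elements r L = {p \<in> L. \<forall>q\<in>L. po_le r q p \<longrightarrow> q = p}"

definition L_min :: "'p potuple \<Rightarrow> 'p set" where
  "L_min T = minimal_elements (po_less T) (po_L T)"

definition L_min_d :: "'p potuple \<Rightarrow> 'p set" where
  "L_min_d T = L_min T \<inter> discrete_part (po_points T) (po_less T)"

definition extended_po_system :: "'p potuple \<Rightarrow> bool" where
  "extended_po_system T \<longleftrightarrow>
     po_system (po_points T) (po_less T) \<and>
     lower_subset (po_points T) (po_less T) (po_L T) \<and>
     (\<forall>p\<in>L_min_d T. po_f T p > 0)"

definition finite_crowded :: "'p potuple \<Rightarrow> bool" where
  "finite_crowded T \<longleftrightarrow>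
     finite (po_points T) \<and> discrete_part (po_points T) (po_less T) \<subseteq> L_min T"

definition po_derivative :: "'p set \<Rightarrow> 'p rel \<Rightarrow> 'p set \<Rightarrow> 'p set" where
  "po_derivative P r Q = {p \<in> P. \<exists>q\<in>Q. (p, q) \<in> r}"

definition generated_algebra :: "'p set \<Rightarrow> 'p rel \<Rightarrow> 'p set set \<Rightarrow> 'p set set" where
  "generated_algebra P r G =
     \<Inter> {\<A>. algebra P \<A> \<and> G \<subseteq> \<A> \<and> (\<forall>Q\<in>\<A>. po_derivative P r Q \<in> \<A>)}"

definition po_tuples :: "nat \<Rightarrow> 'p potuple set" where
  "po_tuples n =
     {T. extended_po_system T \<and> finite_crowded T \<and> length (po_Qs T) = n \<and>
         (\<forall>Q\<in>set (po_Qs T). lower_subset (po_points T) (po_less T) Q) \<and>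
         generated_algebra (po_points T) (po_less T) (set (po_Qs T)) = Pow (po_points T)}"

definition potuple_iso :: "'p potuple \<Rightarrow> 'q potuple \<Rightarrow> ('p \<Rightarrow> 'q) \<Rightarrow> bool" where
  "potuple_iso S T h \<longleftrightarrow>
     bij_betw h (po_points S) (po_points T) \<and>
     (\<forall>p\<in>po_points S. \<forall>q\<in>po_points S. (p, q) \<in> po_less S \<longleftrightarrow> (h p, h q) \<in> po_less T) \<and>
     h ` po_L S = po_L T \<and>
     map (\<lambda>Q. h ` Q) (po_Qs S) = po_Qs T \<and>
     (\<forall>p\<in>L_min_d S. po_f T (h p) = po_f S p)"

definition potuple_iso_rel :: "nat \<Rightarrow> 'p potuple rel" where
  "potuple_iso_rel n =
     {(S, T). S \<in> po_tuples n \<and> T \<in> po_tuples n \<and> (\<exists>h. potuple_iso S T h)}"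


section \<open>The natural correspondence\<close>

text \<open>The points of the Stone space of a Boolean ring are its (proper) prime ideals.\<close>

definition stone_points :: "'a bsystem \<Rightarrow> 'a set set" where
  "stone_points M =
     {I. ring_ideal M I \<and> I \<noteq> sys_carrier M \<and>
         (\<forall>x\<in>sys_carrier M. \<forall>y\<in>sys_carrier M. sys_mult M x y \<in> I \<longrightarrow> x \<in> I \<or> y \<in> I)}"

definition stone_space :: "'a bsystem \<Rightarrow> 'a set topology" where
  "stone_space M =
     topology_generated_by ((\<lambda>a. {I \<in> stone_points M. a \<notin> I}) ` sys_carrier M)"

text \<open>The closed set corresponding to an ideal \<open>J\<close>: the complement of the union of the
  compact open sets belonging to the elements of \<open>J\<close>.\<close>

definition closed_set_of_ideal :: "'a bsystem \<Rightarrow> 'a set \<Rightarrow> 'a set set" where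
  "closed_set_of_ideal M J = {I \<in> stone_points M. J \<subseteq> I}"

text \<open>A partition \<open>{X\<^sub>p | p \<in> P}\<close> of the Stone space into nonempty sets realises the tuple
  \<open>[P, L, f, Q\<^sub>1, \<dots>, Q\<^sub>n]\<close> for \<open>(R, J\<^sub>1, \<dots>, J\<^sub>n)\<close> if the order describes the derived sets
  of the \<open>X\<^sub>p\<close>, \<open>L\<close> singles out those with compact closure, \<open>f\<close> counts the points of
  the finite ones, and the \<open>Q\<^sub>i\<close> describe the closed sets of the ideals.\<close>

definition realises ::
    "'a bsystem \<Rightarrow> 'p potuple \<Rightarrow> ('p \<Rightarrow> 'a set set) \<Rightarrow> bool" where
  "realises M T X \<longleftrightarrow>
     (\<forall>p\<in>po_points T. X p \<noteq> {}) \<and>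
     disjoint_family_on X (po_points T) \<and>
     (\<Union>p\<in>po_points T. X p) = stone_points M \<and>
     (\<forall>p\<in>po_points T.
        stone_space M derived_set_of X p = (\<Union>q\<in>{q \<in> po_points T. (q, p) \<in> po_less T}. X q)) \<and>
     po_L T = {p \<in> po_points T. compactin (stone_space M) (stone_space M closure_of X p)} \<and>
     (\<forall>p\<in>L_min_d T. finite (X p) \<and> card (X p) = po_f T p) \<and>
     map (closed_set_of_ideal M) (sys_preds M) = map (\<lambda>Q. \<Union>p\<in>Q. X p) (po_Qs T)"

definition represents :: "'p potuple \<Rightarrow> 'a bsystem \<Rightarrow> bool" where
  "represents T M \<longleftrightarrow> (\<exists>X. realises M T X)"

text \<open>The map induced on isomorphism classes. That the result is again an isomorphism class
  is not built in.\<close>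

definition natural_map :: "nat \<Rightarrow> 'a bsystem set \<Rightarrow> 'p potuple set" where
  "natural_map n C = {T \<in> po_tuples n. \<exists>M\<in>C. represents T M}"

end

theory Submission
  imports Defs
begin

text \<open>The points \<open>p\<close> of the tuple are the atoms of the finite algebra of subsets of the Stone space
  generated by the closed sets of the ideals under Boolean operations and derived sets. It is finite
  because a countably categorical structure has only finitely many definable subsets (otherwise a
  non-isolated type is realised in one countable model and omitted in another), and because derived
  sets of definable closed sets are again given by definable ideals: for a definable set the
  condition "at least \<open>m\<close> points" is definable and must become constant in \<open>m\<close>.
  The tuple determines the system by back and forth: for two spaces with the same tuple, matching
  finite partitions into clopen pieces that meet the same parts \<open>X\<^sub>p\<close> (in the same number of points
  if \<open>X\<^sub>p\<close> is discrete) extend to any further compact open set. This argument also bounds the number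
  of types, so every realised system is countably categorical. Conversely, every tuple is realised on
  a space of paths whose labels increase in \<open>P\<close>.\<close>

section \<open>First-order formulas\<close>

text \<open>Rings need not have an identity, so Stone spaces are only locally compact, and a cell of
  a finite partition may be the complement of a compact open set. Matching such cells is where the
  lower subset \<open>L\<close> enters: it tells which parts stay inside a compact set. Antisymmetry
  of \<open><\<close> does not come from atomicity alone. It holds because the sets of the algebra
  are Boolean combinations of finitely many closed sets: two atoms, each inside the derived set of
  the other, cannot be told apart by these closed sets on a small enough neighbourhood. The
  condition that the \<open>Q\<^sub>i\<close> generate all of \<open>2^P\<close> makes the tuple
  unique: it forces two partitions that realise tuples for one system to have the same blocks. The
  topology is done for an abstract set of points with a ring of subsets, so that it applies to prime
  ideals and to paths alike. On the logical side, categoricity is used through the finiteness of the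
  family of one-variable definable sets, and it is proved from the finiteness of the set of types in
  \<open>k\<close> variables for each \<open>k\<close>.\<close>

instance bterm :: countable by countable_datatype
instance bform :: countable by countable_datatype

definition envs :: "'a bsystem \<Rightarrow> (nat \<Rightarrow> 'a) set" where
  "envs M = {e. range e \<subseteq> sys_carrier M}"

definition forms :: "nat \<Rightarrow> bform set" where
  "forms n = {A. pred_symbols A \<subseteq> {..<n}}"

lemma envs_upd: "e \<in> envs M \<Longrightarrow> x \<in> sys_carrier M \<Longrightarrow> e(v := x) \<in> envs M"
  by (auto simp: envs_def)

lemma envs_comp: "e \<in> envs M \<Longrightarrow> e \<circ> s \<in> envs M"
  by (auto simp: envs_def)

lemma forms_simps [simp]:
  "Equal s t \<in> forms n"
  "Pred i t \<in> forms n \<longleftrightarrow> i < n"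
  "Neg A \<in> forms n \<longleftrightarrow> A \<in> forms n"
  "Conj A B \<in> forms n \<longleftrightarrow> A \<in> forms n \<and> B \<in> forms n"
  "Forall v A \<in> forms n \<longleftrightarrow> A \<in> forms n"
  by (auto simp: forms_def)

lemma finite_term_vars: "finite (term_vars t)"
  by (induction t) auto

lemma finite_free_vars: "finite (free_vars A)"
  by (induction A) (auto simp: finite_term_vars)

lemma term_val_cong:
  "(\<And>v. v \<in> term_vars t \<Longrightarrow> e v = e' v) \<Longrightarrow> term_val M e t = term_val M e' t"
  by (induction t) auto

lemma satisfies_cong:
  "(\<And>v. v \<in> free_vars A \<Longrightarrow> e v = e' v) \<Longrightarrow> satisfies M e A \<longleftrightarrow> satisfies M e' A"
proof (induction A arbitrary: e e')
  case (Equal s t)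
  then show ?case using term_val_cong[of s e e' M] term_val_cong[of t e e' M] by auto
next
  case (Pred i t)
  then show ?case using term_val_cong[of t e e' M] by auto
next
  case (Neg A) from Neg.IH[of e e'] Neg.prems show ?case by auto
next
  case (Conj A B) from Conj.IH(1)[of e e'] Conj.IH(2)[of e e'] Conj.prems show ?case by auto
next
  case (Forall v A)
  have "satisfies M (e(v := x)) A \<longleftrightarrow> satisfies M (e'(v := x)) A" for x
    by (rule Forall.IH) (use Forall.prems in auto)
  then show ?case by simp
qed

fun tsubst :: "(nat \<Rightarrow> nat) \<Rightarrow> bterm \<Rightarrow> bterm" where
  "tsubst s (Var v) = Var (s v)"
| "tsubst s Zero = Zero"
| "tsubst s (Add t u) = Add (tsubst s t) (tsubst s u)"
| "tsubst s (Mult t u) = Mult (tsubst s t) (tsubst s u)"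

text \<open>The renaming \<open>s\<close> may identify variables, and later uses send all of them to
  a single one. The bound variable therefore moves to one outside the image of the free variables,
  so that nothing is captured.\<close>

fun fsubst :: "(nat \<Rightarrow> nat) \<Rightarrow> bform \<Rightarrow> bform" where
  "fsubst s (Equal t u) = Equal (tsubst s t) (tsubst s u)"
| "fsubst s (Pred i t) = Pred i (tsubst s t)"
| "fsubst s (Neg A) = Neg (fsubst s A)"
| "fsubst s (Conj A B) = Conj (fsubst s A) (fsubst s B)"
| "fsubst s (Forall v A) =
     (let w = (SOME w. w \<notin> s ` free_vars A) in Forall w (fsubst (s(v := w)) A))"

lemma fresh_var: "finite V \<Longrightarrow> (SOME w::nat. w \<notin> V) \<notin> V"
  by (metis (mono_tags) ex_new_if_finite infinite_UNIV_nat someI_ex)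

lemma term_val_tsubst: "term_val M e (tsubst s t) = term_val M (e \<circ> s) t"
  by (induction t) auto

lemma satisfies_fsubst: "satisfies M e (fsubst s A) \<longleftrightarrow> satisfies M (e \<circ> s) A"
proof (induction A arbitrary: e s)
  case (Forall v A)
  define w where "w = (SOME w. w \<notin> s ` free_vars A)"
  have w: "w \<notin> s ` free_vars A"
    unfolding w_def by (rule fresh_var) (simp add: finite_free_vars)
  have "satisfies M (e(w := x)) (fsubst (s(v := w)) A) \<longleftrightarrow> satisfies M ((e \<circ> s)(v := x)) A" for x
  proof -
    have "satisfies M (e(w := x)) (fsubst (s(v := w)) A) \<longleftrightarrow>
          satisfies M (e(w := x) \<circ> s(v := w)) A" by (rule Forall.IH)
    also have "\<dots> \<longleftrightarrow> satisfies M ((e \<circ> s)(v := x)) A"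
      by (rule satisfies_cong) (use w in auto)
    finally show ?thesis .
  qed
  then show ?case by (simp add: Let_def comp_def flip: w_def)
qed (auto simp: term_val_tsubst)

lemma pred_symbols_fsubst: "pred_symbols (fsubst s A) = pred_symbols A"
  by (induction A arbitrary: s) (auto simp: Let_def)

lemma fsubst_forms [simp]: "fsubst s A \<in> forms n \<longleftrightarrow> A \<in> forms n"
  by (simp add: forms_def pred_symbols_fsubst)

lemma term_vars_tsubst: "term_vars (tsubst s t) = s ` term_vars t"
  by (induction t) auto

lemma free_vars_fsubst: "free_vars (fsubst s A) \<subseteq> s ` free_vars A"
proof (induction A arbitrary: s)
  case (Forall v A)
  define w where "w = (SOME w. w \<notin> s ` free_vars A)"
  have "free_vars (fsubst (s(v := w)) A) \<subseteq> (s(v := w)) ` free_vars A" by (rule Forall.IH)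
  then show ?case by (auto simp: Let_def simp flip: w_def)
qed (auto simp: term_vars_tsubst, blast+)

definition fall :: "nat list \<Rightarrow> bform \<Rightarrow> bform" where
  "fall vs A = foldr Forall vs A"

lemma fall_forms [simp]: "fall vs A \<in> forms n \<longleftrightarrow> A \<in> forms n"
  by (induction vs) (auto simp: fall_def)

lemma free_vars_fall: "free_vars (fall vs A) = free_vars A - set vs"
  by (induction vs) (auto simp: fall_def)

lemma satisfies_fall:
  assumes "e \<in> envs M"
  shows "satisfies M e (fall vs A) \<longleftrightarrow>
    (\<forall>e'\<in>envs M. (\<forall>v. v \<notin> set vs \<longrightarrow> e' v = e v) \<longrightarrow> satisfies M e' A)"
  using assms
proof (induction vs arbitrary: e)
  case Nil
  have "e' = e" if "\<forall>v. e' v = e v" for e' using that by auto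
  then show ?case using Nil by (auto simp: fall_def) 
next
  case (Cons w vs)
  have *: "satisfies M e (fall (w # vs) A) \<longleftrightarrow>
      (\<forall>x\<in>sys_carrier M. satisfies M (e(w := x)) (fall vs A))"
    by (simp add: fall_def)
  show ?case
  proof
    assume L: "satisfies M e (fall (w # vs) A)"
    show "\<forall>e'\<in>envs M. (\<forall>v. v \<notin> set (w # vs) \<longrightarrow> e' v = e v) \<longrightarrow> satisfies M e' A"
    proof (intro ballI impI)
      fix e' assume e': "e' \<in> envs M" "\<forall>v. v \<notin> set (w # vs) \<longrightarrow> e' v = e v"
      then have x: "e' w \<in> sys_carrier M" by (auto simp: envs_def)
      have "satisfies M (e(w := e' w)) (fall vs A)" using L x * by blast
      then show "satisfies M e' A"
        using Cons.IH[OF envs_upd[OF Cons.prems x]] e' by auto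
    qed
  next
    assume R: "\<forall>e'\<in>envs M. (\<forall>v. v \<notin> set (w # vs) \<longrightarrow> e' v = e v) \<longrightarrow> satisfies M e' A"
    show "satisfies M e (fall (w # vs) A)"
    proof (unfold *, rule ballI)
      fix x assume x: "x \<in> sys_carrier M"
      show "satisfies M (e(w := x)) (fall vs A)"
        unfolding Cons.IH[OF envs_upd[OF Cons.prems x]] using R by auto
    qed
  qed
qed

lemma true_in_sentence:
  assumes "free_vars A = {}" "e \<in> envs M"
  shows "true_in M A \<longleftrightarrow> satisfies M e A"
proof -
  have "satisfies M e' A \<longleftrightarrow> satisfies M e A" for e'
    by (rule satisfies_cong) (use assms in auto)
  then show ?thesis using assms(2) by (auto simp: true_in_def envs_def)
qed

lemma envs_nonempty: "is_structure n M \<Longrightarrow> (\<lambda>_. sys_zero M) \<in> envs M"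
  by (auto simp: envs_def is_structure_def)

definition elem_equiv :: "nat \<Rightarrow> 'a bsystem \<Rightarrow> 'b bsystem \<Rightarrow> bool" where
  "elem_equiv n M N \<longleftrightarrow> (\<forall>A\<in>sentences n. true_in M A \<longleftrightarrow> true_in N A)"

text \<open>One direction is enough because the theory of a structure is complete: the other one
  follows by applying it to the negation. The zero element provides an environment in which to
  evaluate sentences.\<close>

lemma elem_equivI:
  assumes "is_structure n M" "is_structure n N"
    and "\<And>A. A \<in> sentences n \<Longrightarrow> true_in M A \<Longrightarrow> true_in N A"
  shows "elem_equiv n M N"
  unfolding elem_equiv_def
proof (intro ballI iffI)
  fix A assume A: "A \<in> sentences n" "true_in N A"
  show "true_in M A"
  proof (rule ccontr)
    assume "\<not> true_in M A"
    moreover have fv: "free_vars A = {}" "free_vars (Neg A) = {}"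
      using A by (auto simp: sentences_def)
    ultimately have "true_in M (Neg A)"
      using true_in_sentence[OF fv(1) envs_nonempty[OF assms(1)]]
        true_in_sentence[OF fv(2) envs_nonempty[OF assms(1)]] by simp
    then have "true_in N (Neg A)" using assms(3) A by (auto simp: sentences_def)
    then show False using A(2) envs_nonempty[OF assms(2)]
      by (auto simp: true_in_def envs_def)
  qed
qed (use assms in auto)

lemma satisfies_iso:
  assumes h: "system_iso M N h" and st: "is_structure n M" and A: "A \<in> forms n" and e: "e \<in> envs M"
  shows "satisfies M e A \<longleftrightarrow> satisfies N (h \<circ> e) A"
proof -
  have bij: "bij_betw h (sys_carrier M) (sys_carrier N)"
    and pr: "map (\<lambda>J. h ` J) (sys_preds M) = sys_preds N"
    using h by (auto simp: system_iso_def)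
  have tv: "term_val M e t \<in> sys_carrier M \<and> h (term_val M e t) = term_val N (h \<circ> e) t"
    if "e \<in> envs M" for e t
    by (induction t) (use that h st in \<open>auto simp: system_iso_def is_structure_def envs_def\<close>)
  show ?thesis using A e
  proof (induction A arbitrary: e)
    case (Equal s t)
    then show ?case using tv[of e s] tv[of e t] bij unfolding bij_betw_def inj_on_def
      by (metis satisfies.simps(1))
  next
    case (Pred i t)
    have len: "i < length (sys_preds M)" using Pred st by (auto simp: is_structure_def)
    then have 1: "sys_preds N ! i = h ` (sys_preds M ! i)" using pr by (metis nth_map)
    have 2: "sys_preds M ! i \<subseteq> sys_carrier M" using st len by (auto simp: is_structure_def)
    have "x \<in> sys_preds M ! i \<longleftrightarrow> h x \<in> sys_preds N ! i" if "x \<in> sys_carrier M" for x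
      using 1 2 bij that unfolding bij_betw_def by (metis inj_on_image_mem_iff)
    then show ?case using tv[of e t] Pred by (metis satisfies.simps(2))
  next
    case (Forall v A)
    have "satisfies M (e(v := x)) A = satisfies N ((h \<circ> e)(v := h x)) A"
      if "x \<in> sys_carrier M" for x
    proof -
      have "h \<circ> e(v := x) = (h \<circ> e)(v := h x)" by auto
      then show ?thesis using Forall.IH[OF _ envs_upd[OF Forall.prems(2) that]] Forall.prems(1)
        by (metis forms_simps(5))
    qed
    moreover have "sys_carrier N = h ` sys_carrier M" using bij by (auto simp: bij_betw_def)
    ultimately show ?case by (simp only: satisfies.simps ball_simps cong: ball_cong)
  qed auto
qed

section \<open>Omitting types\<close>

text \<open>Consistency is finite satisfiability inside the fixed structure \<open>M\<close>, so no
  proof calculus is involved. All formulas share one environment: free variables act as the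
  constants of a Henkin construction.\<close>

definition con :: "'a bsystem \<Rightarrow> bform set \<Rightarrow> bform \<Rightarrow> bool" where
  "con M \<Sigma> B \<longleftrightarrow> (\<forall>F. finite F \<longrightarrow> F \<subseteq> \<Sigma> \<longrightarrow>
     (\<exists>e\<in>envs M. satisfies M e B \<and> (\<forall>A\<in>F. satisfies M e A)))"

lemma con_decide:
  assumes "con M \<Sigma> B"
  shows "con M \<Sigma> (Conj B A) \<or> con M \<Sigma> (Conj B (Neg A))"
proof (rule ccontr)
  assume "\<not> ?thesis"
  then obtain F1 F2 where F: "finite F1" "F1 \<subseteq> \<Sigma>" "finite F2" "F2 \<subseteq> \<Sigma>"
    and n: "\<And>e. e \<in> envs M \<Longrightarrow> satisfies M e (Conj B A) \<Longrightarrow> \<exists>A\<in>F1. \<not> satisfies M e A"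
      "\<And>e. e \<in> envs M \<Longrightarrow> satisfies M e (Conj B (Neg A)) \<Longrightarrow> \<exists>A\<in>F2. \<not> satisfies M e A"
    unfolding con_def by metis
  obtain e where "e \<in> envs M" "satisfies M e B" "\<forall>A\<in>F1 \<union> F2. satisfies M e A"
    using assms F unfolding con_def by (metis finite_UnI Un_least)
  then show False using n[of e] by auto
qed

text \<open>The formulas of \<open>\<Sigma>\<close> have only variable 0 free, so one variable can
  be fresh for all of \<open>\<Sigma>\<close> and for \<open>A\<close> and \<open>B\<close> at once.
  The value of a counterexample to \<open>A\<close> is stored there without disturbing the other
  formulas.\<close>

lemma con_witness:
  assumes "con M \<Sigma> B" and \<Sigma>: "\<And>A. A \<in> \<Sigma> \<Longrightarrow> free_vars A \<subseteq> {0}"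
  shows "con M \<Sigma> (Conj B (Forall v A)) \<or> (\<exists>w. con M \<Sigma> (Conj B (Neg (fsubst (id(v := w)) A))))"
proof (cases "con M \<Sigma> (Conj B (Forall v A))")
  case False
  then obtain F where F: "finite F" "F \<subseteq> \<Sigma>"
    and n: "\<And>e. e \<in> envs M \<Longrightarrow> satisfies M e (Conj B (Forall v A)) \<Longrightarrow> \<exists>A\<in>F. \<not> satisfies M e A"
    unfolding con_def by metis
  define V where "V = {0, v} \<union> free_vars B \<union> free_vars A"
  define w where "w = (SOME w. w \<notin> V)"
  have w: "w \<notin> V" unfolding w_def V_def by (rule fresh_var) (simp add: finite_free_vars)
  have "con M \<Sigma> (Conj B (Neg (fsubst (id(v := w)) A)))"
    unfolding con_def
  proof (intro allI impI)
    fix G assume G: "finite G" "G \<subseteq> \<Sigma>"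
    obtain e where e: "e \<in> envs M" "satisfies M e B" "\<forall>A\<in>F \<union> G. satisfies M e A"
      using assms(1) F G unfolding con_def by (metis finite_UnI Un_least)
    then obtain x where x: "x \<in> sys_carrier M" "\<not> satisfies M (e(v := x)) A"
      using n[of e] by auto
    have 1: "satisfies M (e(w := x)) B \<longleftrightarrow> satisfies M e B"
      by (rule satisfies_cong) (use w V_def in auto)
    have 2: "satisfies M (e(w := x)) C \<longleftrightarrow> satisfies M e C" if "C \<in> \<Sigma>" for C
      by (rule satisfies_cong) (use w V_def \<Sigma>[OF that] in auto)
    have 3: "satisfies M (e(w := x) \<circ> id(v := w)) A \<longleftrightarrow> satisfies M (e(v := x)) A"
      by (rule satisfies_cong) (use w V_def in auto)
    show "\<exists>e\<in>envs M. satisfies M e (Conj B (Neg (fsubst (id(v := w)) A))) \<and> (\<forall>A\<in>G. satisfies M e A)"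
      by (rule bexI[of _ "e(w := x)"])
        (use 1 2 3 e x G envs_upd in \<open>auto simp: satisfies_fsubst\<close>)
  qed
  then show ?thesis by blast
qed simp

definition henkin_set :: "nat \<Rightarrow> 'a bsystem \<Rightarrow> bform set \<Rightarrow> bool" where
  "henkin_set n M U \<longleftrightarrow> U \<subseteq> forms n \<and>
    (\<forall>F. finite F \<longrightarrow> F \<subseteq> U \<longrightarrow> (\<exists>e\<in>envs M. \<forall>A\<in>F. satisfies M e A)) \<and>
    (\<forall>A\<in>forms n. A \<in> U \<or> Neg A \<in> U) \<and>
    (\<forall>v A. Neg (Forall v A) \<in> U \<longrightarrow> (\<exists>w. Neg (fsubst (id(v := w)) A) \<in> U))"

text \<open>Every demand on \<open>U\<close> has the form "contain some formula of this set". There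
  are countably many such sets, and they are met one after the other by a growing conjunction that
  stays consistent with \<open>\<Sigma>\<close>.\<close>

lemma henkin_set_exists:
  fixes M :: "'a bsystem" and \<D> :: "nat \<Rightarrow> bform set"
  assumes fs: "\<And>F. finite F \<Longrightarrow> F \<subseteq> \<Sigma> \<Longrightarrow> \<exists>e\<in>envs M. \<forall>A\<in>F. satisfies M e A"
    and \<Sigma>: "\<And>A. A \<in> \<Sigma> \<Longrightarrow> free_vars A \<subseteq> {0}" "\<Sigma> \<subseteq> forms n"
    and \<D>: "\<And>j. \<D> j \<subseteq> forms n"
    and dense: "\<And>j B. B \<in> forms n \<Longrightarrow> con M \<Sigma> B \<Longrightarrow> \<exists>D\<in>\<D> j. con M \<Sigma> (Conj B D)"
  shows "\<exists>U. henkin_set n M U \<and> \<Sigma> \<subseteq> U \<and> (\<forall>j. \<D> j \<inter> U \<noteq> {})"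
proof -
  \<comment> \<open>The three kinds of demand: the given families, a decision about each formula,
    and a witness for each failing universal formula.\<close>
  define \<R> where "\<R> = range \<D> \<union> (\<lambda>A. {A, Neg A}) ` forms n
     \<union> (\<lambda>(v, A). insert (Forall v A) (range (\<lambda>w. Neg (fsubst (id(v := w)) A)))) ` (UNIV \<times> forms n)"
  have cR: "countable \<R>"
    unfolding \<R>_def by (intro countable_Un countable_image countable_SIGMA) auto
  have neR: "\<R> \<noteq> {}" by (auto simp: \<R>_def)
  have forR: "D \<subseteq> forms n" if "D \<in> \<R>" for D
    using that \<D> by (auto simp: \<R>_def)
  have denR: "\<exists>C\<in>D. con M \<Sigma> (Conj B C)" if DR: "D \<in> \<R>" "B \<in> forms n" "con M \<Sigma> B" for D B
  proof -
    have "(\<exists>j. D = \<D> j) \<or> (\<exists>A. D = {A, Neg A}) \<or>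
        (\<exists>v A. D = insert (Forall v A) (range (\<lambda>w. Neg (fsubst (id(v := w)) A))))"
      using DR(1) unfolding \<R>_def Un_iff by (elim disjE) (auto simp del: id_apply)
    then consider j where "D = \<D> j" | A where "D = {A, Neg A}"
      | v A where "D = insert (Forall v A) (range (\<lambda>w. Neg (fsubst (id(v := w)) A)))"
      by metis
    then show ?thesis
    proof cases
      case 1 then show ?thesis using dense DR by auto
    next
      case 2 then show ?thesis using con_decide[OF DR(3)] by auto
    next
      case 3 then show ?thesis using con_witness[OF DR(3) \<Sigma>(1), of v A] by auto
    qed
  qed
  define R where "R = from_nat_into \<R>"
  have R: "range R = \<R>" unfolding R_def using range_from_nat_into[OF neR cR] .
  have c0: "con M \<Sigma> (Equal Zero Zero)" using fs by (auto simp: con_def)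
  have "\<exists>\<phi>. \<forall>i. (\<phi> i \<in> forms n \<and> con M \<Sigma> (\<phi> i)) \<and>
      (\<exists>C\<in>R i. \<phi> (Suc i) = Conj (\<phi> i) C)"
  proof (rule dependent_nat_choice)
    show "\<exists>x. x \<in> forms n \<and> con M \<Sigma> x" using c0 by (intro exI[of _ "Equal Zero Zero"]) auto
  next
    fix B i assume B: "B \<in> forms n \<and> con M \<Sigma> B"
    have "R i \<in> \<R>" using R by auto
    then obtain C where "C \<in> R i" "con M \<Sigma> (Conj B C)" using denR B by blast
    then show "\<exists>y. (y \<in> forms n \<and> con M \<Sigma> y) \<and> (\<exists>C\<in>R i. y = Conj B C)"
      using B forR[OF \<open>R i \<in> \<R>\<close>] by (intro exI[of _ "Conj B C"]) auto
  qed
  then obtain \<phi> where \<phi>: "\<And>i. \<phi> i \<in> forms n" "\<And>i. con M \<Sigma> (\<phi> i)"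
    "\<And>i. \<exists>C\<in>R i. \<phi> (Suc i) = Conj (\<phi> i) C" by blast
  then obtain C where C: "\<And>i. C i \<in> R i" "\<And>i. \<phi> (Suc i) = Conj (\<phi> i) (C i)" by metis
  define U where "U = range C"
  have step: "i \<le> j \<Longrightarrow> satisfies M e (\<phi> j) \<Longrightarrow> satisfies M e (\<phi> i)" for e i j
    by (induction j) (auto simp: C(2) le_Suc_eq)
  have fsU: "\<exists>e\<in>envs M. \<forall>A\<in>F. satisfies M e A" if F: "finite F" "F \<subseteq> U \<union> \<Sigma>" for F
  proof -
    have "finite (F \<inter> U)" "F \<inter> U \<subseteq> range C" using F by (auto simp: U_def)
    then obtain I where I: "finite I" "F \<inter> U = C ` I"
      by (meson finite_subset_image)
    define k where "k = Suc (Max (insert 0 I))"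
    obtain e where e: "e \<in> envs M" "satisfies M e (\<phi> k)" "\<forall>A\<in>F - U. satisfies M e A"
      using \<phi>(2)[of k] F unfolding con_def
      by (metis (no_types, lifting) Diff_subset_conv finite_Diff)
    have "satisfies M e (C i)" if "i \<in> I" for i
    proof -
      have "Suc i \<le> k" using I(1) that by (simp add: k_def)
      then show ?thesis using step[OF _ e(2), of "Suc i"] C(2) by simp
    qed
    then have "satisfies M e A" if "A \<in> F" "A \<in> U" for A using that I(2) by (metis IntI imageE)
    then show ?thesis using e by (metis DiffI)
  qed
  have dec: "\<exists>A\<in>D. A \<in> U" if "D \<in> \<R>" for D
    using that R C(1) unfolding U_def by (metis rangeE rangeI)
  have comp: "A \<in> U \<or> Neg A \<in> U" if "A \<in> forms n" for A
    using dec[of "{A, Neg A}"] that by (auto simp: \<R>_def)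
  have no: "\<not> (A \<in> U \<union> \<Sigma> \<and> Neg A \<in> U \<union> \<Sigma>)" for A
    using fsU[of "{A, Neg A}"] by auto
  \<comment> \<open>The formulas of \<open>\<Sigma>\<close> are never added explicitly. They are
    decided along the way, and a negative decision would contradict consistency with
    \<open>\<Sigma>\<close>.\<close>
  have sU: "\<Sigma> \<subseteq> U" using \<Sigma>(2) comp no by blast
  have fU: "U \<subseteq> forms n" using C(1) forR R unfolding U_def by blast
  have "\<exists>w. Neg (fsubst (id(v := w)) A) \<in> U" if "Neg (Forall v A) \<in> U" for v A
  proof -
    have "A \<in> forms n" using that fU by auto
    then have "insert (Forall v A) (range (\<lambda>w. Neg (fsubst (id(v := w)) A))) \<in> \<R>"
      unfolding \<R>_def by (intro UnI2 image_eqI[of _ _ "(v, A)"]) auto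
    from dec[OF this] no[of "Forall v A"] that show ?thesis by auto
  qed
  moreover have "\<D> j \<inter> U \<noteq> {}" for j using dec[of "\<D> j"] by (auto simp: \<R>_def)
  ultimately show ?thesis
    using fsU comp sU fU unfolding henkin_set_def
    by (metis le_supI1)
qed

section \<open>The term model of a Henkin set\<close>

locale henkin =
  fixes n :: nat and M :: "'a bsystem" and U :: "bform set"
  assumes hs: "henkin_set n M U" and st: "is_structure n M"
begin

lemma U_forms: "A \<in> U \<Longrightarrow> A \<in> forms n"
  using hs by (auto simp: henkin_set_def)

lemma U_fs: "finite F \<Longrightarrow> F \<subseteq> U \<Longrightarrow> \<exists>e\<in>envs M. \<forall>A\<in>F. satisfies M e A"
  using hs by (auto simp: henkin_set_def)

text \<open>Otherwise completeness puts \<open>Neg B\<close> into \<open>U\<close>, and the finite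
  set \<open>F\<close> with \<open>Neg B\<close> has no satisfying environment. Every closure
  property of \<open>U\<close> below is an instance.\<close>

lemma U_cons:
  assumes "finite F" "F \<subseteq> U" "B \<in> forms n"
    and "\<And>e. e \<in> envs M \<Longrightarrow> \<forall>A\<in>F. satisfies M e A \<Longrightarrow> satisfies M e B"
  shows "B \<in> U"
proof (rule ccontr)
  assume "B \<notin> U"
  then have "Neg B \<in> U" using hs assms by (auto simp: henkin_set_def)
  then show False using U_fs[of "insert (Neg B) F"] assms by auto
qed

lemma U_Neg: "A \<in> forms n \<Longrightarrow> Neg A \<in> U \<longleftrightarrow> A \<notin> U"
  using hs U_fs[of "{A, Neg A}"] by (auto simp: henkin_set_def)

lemma U_Conj: "Conj A B \<in> U \<longleftrightarrow> A \<in> U \<and> B \<in> U"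
proof
  assume *: "Conj A B \<in> U"
  show "A \<in> U \<and> B \<in> U"
    using U_cons[of "{Conj A B}"] * U_forms[OF *] by auto
next
  assume *: "A \<in> U \<and> B \<in> U"
  then show "Conj A B \<in> U"
    using U_cons[of "{A, B}"] * U_forms by auto
qed

lemma U_eq1:
  assumes "B \<in> U" "C \<in> forms n" "\<And>e. e \<in> envs M \<Longrightarrow> satisfies M e B \<Longrightarrow> satisfies M e C"
  shows "C \<in> U"
  using U_cons[of "{B}" C] assms by auto

lemma U_eq2:
  assumes "A \<in> U" "B \<in> U" "C \<in> forms n"
    "\<And>e. e \<in> envs M \<Longrightarrow> satisfies M e A \<Longrightarrow> satisfies M e B \<Longrightarrow> satisfies M e C"
  shows "C \<in> U"
  using U_cons[of "{A, B}" C] assms by auto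

lemma U_Forall:
  assumes "Forall v A \<in> forms n"
  shows "Forall v A \<in> U \<longleftrightarrow> (\<forall>w. fsubst (id(v := w)) A \<in> U)"
proof
  assume "Forall v A \<in> U"
  show "\<forall>w. fsubst (id(v := w)) A \<in> U"
  proof
    fix w
    show "fsubst (id(v := w)) A \<in> U"
    proof (rule U_eq1[OF \<open>Forall v A \<in> U\<close>])
      fix e assume "e \<in> envs M" "satisfies M e (Forall v A)"
      moreover from this have "e w \<in> sys_carrier M" by (auto simp: envs_def)
      moreover have "e \<circ> id(v := w) = e(v := e w)" by auto
      ultimately show "satisfies M e (fsubst (id(v := w)) A)"
        by (auto simp: satisfies_fsubst simp del: fun_upd_apply)
    qed (use assms in auto)
  qed
next
  assume *: "\<forall>w. fsubst (id(v := w)) A \<in> U"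
  show "Forall v A \<in> U"
  proof (rule ccontr)
    assume "Forall v A \<notin> U"
    then have "Neg (Forall v A) \<in> U" using U_Neg assms by auto
    then obtain w where "Neg (fsubst (id(v := w)) A) \<in> U"
      using hs unfolding henkin_set_def by metis
    then show False using * U_Neg assms by auto
  qed
qed

text \<open>Variables that \<open>U\<close> declares equal are represented by the least among them,
  so that the quotient has natural numbers as elements instead of classes.\<close>

definition rep :: "nat \<Rightarrow> nat" where
  "rep i = (LEAST j. Equal (Var i) (Var j) \<in> U)"

lemma Equal_refl: "Equal t t \<in> U"
  by (rule U_cons[of "{}"]) auto

lemma Equal_sym: "Equal s t \<in> U \<Longrightarrow> Equal t s \<in> U"
  by (erule U_eq1) auto

lemma Equal_trans: "Equal s t \<in> U \<Longrightarrow> Equal t u \<in> U \<Longrightarrow> Equal s u \<in> U"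
  by (erule U_eq2) auto

lemma rep_Equal: "Equal (Var i) (Var (rep i)) \<in> U"
  unfolding rep_def by (rule LeastI[of _ i]) (rule Equal_refl)

lemma rep_eq_iff: "rep i = rep j \<longleftrightarrow> Equal (Var i) (Var j) \<in> U"
proof
  assume "rep i = rep j"
  then show "Equal (Var i) (Var j) \<in> U"
    using rep_Equal[of i] rep_Equal[of j] Equal_trans Equal_sym by metis
next
  assume "Equal (Var i) (Var j) \<in> U"
  then have "Equal (Var i) (Var k) \<in> U \<longleftrightarrow> Equal (Var j) (Var k) \<in> U" for k
    using Equal_trans Equal_sym by blast
  then show "rep i = rep j" by (simp add: rep_def)
qed

definition tv :: "bterm \<Rightarrow> nat" where
  "tv t = rep (SOME w. Equal (Var w) t \<in> U)"

text \<open>The formula "every \<open>v\<close> differs from \<open>t\<close>" cannot be in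
  \<open>U\<close>: some environment of \<open>M\<close> would satisfy it, although the value of
  \<open>t\<close> lies in the carrier. Its negation has a witness, and this is a variable equal to
  \<open>t\<close>.\<close>

lemma tv_Equal: "Equal (Var (tv t)) t \<in> U"
proof -
  define v where "v = (SOME v. v \<notin> term_vars t)"
  have v: "v \<notin> term_vars t" unfolding v_def by (rule fresh_var) (simp add: finite_term_vars)
  have tvv: "term_val M (e(v := x)) t = term_val M e t" for e x
    by (rule term_val_cong) (use v in auto)
  have "\<exists>w. Equal (Var w) t \<in> U"
  proof (cases "Forall v (Neg (Equal (Var v) t)) \<in> U")
    case True
    then obtain e where e: "e \<in> envs M" "satisfies M e (Forall v (Neg (Equal (Var v) t)))"
      using U_fs[of "{Forall v (Neg (Equal (Var v) t))}"] by auto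
    have "term_val M e t \<in> sys_carrier M"
      by (induction t) (use e(1) st in \<open>auto simp: envs_def is_structure_def\<close>)
    then show ?thesis using e(2) tvv by auto
  next
    case False
    then obtain w where w: "fsubst (id(v := w)) (Neg (Equal (Var v) t)) \<notin> U"
      using U_Forall[of v "Neg (Equal (Var v) t)"] by auto
    have "Equal (Var w) (tsubst (id(v := w)) t) \<in> U"
      using w U_Neg[of "Equal (Var w) (tsubst (id(v := w)) t)"] by auto
    then have "Equal (Var w) t \<in> U"
    proof (rule U_eq1)
      have "term_val M (e \<circ> id(v := w)) t = term_val M e t" for e
        by (rule term_val_cong) (use v in auto)
      then show "satisfies M e (Equal (Var w) (tsubst (id(v := w)) t)) \<Longrightarrow> satisfies M e (Equal (Var w) t)" for e
        by (simp add: term_val_tsubst del: fun_upd_apply)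
    qed auto
    then show ?thesis by blast
  qed
  then have "Equal (Var (SOME w. Equal (Var w) t \<in> U)) t \<in> U" by (rule someI_ex)
  then show ?thesis unfolding tv_def using rep_Equal Equal_sym Equal_trans by blast
qed

lemma rep_rep [simp]: "rep (rep i) = rep i"
  using rep_eq_iff rep_Equal by metis

lemma rep_tv [simp]: "rep (tv t) = tv t"
  by (simp add: tv_def)

lemma tv_eq_iff: "tv s = tv t \<longleftrightarrow> Equal s t \<in> U"
proof
  assume "tv s = tv t"
  then show "Equal s t \<in> U"
    using tv_Equal[of s] tv_Equal[of t] Equal_trans Equal_sym by metis
next
  assume "Equal s t \<in> U"
  then have "Equal (Var (tv s)) (Var (tv t)) \<in> U"
    using tv_Equal[of s] tv_Equal[of t] Equal_trans Equal_sym by metis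
  then show "tv s = tv t" using rep_eq_iff[of "tv s" "tv t"] by simp
qed

lemma tv_Var: "tv (Var i) = rep i"
  using tv_Equal[of "Var i"] rep_eq_iff[of "tv (Var i)" i] by simp

lemma tv_Add: "tv (Add s t) = tv (Add (Var (tv s)) (Var (tv t)))"
  unfolding tv_eq_iff
  by (rule U_eq2[OF Equal_sym[OF tv_Equal[of s]] Equal_sym[OF tv_Equal[of t]]]) auto

lemma tv_Mult: "tv (Mult s t) = tv (Mult (Var (tv s)) (Var (tv t)))"
  unfolding tv_eq_iff
  by (rule U_eq2[OF Equal_sym[OF tv_Equal[of s]] Equal_sym[OF tv_Equal[of t]]]) auto

definition term_model :: "nat bsystem" where
  "term_model = \<lparr>sys_carrier = range rep, sys_add = (\<lambda>i j. tv (Add (Var i) (Var j))),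
     sys_mult = (\<lambda>i j. tv (Mult (Var i) (Var j))), sys_zero = tv Zero,
     sys_preds = map (\<lambda>i. {rep w |w. Pred i (Var w) \<in> U}) [0..<n]\<rparr>"

lemma term_val_term_model: "term_val term_model (rep \<circ> r) t = tv (tsubst r t)"
proof (induction t)
  case (Add t1 t2)
  then show ?case using tv_Add[of "tsubst r t1" "tsubst r t2"] by (simp add: term_model_def)
next
  case (Mult t1 t2)
  then show ?case using tv_Mult[of "tsubst r t1" "tsubst r t2"] by (simp add: term_model_def)
qed (simp_all add: tv_Var term_model_def)

lemma Pred_tv:
  assumes "i < n"
  shows "tv t \<in> sys_preds term_model ! i \<longleftrightarrow> Pred i t \<in> U"
proof -
  have "tv t \<in> sys_preds term_model ! i \<longleftrightarrow> (\<exists>w. tv t = rep w \<and> Pred i (Var w) \<in> U)"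
    using assms by (auto simp: term_model_def)
  also have "\<dots> \<longleftrightarrow> Pred i t \<in> U"
  proof
    assume "\<exists>w. tv t = rep w \<and> Pred i (Var w) \<in> U"
    then obtain w where "tv t = rep w" "Pred i (Var w) \<in> U" by blast
    then have "Equal t (Var w) \<in> U" using tv_eq_iff[of t "Var w"] tv_Var by simp
    from this \<open>Pred i (Var w) \<in> U\<close> show "Pred i t \<in> U" by (rule U_eq2) (use assms in auto)
  next
    assume P: "Pred i t \<in> U"
    from tv_Equal[of t] P have "Pred i (Var (tv t)) \<in> U" by (rule U_eq2) (use assms in auto)
    then show "\<exists>w. tv t = rep w \<and> Pred i (Var w) \<in> U" by (intro exI[of _ "tv t"]) simp
  qed
  finally show ?thesis .
qed

text \<open>The truth lemma. Since the carrier is the range of \<open>rep\<close>, environments of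
  the term model have the form \<open>rep \<circ> r\<close>. Stating it for every renaming
  \<open>r\<close> lets the induction absorb the update made by a quantifier.\<close>

lemma satisfies_term_model:
  assumes "A \<in> forms n"
  shows "satisfies term_model (rep \<circ> r) A \<longleftrightarrow> fsubst r A \<in> U"
  using assms
proof (induction A arbitrary: r)
  case (Equal s t)
  then show ?case by (simp only: satisfies.simps fsubst.simps term_val_term_model tv_eq_iff)
next
  case (Pred i t)
  then show ?case by (simp only: satisfies.simps fsubst.simps term_val_term_model Pred_tv forms_simps)
next
  case (Neg A)
  then show ?case by (simp only: satisfies.simps fsubst.simps U_Neg forms_simps fsubst_forms)
next
  case (Conj A B)
  then show ?case by (simp only: satisfies.simps fsubst.simps U_Conj forms_simps)
next
  case (Forall v A)
  define w where "w = (SOME w. w \<notin> r ` free_vars A)"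
  have w: "w \<notin> r ` free_vars A"
    unfolding w_def by (rule fresh_var) (simp add: finite_free_vars)
  have A: "A \<in> forms n" using Forall.prems by simp
  \<comment> \<open>Renaming in two stages and renaming at once may give different formulas because
    of the choice of bound variables. They hold in the same environments of \<open>M\<close>, which
    is all that membership in \<open>U\<close> sees.\<close>
  have eq: "fsubst (id(w := u)) (fsubst (r(v := w)) A) \<in> U \<longleftrightarrow> fsubst (r(v := u)) A \<in> U" for u
  proof -
    have "satisfies M (e \<circ> id(w := u) \<circ> r(v := w)) A \<longleftrightarrow> satisfies M (e \<circ> r(v := u)) A" for e
      by (rule satisfies_cong) (use w in auto)
    then have "satisfies M e (fsubst (id(w := u)) (fsubst (r(v := w)) A)) \<longleftrightarrow>
        satisfies M e (fsubst (r(v := u)) A)" for e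
      by (simp only: satisfies_fsubst)
    then show ?thesis using U_eq1 A by (metis fsubst_forms)
  qed
  have "satisfies term_model (rep \<circ> r) (Forall v A) \<longleftrightarrow>
      (\<forall>u. satisfies term_model ((rep \<circ> r)(v := rep u)) A)"
    by (auto simp: term_model_def)
  also have "\<dots> \<longleftrightarrow> (\<forall>u. satisfies term_model (rep \<circ> r(v := u)) A)"
  proof -
    have "(rep \<circ> r)(v := rep u) = rep \<circ> r(v := u)" for u by auto
    then show ?thesis by metis
  qed
  also have "\<dots> \<longleftrightarrow> (\<forall>u. fsubst (r(v := u)) A \<in> U)" using Forall.IH A by blast
  also have "\<dots> \<longleftrightarrow> fsubst r (Forall v A) \<in> U"
    using U_Forall[of w "fsubst (r(v := w)) A"] eq A by (simp add: Let_def flip: w_def)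
  finally show ?case .
qed

lemma term_model_structure: "is_structure n term_model"
proof -
  have "tv t \<in> range rep" for t by (simp add: tv_def)
  then show ?thesis by (auto simp: is_structure_def term_model_def)
qed

lemma satisfies_rep: "A \<in> forms n \<Longrightarrow> satisfies term_model rep A \<longleftrightarrow> A \<in> U"
proof -
  assume A: "A \<in> forms n"
  have "satisfies term_model (rep \<circ> id) A \<longleftrightarrow> fsubst id A \<in> U"
    by (rule satisfies_term_model[OF A])
  \<comment> \<open>Even \<open>fsubst id\<close> may change bound variables, so the comparison with
    \<open>A\<close> is again semantic.\<close>
  also have "\<dots> \<longleftrightarrow> A \<in> U"
    using A U_eq1 by (metis fsubst_forms satisfies_fsubst comp_id)
  finally show ?thesis by simp
qed

lemma term_model_elem_equiv: "elem_equiv n M term_model"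
proof (rule elem_equivI[OF st term_model_structure])
  fix A assume A: "A \<in> sentences n" "true_in M A"
  have "A \<in> U" by (rule U_cons[of "{}"]) (use A in \<open>auto simp: sentences_def forms_def true_in_def envs_def\<close>)
  moreover have "rep \<in> envs term_model" by (auto simp: envs_def term_model_def)
  ultimately show "true_in term_model A"
    using A true_in_sentence[of A rep term_model] satisfies_rep by (auto simp: sentences_def forms_def)
qed

end

text \<open>Realising and omitting in one statement: \<open>e 0\<close> realises
  \<open>\<Sigma>\<close>, and since \<open>e\<close> enumerates the whole model, a type is omitted
  by letting \<open>\<D> j\<close> consist of the negations of its formulas at variable
  \<open>j\<close>. The density hypothesis then says that the type is not isolated.\<close>

lemma omitting_types:
  fixes M :: "'a bsystem" and \<D> :: "nat \<Rightarrow> bform set"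
  assumes st: "is_structure n M"
    and fs: "\<And>F. finite F \<Longrightarrow> F \<subseteq> \<Sigma> \<Longrightarrow> \<exists>e\<in>envs M. \<forall>A\<in>F. satisfies M e A"
    and \<Sigma>: "\<And>A. A \<in> \<Sigma> \<Longrightarrow> free_vars A \<subseteq> {0}" "\<Sigma> \<subseteq> forms n"
    and \<D>: "\<And>j. \<D> j \<subseteq> forms n"
    and dense: "\<And>j B. B \<in> forms n \<Longrightarrow> con M \<Sigma> B \<Longrightarrow> \<exists>D\<in>\<D> j. con M \<Sigma> (Conj B D)"
  shows "\<exists>(N :: nat bsystem) e. is_structure n N \<and> elem_equiv n M N \<and> range e = sys_carrier N \<and>
    (\<forall>A\<in>\<Sigma>. satisfies N e A) \<and> (\<forall>j. \<exists>D\<in>\<D> j. satisfies N e D)"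
proof -
  have "\<exists>U. henkin_set n M U \<and> \<Sigma> \<subseteq> U \<and> (\<forall>j. \<D> j \<inter> U \<noteq> {})"
    by (rule henkin_set_exists; fact)
  then obtain U where U: "henkin_set n M U" "\<Sigma> \<subseteq> U" "\<And>j. \<D> j \<inter> U \<noteq> {}"
    by blast
  interpret henkin n M U using U(1) st by unfold_locales
  show ?thesis
  proof (intro exI[of _ term_model] exI[of _ rep] conjI ballI allI
      term_model_structure term_model_elem_equiv)
    show "range rep = sys_carrier term_model" by (simp add: term_model_def)
    show "satisfies term_model rep A" if "A \<in> \<Sigma>" for A
      using that U(2) U_forms satisfies_rep by blast
    show "\<exists>D\<in>\<D> j. satisfies term_model rep D" for j
      using U(3)[of j] U_forms satisfies_rep by blast
  qed
qed

section \<open>Definable sets of countably categorical structures\<close>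

definition transport :: "('a \<Rightarrow> 'b) \<Rightarrow> 'a bsystem \<Rightarrow> 'b bsystem" where
  "transport g M = \<lparr>sys_carrier = g ` sys_carrier M,
     sys_add = (\<lambda>x y. g (sys_add M (inv_into (sys_carrier M) g x) (inv_into (sys_carrier M) g y))),
     sys_mult = (\<lambda>x y. g (sys_mult M (inv_into (sys_carrier M) g x) (inv_into (sys_carrier M) g y))),
     sys_zero = g (sys_zero M),
     sys_preds = map (\<lambda>J. g ` J) (sys_preds M)\<rparr>"

lemma system_iso_transport:
  "inj_on g (sys_carrier M) \<Longrightarrow> system_iso M (transport g M) g"
  by (auto simp: system_iso_def transport_def bij_betw_def)

lemma system_iso_structure:
  assumes "system_iso M N h" "is_structure n M"
  shows "is_structure n N"
proof -
  have bij: "sys_carrier N = h ` sys_carrier M" and pr: "sys_preds N = map (\<lambda>J. h ` J) (sys_preds M)"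
    using assms(1) by (auto simp: system_iso_def bij_betw_def)
  have cl: "\<And>x y. x \<in> sys_carrier M \<Longrightarrow> y \<in> sys_carrier M \<Longrightarrow> sys_add M x y \<in> sys_carrier M"
    "\<And>x y. x \<in> sys_carrier M \<Longrightarrow> y \<in> sys_carrier M \<Longrightarrow> sys_mult M x y \<in> sys_carrier M"
    using assms(2) by (auto simp: is_structure_def)
  have hom: "h (sys_zero M) = sys_zero N"
    "\<And>x y. x \<in> sys_carrier M \<Longrightarrow> y \<in> sys_carrier M \<Longrightarrow> sys_add N (h x) (h y) = h (sys_add M x y)"
    "\<And>x y. x \<in> sys_carrier M \<Longrightarrow> y \<in> sys_carrier M \<Longrightarrow> sys_mult N (h x) (h y) = h (sys_mult M x y)"
    using assms(1) by (auto simp: system_iso_def)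
  show ?thesis
    using assms(2) unfolding is_structure_def bij pr
    by (auto simp: hom cl simp flip: hom(1))
qed

lemma system_iso_inv:
  assumes h: "system_iso M N h" and st: "is_structure n M"
  shows "system_iso N M (inv_into (sys_carrier M) h)"
proof -
  let ?g = "inv_into (sys_carrier M) h"
  have bij: "bij_betw h (sys_carrier M) (sys_carrier N)" and pr: "sys_preds N = map (\<lambda>J. h ` J) (sys_preds M)"
    using h by (auto simp: system_iso_def)
  have gh: "?g (h x) = x" if "x \<in> sys_carrier M" for x
    using bij that by (simp add: bij_betw_inv_into_left)
  have N: "sys_carrier N = h ` sys_carrier M" using bij by (auto simp: bij_betw_def)
  have cl: "sys_zero M \<in> sys_carrier M"
    "\<And>x y. x \<in> sys_carrier M \<Longrightarrow> y \<in> sys_carrier M \<Longrightarrow> sys_add M x y \<in> sys_carrier M"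
    "\<And>x y. x \<in> sys_carrier M \<Longrightarrow> y \<in> sys_carrier M \<Longrightarrow> sys_mult M x y \<in> sys_carrier M"
    using st by (auto simp: is_structure_def)
  have hom: "h (sys_zero M) = sys_zero N"
    "\<And>x y. x \<in> sys_carrier M \<Longrightarrow> y \<in> sys_carrier M \<Longrightarrow> h (sys_add M x y) = sys_add N (h x) (h y)"
    "\<And>x y. x \<in> sys_carrier M \<Longrightarrow> y \<in> sys_carrier M \<Longrightarrow> h (sys_mult M x y) = sys_mult N (h x) (h y)"
    using h by (auto simp: system_iso_def)
  have "?g ` h ` J = J" if "J \<in> set (sys_preds M)" for J
  proof -
    have "J \<subseteq> sys_carrier M" using that st by (auto simp: is_structure_def)
    then show ?thesis using bij by (simp add: bij_betw_def inv_into_image_cancel)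
  qed
  then have "map (\<lambda>J. ?g ` J) (sys_preds N) = sys_preds M"
    unfolding pr by (simp add: map_idI)
  then show ?thesis
    using bij_betw_inv_into[OF bij] unfolding system_iso_def N
    by (auto simp: gh cl simp flip: hom)
qed

lemma system_iso_comp:
  assumes "system_iso M N h" "system_iso N K g"
  shows "system_iso M K (g \<circ> h)"
proof -
  have "h x \<in> sys_carrier N" if "x \<in> sys_carrier M" for x
    using assms(1) that by (auto simp: system_iso_def bij_betw_def)
  moreover have "map (\<lambda>J. (g \<circ> h) ` J) (sys_preds M) = sys_preds K"
  proof -
    have "map (\<lambda>J. g ` J) (map (\<lambda>J. h ` J) (sys_preds M)) = sys_preds K"
      using assms by (simp add: system_iso_def)
    then show ?thesis by (simp add: comp_def image_image)
  qed
  ultimately show ?thesis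
    using assms bij_betw_trans[of h "sys_carrier M" "sys_carrier N" g "sys_carrier K"]
    by (simp add: system_iso_def)
qed

lemma system_iso_elem_equiv:
  assumes "system_iso M N h" "is_structure n M"
  shows "elem_equiv n M N"
  unfolding elem_equiv_def
proof
  fix A assume A: "A \<in> sentences n"
  let ?e = "\<lambda>_. sys_zero M"
  have e: "?e \<in> envs M" by (rule envs_nonempty[OF assms(2)])
  have "h ` sys_carrier M = sys_carrier N" using assms(1) by (auto simp: system_iso_def bij_betw_def)
  then have e': "h \<circ> ?e \<in> envs N"
    using assms(2) by (auto simp: envs_def is_structure_def)
  have fv: "free_vars A = {}" using A by (simp add: sentences_def)
  have "satisfies M ?e A \<longleftrightarrow> satisfies N (h \<circ> ?e) A"
    by (rule satisfies_iso[OF assms]) (use A e in \<open>auto simp: sentences_def forms_def\<close>)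
  then show "true_in M A \<longleftrightarrow> true_in N A"
    using true_in_sentence[OF fv e] true_in_sentence[OF fv e'] by simp
qed

lemma countable_model_iff:
  assumes "is_structure n M"
  shows "countable_model n (first_order_theory n M) N \<longleftrightarrow>
    is_structure n N \<and> countable (sys_carrier N) \<and> elem_equiv n M N"
proof
  assume "countable_model n (first_order_theory n M) N"
  then show "is_structure n N \<and> countable (sys_carrier N) \<and> elem_equiv n M N"
    using elem_equivI[OF assms] by (auto simp: countable_model_def first_order_theory_def)
qed (auto simp: countable_model_def first_order_theory_def elem_equiv_def)

lemma ex_nat_copy:
  assumes "is_structure n M" "countable (sys_carrier M)"
  obtains N :: "nat bsystem" and g where "system_iso M N g" "is_structure n N" "elem_equiv n M N"
proof -
  let ?g = "to_nat_on (sys_carrier M)"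
  have "system_iso M (transport ?g M) ?g"
    using assms(2) by (intro system_iso_transport) (rule inj_on_to_nat_on)
  then show ?thesis
    using that system_iso_structure system_iso_elem_equiv assms(1) by blast
qed

lemma omega_categorical_iso:
  fixes N :: "nat bsystem"
  assumes "omega_categorical n M" "is_structure n M" "countable (sys_carrier M)"
    and "is_structure n N" "elem_equiv n M N"
  obtains h where "system_iso M N h"
proof -
  obtain M' :: "nat bsystem" and g where g: "system_iso M M' g" "is_structure n M'" "elem_equiv n M M'"
    using ex_nat_copy[OF assms(2,3)] .
  obtain K :: "nat bsystem" where K: "\<forall>N' :: nat bsystem. countable_model n (first_order_theory n M) N' \<longrightarrow>
      systems_isomorphic N' K"
    using assms(1) unfolding omega_categorical_def by auto
  obtain a where a: "system_iso M' K a"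
    using K[rule_format, of M'] g countable_model_iff[OF assms(2)] by (auto simp: systems_isomorphic_def)
  obtain b where b: "system_iso N K b"
    using K[rule_format, of N] assms countable_model_iff[OF assms(2)] by (auto simp: systems_isomorphic_def)
  show ?thesis
    by (rule that[OF system_iso_comp[OF system_iso_comp[OF g(1) a] system_iso_inv[OF b assms(4)]]])
qed

section \<open>Definability without parameters\<close>

definition definable :: "nat \<Rightarrow> 'a bsystem \<Rightarrow> ((nat \<Rightarrow> 'a) \<Rightarrow> bool) \<Rightarrow> bool" where
  "definable n M \<Phi> \<longleftrightarrow> (\<exists>A\<in>forms n. \<forall>e\<in>envs M. satisfies M e A \<longleftrightarrow> \<Phi> e)"

lemma definable_not:
  assumes "definable n M \<Phi>" shows "definable n M (\<lambda>e. \<not> \<Phi> e)"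
proof -
  obtain A where "A \<in> forms n" "\<forall>e\<in>envs M. satisfies M e A \<longleftrightarrow> \<Phi> e"
    using assms unfolding definable_def by (elim bexE)
  then show ?thesis
    unfolding definable_def by (intro bexI[of _ "Neg A"]) simp_all
qed

lemma definable_conj:
  assumes "definable n M \<Phi>" "definable n M \<Psi>" shows "definable n M (\<lambda>e. \<Phi> e \<and> \<Psi> e)"
proof -
  obtain A where "A \<in> forms n" "\<forall>e\<in>envs M. satisfies M e A \<longleftrightarrow> \<Phi> e"
    using assms(1) unfolding definable_def by (elim bexE)
  moreover obtain B where "B \<in> forms n" "\<forall>e\<in>envs M. satisfies M e B \<longleftrightarrow> \<Psi> e"
    using assms(2) unfolding definable_def by (elim bexE)
  ultimately show ?thesis
    unfolding definable_def by (intro bexI[of _ "Conj A B"]) simp_all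
qed

lemma definable_imp:
  assumes "definable n M \<Phi>" "definable n M \<Psi>" shows "definable n M (\<lambda>e. \<Phi> e \<longrightarrow> \<Psi> e)"
  using definable_not[OF definable_conj[OF assms(1) definable_not[OF assms(2)]]]
  by simp

lemma definable_all:
  assumes "definable n M \<Phi>" shows "definable n M (\<lambda>e. \<forall>x\<in>sys_carrier M. \<Phi> (e(v := x)))"
proof -
  obtain A where "A \<in> forms n" "\<forall>e\<in>envs M. satisfies M e A \<longleftrightarrow> \<Phi> e"
    using assms unfolding definable_def by blast
  then show ?thesis
    unfolding definable_def by (intro bexI[of _ "Forall v A"]) (simp_all add: envs_upd)
qed

lemma definable_ex:
  assumes "definable n M \<Phi>" shows "definable n M (\<lambda>e. \<exists>x\<in>sys_carrier M. \<Phi> (e(v := x)))"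
  using definable_not[OF definable_all[OF definable_not[OF assms]]] by simp

lemma definable_subst:
  assumes "definable n M \<Phi>" shows "definable n M (\<lambda>e. \<Phi> (e \<circ> s))"
proof -
  obtain A where "A \<in> forms n" "\<forall>e\<in>envs M. satisfies M e A \<longleftrightarrow> \<Phi> e"
    using assms unfolding definable_def by blast
  then show ?thesis
    unfolding definable_def by (intro bexI[of _ "fsubst s A"]) (simp_all add: envs_comp satisfies_fsubst)
qed

lemma definable_eq: "definable n M (\<lambda>e. term_val M e s = term_val M e t)"
  unfolding definable_def by (intro bexI[of _ "Equal s t"]) auto

lemma definable_pred: "i < n \<Longrightarrow> definable n M (\<lambda>e. term_val M e t \<in> sys_preds M ! i)"
  unfolding definable_def by (intro bexI[of _ "Pred i t"]) auto

lemma definable_cong: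
  "definable n M \<Phi> \<Longrightarrow> (\<And>e. e \<in> envs M \<Longrightarrow> \<Phi> e \<longleftrightarrow> \<Psi> e) \<Longrightarrow> definable n M \<Psi>"
  unfolding definable_def by simp

definition definable_sets :: "nat \<Rightarrow> 'a bsystem \<Rightarrow> 'a set set" where
  "definable_sets n M = {S. S \<subseteq> sys_carrier M \<and> definable n M (\<lambda>e. e 0 \<in> S)}"

text \<open>Truth depends only on the value of variable 0, so sending all free variables to 0 does
  not change the defined set and makes the formula one of a single variable.\<close>

lemma definable_sets_formula:
  assumes "S \<in> definable_sets n M"
  obtains A where "A \<in> forms n" "free_vars A \<subseteq> {0}"
    "\<And>e. e \<in> envs M \<Longrightarrow> satisfies M e A \<longleftrightarrow> e 0 \<in> S"
proof -
  obtain A where "A \<in> forms n" "\<forall>e\<in>envs M. satisfies M e A \<longleftrightarrow> e 0 \<in> S"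
    using assms unfolding definable_sets_def definable_def by blast
  then have "fsubst (\<lambda>_. 0) A \<in> forms n" "free_vars (fsubst (\<lambda>_. 0) A) \<subseteq> {0}"
    "\<And>e. e \<in> envs M \<Longrightarrow> satisfies M e (fsubst (\<lambda>_. 0) A) \<longleftrightarrow> e 0 \<in> S"
    using free_vars_fsubst[of "\<lambda>_. 0" A] envs_comp[of _ M "\<lambda>_. 0"]
    unfolding satisfies_fsubst by (simp, blast, fastforce simp: comp_def)
  then show ?thesis by (rule that)
qed

lemma definable_mem: "S \<in> definable_sets n M \<Longrightarrow> definable n M (\<lambda>e. e v \<in> S)"
  using definable_subst[of n M "\<lambda>e. e 0 \<in> S" "\<lambda>_. v"] by (simp add: definable_sets_def)

lemma definable_sets_Diff:
  "S \<in> definable_sets n M \<Longrightarrow> T \<in> definable_sets n M \<Longrightarrow> S - T \<in> definable_sets n M"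
  using definable_conj[OF _ definable_not, of n M "\<lambda>e. e 0 \<in> S" "\<lambda>e. e 0 \<in> T"]
  by (auto simp: definable_sets_def)

lemma definable_sets_UNIV: "sys_carrier M \<in> definable_sets n M"
  unfolding definable_sets_def
  by (simp, rule definable_cong[OF definable_eq[of n M Zero Zero]]) (auto simp: envs_def)

lemma definable_projection:
  assumes "A \<in> forms n"
  shows "{e j |e. e \<in> envs M \<and> satisfies M e A} \<in> definable_sets n M"
proof -
  \<comment> \<open>Variable \<open>j\<close> becomes 0 and every other variable moves up by one.
    The shift keeps 0 apart from the variables that are then quantified away.\<close>
  define s where "s = (\<lambda>i. if i = j then 0 else Suc i)"
  define vs where "vs = sorted_list_of_set (Suc ` free_vars A)"
  have vs: "set vs = Suc ` free_vars A" by (simp add: vs_def finite_free_vars)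
  define B where "B = Neg (fall vs (Neg (fsubst s A)))"
  have "satisfies M e B \<longleftrightarrow> e 0 \<in> {e j |e. e \<in> envs M \<and> satisfies M e A}" if e: "e \<in> envs M" for e
  proof
    assume "satisfies M e B"
    then obtain e' where e': "e' \<in> envs M" "\<forall>v. v \<notin> set vs \<longrightarrow> e' v = e v" "satisfies M (e' \<circ> s) A"
      unfolding B_def satisfies.simps satisfies_fall[OF e] satisfies_fsubst by auto
    then have "(e' \<circ> s) j = e 0" using vs by (auto simp: s_def)
    then show "e 0 \<in> {e j |e. e \<in> envs M \<and> satisfies M e A}"
      using e' envs_comp[OF e'(1), of s] by (auto intro!: exI[of _ "e' \<circ> s"])
  next
    assume "e 0 \<in> {e j |e. e \<in> envs M \<and> satisfies M e A}"
    then obtain f where f: "f \<in> envs M" "satisfies M f A" "f j = e 0" by auto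
    define e' where "e' = (\<lambda>v. if v \<in> set vs then f (v - 1) else e v)"
    have "e' \<in> envs M" using e f by (auto simp: e'_def envs_def)
    moreover have "satisfies M (e' \<circ> s) A \<longleftrightarrow> satisfies M f A"
      by (rule satisfies_cong) (use f vs in \<open>auto simp: e'_def s_def\<close>)
    moreover have "\<forall>v. v \<notin> set vs \<longrightarrow> e' v = e v" by (simp add: e'_def)
    ultimately show "satisfies M e B"
      unfolding B_def satisfies.simps satisfies_fall[OF e] satisfies_fsubst using f(2) by auto
  qed
  moreover have "B \<in> forms n" using assms by (simp add: B_def)
  ultimately show ?thesis
    unfolding definable_sets_def definable_def by (auto simp: envs_def)
qed

text \<open>In an infinite Boolean algebra the atoms do not cover the carrier by finitely many, so
  "lying in no atom" is a consistent type. Categoricity moves a realisation of it into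
  \<open>M\<close> as an element \<open>a\<close>. The type of \<open>a\<close> is not isolated,
  hence omitted in a model that is again isomorphic to \<open>M\<close>.\<close>

theorem finite_definable_sets:
  fixes M :: "'a bsystem"
  assumes oc: "omega_categorical n M" and st: "is_structure n M" and co: "countable (sys_carrier M)"
  shows "finite (definable_sets n M)"
proof (rule ccontr)
  let ?B = "definable_sets n M" and ?C = "sys_carrier M"
  assume inf: "infinite ?B"
  define At where "At = {S \<in> ?B. S \<noteq> {} \<and> (\<forall>T\<in>?B. S \<subseteq> T \<or> S \<inter> T = {})}"
  have BC: "S \<subseteq> ?C" if "S \<in> ?B" for S using that by (auto simp: definable_sets_def)
  have compl: "?C - S \<in> ?B" if "S \<in> ?B" for S
    using definable_sets_Diff[OF definable_sets_UNIV that] .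
  \<comment> \<open>If finitely many atoms covered the carrier, each definable set would be the
    union of the atoms inside it, leaving only finitely many definable sets.\<close>
  have cover: "\<exists>a\<in>?C. \<forall>S\<in>F. a \<notin> S" if F: "finite F" "F \<subseteq> At" for F
  proof (rule ccontr)
    assume "\<not> ?thesis"
    then have cov: "?C \<subseteq> \<Union>F" by blast
    have "?B \<subseteq> Union ` Pow F"
    proof
      fix T assume T: "T \<in> ?B"
      have "T = \<Union>{S \<in> F. S \<subseteq> T}"
      proof
        show "T \<subseteq> \<Union>{S \<in> F. S \<subseteq> T}"
        proof
          fix x assume "x \<in> T"
          then obtain S where S: "S \<in> F" "x \<in> S" using cov BC[OF T] by blast
          then have "S \<subseteq> T" using F T \<open>x \<in> T\<close> unfolding At_def by blast
          then show "x \<in> \<Union>{S \<in> F. S \<subseteq> T}" using S by blast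
        qed
      qed blast
      then show "T \<in> Union ` Pow F" by blast
    qed
    then show False using inf F(1) finite_subset by blast
  qed
  define is_fm where "is_fm S A \<longleftrightarrow> A \<in> forms n \<and> free_vars A \<subseteq> {0} \<and>
      (\<forall>e\<in>envs M. satisfies M e A \<longleftrightarrow> e 0 \<in> S)" for S A
  define fm where "fm S = (SOME A. is_fm S A)" for S
  have "is_fm S (fm S)" if S: "S \<in> ?B" for S
  proof -
    have "\<exists>A. is_fm S A"
    proof (rule definable_sets_formula[OF S])
      fix A assume "A \<in> forms n" "free_vars A \<subseteq> {0}"
        "\<And>e. e \<in> envs M \<Longrightarrow> satisfies M e A \<longleftrightarrow> e 0 \<in> S"
      then show "\<exists>A. is_fm S A" unfolding is_fm_def by (intro exI[of _ A]) simp
    qed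
    then show ?thesis unfolding fm_def by (rule someI_ex)
  qed
  then have fm: "\<And>S. S \<in> ?B \<Longrightarrow> fm S \<in> forms n" "\<And>S. S \<in> ?B \<Longrightarrow> free_vars (fm S) \<subseteq> {0}"
    "\<And>S e. S \<in> ?B \<Longrightarrow> e \<in> envs M \<Longrightarrow> satisfies M e (fm S) \<longleftrightarrow> e 0 \<in> S"
    unfolding is_fm_def by simp_all
  have const: "(\<lambda>_. x) \<in> envs M" if "x \<in> ?C" for x using that by (auto simp: envs_def)
  have iso_const: "satisfies N e (fm S) \<longleftrightarrow> x \<in> S"
    if "system_iso M N h" "S \<in> ?B" "x \<in> ?C" "e 0 = h x" for N :: "nat bsystem" and h e S x
  proof -
    have "satisfies N e (fm S) \<longleftrightarrow> satisfies N (h \<circ> (\<lambda>_. x)) (fm S)"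
      by (rule satisfies_cong) (use fm(2)[OF that(2)] that(4) in auto)
    also have "\<dots> \<longleftrightarrow> x \<in> S"
      using satisfies_iso[OF that(1) st fm(1)[OF that(2)] const[OF that(3)]] fm(3)[OF that(2) const[OF that(3)]]
      by simp
    finally show ?thesis .
  qed
  have At_B: "S \<in> ?B" if "S \<in> At" for S using that by (auto simp: At_def)
  \<comment> \<open>This application only realises a type; the trivially true demand
    \<open>Equal Zero Zero\<close> stands for the empty list of demands.\<close>
  have "\<exists>(N1 :: nat bsystem) e1. is_structure n N1 \<and> elem_equiv n M N1 \<and> range e1 = sys_carrier N1 \<and>
      (\<forall>A\<in>(\<lambda>S. Neg (fm S)) ` At. satisfies N1 e1 A) \<and> (\<forall>j::nat. \<exists>D\<in>{Equal Zero Zero}. satisfies N1 e1 D)"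
  proof (rule omitting_types[OF st, of "(\<lambda>S. Neg (fm S)) ` At" "\<lambda>_. {Equal Zero Zero}"])
    fix F assume F: "finite F" "F \<subseteq> (\<lambda>S. Neg (fm S)) ` At"
    then obtain G where G: "finite G" "G \<subseteq> At" "F = (\<lambda>S. Neg (fm S)) ` G"
      by (meson finite_subset_image)
    obtain a where "a \<in> ?C" "\<forall>S\<in>G. a \<notin> S" using cover[OF G(1,2)] by blast
    then show "\<exists>e\<in>envs M. \<forall>A\<in>F. satisfies M e A"
      using fm(3) const At_B G by (intro bexI[of _ "\<lambda>_. a"]) auto
  next
    show "free_vars A \<subseteq> {0}" if A: "A \<in> (\<lambda>S. Neg (fm S)) ` At" for A
    proof -
      obtain S where "S \<in> At" "A = Neg (fm S)" using A by blast
      then show ?thesis using fm(2)[OF At_B] by simp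
    qed
    show "(\<lambda>S. Neg (fm S)) ` At \<subseteq> forms n" using fm(1) At_B by auto
    show "\<exists>D\<in>{Equal Zero Zero}. con M ((\<lambda>S. Neg (fm S)) ` At) (Conj B D)"
      if "con M ((\<lambda>S. Neg (fm S)) ` At) B" for B
      using that by (auto simp: con_def)
  qed simp
  then obtain N1 :: "nat bsystem" and e1 where N1: "is_structure n N1" "elem_equiv n M N1"
    "range e1 = sys_carrier N1" "\<forall>A\<in>(\<lambda>S. Neg (fm S)) ` At. satisfies N1 e1 A"
    by (elim exE conjE)
  obtain h1 where h1: "system_iso M N1 h1" using omega_categorical_iso[OF oc st co N1(1,2)] .
  then have "e1 0 \<in> h1 ` ?C" using N1(3) by (auto simp: system_iso_def bij_betw_def)
  then obtain a where a: "a \<in> ?C" "e1 0 = h1 a" by auto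
  have aAt: "a \<notin> S" if "S \<in> At" for S
    using iso_const[where e = e1, OF h1 At_B[OF that] a] N1(4) that by auto
  \<comment> \<open>Now nothing is realised, and each element \<open>e2 j\<close> is kept out of
    some definable set that contains \<open>a\<close>.\<close>
  have "\<exists>(N2 :: nat bsystem) e2. is_structure n N2 \<and> elem_equiv n M N2 \<and> range e2 = sys_carrier N2 \<and>
      (\<forall>A\<in>{}. satisfies N2 e2 A) \<and>
      (\<forall>j. \<exists>D\<in>{Neg (fsubst (\<lambda>_. j) (fm T)) |T. T \<in> ?B \<and> a \<in> T}. satisfies N2 e2 D)"
  proof (rule omitting_types[OF st, of "{}" "\<lambda>j. {Neg (fsubst (\<lambda>_. j) (fm T)) |T. T \<in> ?B \<and> a \<in> T}"])
    show "\<exists>e\<in>envs M. \<forall>A\<in>F. satisfies M e A" if "F \<subseteq> {}" for F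
      using that const[OF a(1)] by auto
    show "{Neg (fsubst (\<lambda>_. j) (fm T)) |T. T \<in> ?B \<and> a \<in> T} \<subseteq> forms n" for j
      using fm(1) by auto
    fix j B assume B: "B \<in> forms n" "con M {} B"
    show "\<exists>D\<in>{Neg (fsubst (\<lambda>_. j) (fm T)) |T. T \<in> ?B \<and> a \<in> T}. con M {} (Conj B D)"
    proof (rule ccontr)
      assume neg: "\<not> ?thesis"
      have all: "e j \<in> T" if "e \<in> envs M" "satisfies M e B" "T \<in> ?B" "a \<in> T" for e T
      proof (rule ccontr)
        assume "e j \<notin> T"
        then have "satisfies M e (Neg (fsubst (\<lambda>_. j) (fm T)))"
          using fm(3)[OF that(3) envs_comp[OF that(1), of "\<lambda>_. j"]]
          unfolding satisfies.simps satisfies_fsubst by simp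
        then have "con M {} (Conj B (Neg (fsubst (\<lambda>_. j) (fm T))))"
          using that unfolding con_def by auto
        then show False using neg that by blast
      qed
      \<comment> \<open>The values that \<open>B\<close> permits for variable \<open>j\<close>. If
        the demand at \<open>j\<close> could not be met, this set would lie inside every definable
        set around \<open>a\<close>. It would then be an atom, so that \<open>a\<close> is outside
        it, and it would be contained in its own complement.\<close>
      define \<theta> where "\<theta> = {e j |e. e \<in> envs M \<and> satisfies M e B}"
      have \<theta>: "\<theta> \<in> ?B" unfolding \<theta>_def by (rule definable_projection[OF B(1)])
      have sub: "\<theta> \<subseteq> T" if "T \<in> ?B" "a \<in> T" for T using all that by (auto simp: \<theta>_def)
      have ne: "\<theta> \<noteq> {}" using B(2) by (auto simp: \<theta>_def con_def)
      have "\<theta> \<in> At" unfolding At_def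
      proof (intro CollectI conjI \<theta> ne ballI)
        fix T assume T: "T \<in> ?B"
        show "\<theta> \<subseteq> T \<or> \<theta> \<inter> T = {}"
          using sub[OF T] sub[OF compl[OF T]] a(1) by blast
      qed
      then have "a \<notin> \<theta>" by (rule aAt)
      then show False using sub[OF compl[OF \<theta>]] a(1) ne by blast
    qed
  qed simp_all
  then obtain N2 :: "nat bsystem" and e2 where N2: "is_structure n N2" "elem_equiv n M N2"
    "range e2 = sys_carrier N2"
    "\<forall>j. \<exists>D\<in>{Neg (fsubst (\<lambda>_. j) (fm T)) |T. T \<in> ?B \<and> a \<in> T}. satisfies N2 e2 D"
    by (elim exE conjE)
  obtain h2 where h2: "system_iso M N2 h2" using omega_categorical_iso[OF oc st co N2(1,2)] .
  then have "h2 a \<in> range e2" using a(1) N2(3) by (auto simp: system_iso_def bij_betw_def)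
  then obtain j where j: "h2 a = e2 j" by auto
  obtain T where T: "T \<in> ?B" "a \<in> T" "\<not> satisfies N2 (e2 \<circ> (\<lambda>_. j)) (fm T)"
    using N2(4)[rule_format, of j] by (auto simp: satisfies_fsubst)
  then show False using iso_const[OF h2 T(1) a(1), of "e2 \<circ> (\<lambda>_. j)"] j by simp
qed

section \<open>Structures with finitely many types\<close>

text \<open>The limit is merely a relation that is total on both sides. All further properties are
  read off from finite subsets, each of which lies inside one approximation satisfying
  \<open>P\<close>.\<close>

lemma back_and_forth:
  fixes P :: "('a \<times> 'b) set \<Rightarrow> bool"
  assumes "countable A" "countable B" "A \<noteq> {}" "B \<noteq> {}" "P G0"
    and forth: "\<And>G a. P G \<Longrightarrow> a \<in> A \<Longrightarrow> \<exists>b\<in>B. P (insert (a, b) G)"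
    and bck: "\<And>G b. P G \<Longrightarrow> b \<in> B \<Longrightarrow> \<exists>a\<in>A. P (insert (a, b) G)"
  shows "\<exists>H. (\<forall>a\<in>A. \<exists>b\<in>B. (a, b) \<in> H) \<and> (\<forall>b\<in>B. \<exists>a\<in>A. (a, b) \<in> H) \<and>
    (\<forall>F. finite F \<longrightarrow> F \<subseteq> H \<longrightarrow> (\<exists>G. F \<subseteq> G \<and> P G))"
proof -
  define a where "a = from_nat_into A"
  define b where "b = from_nat_into B"
  have a: "range a = A" and b: "range b = B"
    using assms(1-4) by (auto simp: a_def b_def range_from_nat_into)
  have "\<exists>g. \<forall>i::nat. P (g i) \<and> (g i \<subseteq> g (Suc i) \<and>
      (\<exists>y\<in>B. (a i, y) \<in> g (Suc i)) \<and> (\<exists>x\<in>A. (x, b i) \<in> g (Suc i)))"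
  proof (rule dependent_nat_choice)
    show "\<exists>x. P x" using assms(5) by blast
  next
    fix G and i :: nat assume "P G"
    moreover have "a i \<in> A" using a by blast
    ultimately obtain y where y: "y \<in> B" "P (insert (a i, y) G)" using forth by meson
    have "b i \<in> B" using b by blast
    with bck[OF y(2)] obtain x where x: "x \<in> A" "P (insert (x, b i) (insert (a i, y) G))" by meson
    show "\<exists>G'. P G' \<and> (G \<subseteq> G' \<and> (\<exists>y\<in>B. (a i, y) \<in> G') \<and> (\<exists>x\<in>A. (x, b i) \<in> G'))"
      by (intro exI[of _ "insert (x, b i) (insert (a i, y) G)"] conjI x(2)) (use x(1) y(1) in auto)
  qed
  then obtain g where g0: "\<forall>i::nat. P (g i) \<and> (g i \<subseteq> g (Suc i) \<and>
      (\<exists>y\<in>B. (a i, y) \<in> g (Suc i)) \<and> (\<exists>x\<in>A. (x, b i) \<in> g (Suc i)))"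
    by (elim exE)
  then have Pg: "\<And>i. P (g i)" and g: "\<And>i. g i \<subseteq> g (Suc i)"
    "\<And>i. \<exists>y\<in>B. (a i, y) \<in> g (Suc i)" "\<And>i. \<exists>x\<in>A. (x, b i) \<in> g (Suc i)"
    by simp_all
  have mono: "g i \<subseteq> g j" if "i \<le> j" for i j using that g(1) by (rule lift_Suc_mono_le[rotated])
  define H where "H = (\<Union>i. g i)"
  have "\<exists>y\<in>B. (x, y) \<in> H" if x: "x \<in> A" for x
  proof -
    obtain i where "x = a i" using x a by blast
    then show ?thesis using g(2)[of i] unfolding H_def by blast
  qed
  moreover have "\<exists>x\<in>A. (x, y) \<in> H" if y: "y \<in> B" for y
  proof -
    obtain i where "y = b i" using y b by blast
    then show ?thesis using g(3)[of i] unfolding H_def by blast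
  qed
  moreover have "\<exists>G. F \<subseteq> G \<and> P G" if "finite F" "F \<subseteq> H" for F
  proof -
    have "\<exists>i. F \<subseteq> g i" using that
    proof (induction F rule: finite_induct)
      case (insert x F)
      then obtain i j where "F \<subseteq> g i" "x \<in> g j" unfolding H_def by auto
      then have "insert x F \<subseteq> g (max i j)" using mono[of i "max i j"] mono[of j "max i j"] by auto
      then show ?case by blast
    qed simp
    then show ?thesis using Pg by meson
  qed
  ultimately show ?thesis by (rule_tac exI[of _ H]) simp
qed

text \<open>Each compatibility hypothesis mentions at most three pairs of the relation, which is the
  form in which a back-and-forth limit delivers it.\<close>

lemma iso_of_relation:
  assumes st: "is_structure n M" "is_structure n N"
    and tot: "\<forall>a\<in>sys_carrier M. \<exists>b\<in>sys_carrier N. (a, b) \<in> H"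
      "\<forall>b\<in>sys_carrier N. \<exists>a\<in>sys_carrier M. (a, b) \<in> H"
    and uni: "\<And>a b c d. (a, b) \<in> H \<Longrightarrow> (c, d) \<in> H \<Longrightarrow> a = c \<longleftrightarrow> b = d"
    and add: "\<And>a b c d x. (a, b) \<in> H \<Longrightarrow> (c, d) \<in> H \<Longrightarrow> (sys_add M a c, x) \<in> H \<Longrightarrow> x = sys_add N b d"
    and mult: "\<And>a b c d x. (a, b) \<in> H \<Longrightarrow> (c, d) \<in> H \<Longrightarrow> (sys_mult M a c, x) \<in> H \<Longrightarrow> x = sys_mult N b d"
    and pred: "\<And>a b i. (a, b) \<in> H \<Longrightarrow> i < n \<Longrightarrow> a \<in> sys_preds M ! i \<longleftrightarrow> b \<in> sys_preds N ! i"
    and zero: "\<And>b. (sys_zero M, b) \<in> H \<Longrightarrow> b = sys_zero N"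
  shows "systems_isomorphic M N"
proof -
  have "\<forall>a\<in>sys_carrier M. \<exists>b. b \<in> sys_carrier N \<and> (a, b) \<in> H" using tot(1) by blast
  from bchoice[OF this] obtain h where h: "\<forall>a\<in>sys_carrier M. h a \<in> sys_carrier N \<and> (a, h a) \<in> H"
    by (elim exE)
  have cl: "sys_zero M \<in> sys_carrier M"
    "\<And>x y. x \<in> sys_carrier M \<Longrightarrow> y \<in> sys_carrier M \<Longrightarrow> sys_add M x y \<in> sys_carrier M"
    "\<And>x y. x \<in> sys_carrier M \<Longrightarrow> y \<in> sys_carrier M \<Longrightarrow> sys_mult M x y \<in> sys_carrier M"
    "length (sys_preds M) = n" "length (sys_preds N) = n"
    using st by (auto simp: is_structure_def)
  have hH: "(a, h a) \<in> H" if "a \<in> sys_carrier M" for a using h that by blast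
  have inj: "inj_on h (sys_carrier M)" using uni[OF hH hH] by (auto simp: inj_on_def)
  have sur: "\<exists>a\<in>sys_carrier M. b = h a" if "b \<in> sys_carrier N" for b
  proof -
    obtain a where a: "a \<in> sys_carrier M" "(a, b) \<in> H" using tot(2) \<open>b \<in> sys_carrier N\<close> by blast
    then show ?thesis using uni[OF hH[OF a(1)] a(2)] by auto
  qed
  have bij: "bij_betw h (sys_carrier M) (sys_carrier N)"
    using inj sur h by (auto simp: bij_betw_def)
  have "h ` (sys_preds M ! i) = sys_preds N ! i" if i: "i < n" for i
  proof -
    have sub: "sys_preds M ! i \<subseteq> sys_carrier M" "sys_preds N ! i \<subseteq> sys_carrier N"
      using st i by (auto simp: is_structure_def)
    show ?thesis
    proof
      show "h ` (sys_preds M ! i) \<subseteq> sys_preds N ! i" using pred[OF hH i] sub by blast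
      show "sys_preds N ! i \<subseteq> h ` (sys_preds M ! i)"
      proof
        fix b assume b: "b \<in> sys_preds N ! i"
        obtain a where "a \<in> sys_carrier M" "b = h a" using sur b sub by blast
        then show "b \<in> h ` (sys_preds M ! i)" using pred[OF hH i] b by blast
      qed
    qed
  qed
  then have "map (\<lambda>J. h ` J) (sys_preds M) = sys_preds N"
    by (intro nth_equalityI) (simp_all add: cl)
  then have "system_iso M N h"
    using bij add[OF hH hH hH] mult[OF hH hH hH] zero[OF hH] cl unfolding system_iso_def by simp
  then show ?thesis by (auto simp: systems_isomorphic_def)
qed

section \<open>Types in finitely many variables\<close>

definition conj_list :: "bform list \<Rightarrow> bform" where
  "conj_list As = foldr Conj As (Equal Zero Zero)"

lemma satisfies_conj_list: "satisfies M e (conj_list As) \<longleftrightarrow> (\<forall>A\<in>set As. satisfies M e A)"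
  by (induction As) (auto simp: conj_list_def)

lemma conj_list_forms: "conj_list As \<in> forms n \<longleftrightarrow> set As \<subseteq> forms n"
  by (induction As) (auto simp: conj_list_def)

lemma free_vars_conj_list: "free_vars (conj_list As) = (\<Union>A\<in>set As. free_vars A)"
  by (induction As) (auto simp: conj_list_def)

definition kforms :: "nat \<Rightarrow> nat \<Rightarrow> bform set" where
  "kforms n k = {A \<in> forms n. free_vars A \<subseteq> {..<k}}"

definition ktype :: "nat \<Rightarrow> 'a bsystem \<Rightarrow> nat \<Rightarrow> (nat \<Rightarrow> 'a) \<Rightarrow> bform set" where
  "ktype n M k e = {A \<in> kforms n k. satisfies M e A}"

text \<open>For each pair of sets without inclusion, one element of the difference is collected.
  Applied to types, this turns finitely many types into finitely many formulas that tell them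
  apart.\<close>

lemma finite_separating:
  assumes "finite \<T>"
  shows "\<exists>D. finite D \<and> D \<subseteq> \<Union>\<T> \<and> (\<forall>S\<in>\<T>. \<forall>T\<in>\<T>. S \<inter> D = T \<inter> D \<longrightarrow> S = T)"
proof -
  define p where "p S T = (SOME x. x \<in> S \<and> x \<notin> T)" for S T :: "'a set"
  have p: "p S T \<in> S \<and> p S T \<notin> T" if "\<not> S \<subseteq> T" for S T
    unfolding p_def by (rule someI_ex) (use that in \<open>simp add: subset_eq Bex_def\<close>)
  define D where "D = (\<lambda>(S, T). p S T) ` {(S, T). S \<in> \<T> \<and> T \<in> \<T> \<and> \<not> S \<subseteq> T}"
  have "{(S, T). S \<in> \<T> \<and> T \<in> \<T> \<and> \<not> S \<subseteq> T} \<subseteq> \<T> \<times> \<T>" by auto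
  then have "finite D" unfolding D_def
    using assms by (intro finite_imageI) (meson finite_SigmaI finite_subset)
  moreover have "D \<subseteq> \<Union>\<T>"
  proof
    fix x assume "x \<in> D"
    then obtain S T where "x = p S T" "S \<in> \<T>" "\<not> S \<subseteq> T" by (auto simp: D_def)
    then show "x \<in> \<Union>\<T>" using p[of S T] by auto
  qed
  moreover have sub: "S \<subseteq> T" if "S \<in> \<T>" "T \<in> \<T>" "S \<inter> D = T \<inter> D" for S T
  proof (rule ccontr)
    assume n: "\<not> S \<subseteq> T"
    then have "p S T \<in> D" unfolding D_def
      by (intro image_eqI[of _ _ "(S, T)"]) (use that in simp_all)
    then show False using p[OF n] that(3) by auto
  qed
  ultimately show ?thesis
    by (intro exI[of _ D] conjI ballI impI equalityI) simp_all
qed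

lemma true_sentence_transfer:
  assumes "elem_equiv n M N" "A \<in> forms n" "free_vars A = {}" "e \<in> envs M" "f \<in> envs N"
  shows "satisfies M e A \<longleftrightarrow> satisfies N f A"
  using assms true_in_sentence[OF assms(3,4)] true_in_sentence[OF assms(3,5)]
  by (auto simp: elem_equiv_def sentences_def forms_def)

lemma satisfies_sentence_all:
  assumes "e \<in> envs M" "A \<in> kforms n k"
  shows "satisfies M e (fall [0..<k] A) \<longleftrightarrow> (\<forall>e'\<in>envs M. satisfies M e' A)"
proof
  assume L: "satisfies M e (fall [0..<k] A)"
  show "\<forall>e'\<in>envs M. satisfies M e' A"
  proof
    fix e' assume e': "e' \<in> envs M"
    define f where "f = (\<lambda>v. if v < k then e' v else e v)"
    have "f \<in> envs M" using assms(1) e' by (auto simp: f_def envs_def)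
    then have "satisfies M f A" using L satisfies_fall[OF assms(1), of "[0..<k]" A] by (auto simp: f_def)
    moreover have "satisfies M f A \<longleftrightarrow> satisfies M e' A"
      by (rule satisfies_cong) (use assms(2) in \<open>auto simp: f_def kforms_def\<close>)
    ultimately show "satisfies M e' A" by simp
  qed
qed (use satisfies_fall[OF assms(1)] in auto)

lemma valid_transfer:
  assumes "elem_equiv n M N" "A \<in> kforms n k" "\<forall>e\<in>envs M. satisfies M e A"
    and "envs M \<noteq> {}" "f \<in> envs N"
  shows "satisfies N f A"
proof -
  obtain e where e: "e \<in> envs M" using assms(4) by blast
  have fv: "fall [0..<k] A \<in> forms n" "free_vars (fall [0..<k] A) = {}"
    using assms(2) by (auto simp: kforms_def free_vars_fall)
  have "satisfies M e (fall [0..<k] A)" using satisfies_sentence_all[OF e assms(2)] assms(3) by simp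
  then have "satisfies N f (fall [0..<k] A)"
    using true_sentence_transfer[OF assms(1) fv e assms(5)] by simp
  then show ?thesis using satisfies_sentence_all[OF assms(5,2)] assms(5) by simp
qed

definition lits :: "bform set \<Rightarrow> bform list \<Rightarrow> bform" where
  "lits \<tau> Ds = conj_list (map (\<lambda>A. if A \<in> \<tau> then A else Neg A) Ds)"

lemma satisfies_lits:
  "satisfies M e (lits \<tau> Ds) \<longleftrightarrow> (\<forall>A\<in>set Ds. satisfies M e A \<longleftrightarrow> A \<in> \<tau>)"
  unfolding lits_def satisfies_conj_list set_map ball_simps by (rule ball_cong) auto

text \<open>Finiteness is assumed for \<open>M\<close> only. It makes every type in \<open>k\<close>
  variables isolated by a conjunction of literals, and what this conjunction implies in
  \<open>M\<close> is a sentence, so the same conjunction isolates the same type in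
  \<open>N\<close>.\<close>

theorem finite_types_isomorphic:
  assumes st: "is_structure n M" "is_structure n N"
    and co: "countable (sys_carrier M)" "countable (sys_carrier N)"
    and fin: "\<And>k. finite (ktype n M k ` envs M)"
    and eq: "elem_equiv n M N"
  shows "systems_isomorphic M N"
proof -
  define P where "P G \<longleftrightarrow> (\<exists>k e f. e \<in> envs M \<and> f \<in> envs N \<and> G = (\<lambda>i. (e i, f i)) ` {..<k} \<and>
      ktype n M k e = ktype n N k f)" for G
  have neM: "envs M \<noteq> {}" unfolding ex_in_conv[symmetric] by (rule exI, rule envs_nonempty[OF st(1)])
  have neN: "envs N \<noteq> {}" unfolding ex_in_conv[symmetric] by (rule exI, rule envs_nonempty[OF st(2)])
  have ex: "\<exists>Ds. set Ds \<subseteq> kforms n k \<and> (\<forall>e\<in>envs M. \<forall>e'\<in>envs M.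
      (\<forall>A\<in>set Ds. satisfies M e A \<longleftrightarrow> satisfies M e' A) \<longrightarrow> ktype n M k e = ktype n M k e')" for k
  proof -
    obtain D where D: "finite D" "D \<subseteq> \<Union> (ktype n M k ` envs M)"
      "\<forall>S\<in>ktype n M k ` envs M. \<forall>T\<in>ktype n M k ` envs M. S \<inter> D = T \<inter> D \<longrightarrow> S = T"
      using finite_separating[OF fin[of k]] by (elim exE conjE)
    obtain Ds where Ds: "set Ds = D" using finite_list[OF D(1)] by blast
    have Dk: "D \<subseteq> kforms n k" using D(2) by (auto simp: ktype_def)
    show ?thesis
    proof (intro exI[of _ Ds] conjI ballI impI)
      show "set Ds \<subseteq> kforms n k" using Dk Ds by simp
      fix e e' assume e: "e \<in> envs M" "e' \<in> envs M" "\<forall>A\<in>set Ds. satisfies M e A \<longleftrightarrow> satisfies M e' A"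
      have "ktype n M k e \<inter> D = ktype n M k e' \<inter> D" using e(3) Ds by (auto simp: ktype_def)
      then show "ktype n M k e = ktype n M k e'" using D(3) e by simp
    qed
  qed
  \<comment> \<open>If the literals imply \<open>A\<close> in \<open>M\<close>, then the universal
    closure of this implication is true in \<open>M\<close> and hence in \<open>N\<close>.\<close>
  have same: "ktype n M k e = ktype n N k f"
    if D: "set Ds \<subseteq> kforms n k" "\<forall>e\<in>envs M. \<forall>e'\<in>envs M.
      (\<forall>A\<in>set Ds. satisfies M e A \<longleftrightarrow> satisfies M e' A) \<longrightarrow> ktype n M k e = ktype n M k e'"
      and e: "e \<in> envs M" "satisfies M e (lits \<tau> Ds)" and f: "f \<in> envs N" "satisfies N f (lits \<tau> Ds)"
    for k Ds e f \<tau>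
  proof -
    have lk: "lits \<tau> Ds \<in> kforms n k"
      using D(1) by (auto simp: lits_def kforms_def conj_list_forms free_vars_conj_list split: if_splits)
    have one: "satisfies N f A" if A: "A \<in> kforms n k" "satisfies M e A" for A
    proof -
      define B where "B = Neg (Conj (lits \<tau> Ds) (Neg A))"
      have "satisfies M e' B" if e': "e' \<in> envs M" for e'
      proof (cases "satisfies M e' (lits \<tau> Ds)")
        case True
        then have "\<forall>A\<in>set Ds. satisfies M e A \<longleftrightarrow> satisfies M e' A"
          using e(2) unfolding satisfies_lits by simp
        then have "ktype n M k e = ktype n M k e'" using D(2)[rule_format, OF e(1) e'] by simp
        then have "satisfies M e' A" using A by (auto simp: ktype_def)
        then show ?thesis by (simp add: B_def)
      qed (simp add: B_def)
      moreover have "B \<in> kforms n k" using A lk by (auto simp: B_def kforms_def)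
      ultimately have "satisfies N f B" using valid_transfer[OF eq _ _ neM f(1)] by blast
      then show ?thesis using f(2) by (simp add: B_def)
    qed
    have "satisfies M e A \<longleftrightarrow> satisfies N f A" if A: "A \<in> kforms n k" for A
      using one[OF A] one[of "Neg A"] A by (auto simp: kforms_def)
    then show ?thesis by (auto simp: ktype_def)
  qed
  \<comment> \<open>The existence of a next element satisfying the isolating formula is expressed in
    the first \<open>k\<close> variables, so it is part of the common type and holds on both sides
    or on neither.\<close>
  have exv: "satisfies N f (Neg (Forall k (Neg (lits \<tau> Ds)))) \<longleftrightarrow> satisfies M e (Neg (Forall k (Neg (lits \<tau> Ds))))"
    if D: "set Ds \<subseteq> kforms n (Suc k)" and ty: "ktype n M k e = ktype n N k f" for k Ds e f \<tau>
  proof -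
    have "free_vars (Neg (Forall k (Neg (lits \<tau> Ds)))) \<subseteq> {..<k}"
      using D by (fastforce simp: lits_def kforms_def free_vars_conj_list less_Suc_eq split: if_splits)
    moreover have "Neg (Forall k (Neg (lits \<tau> Ds))) \<in> forms n"
      using D by (auto simp: lits_def kforms_def conj_list_forms)
    ultimately have "Neg (Forall k (Neg (lits \<tau> Ds))) \<in> kforms n k" by (simp add: kforms_def)
    then show ?thesis using ty unfolding ktype_def by blast
  qed
  have ins: "insert (a, b) ((\<lambda>i. (e i, f i)) ` {..<k}) =
      (\<lambda>i. ((e(k := a)) i, (f(k := b)) i)) ` {..<Suc k}" for a b k and e :: "nat \<Rightarrow> 'a" and f :: "nat \<Rightarrow> 'b"
    by (auto simp: lessThan_Suc image_iff)
  have "\<exists>H. (\<forall>a\<in>sys_carrier M. \<exists>b\<in>sys_carrier N. (a, b) \<in> H) \<and>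
      (\<forall>b\<in>sys_carrier N. \<exists>a\<in>sys_carrier M. (a, b) \<in> H) \<and>
      (\<forall>F. finite F \<longrightarrow> F \<subseteq> H \<longrightarrow> (\<exists>G. F \<subseteq> G \<and> P G))"
  proof (rule back_and_forth[OF co])
    show "sys_carrier M \<noteq> {}" "sys_carrier N \<noteq> {}" using st by (auto simp: is_structure_def)
    obtain e f where ef: "e \<in> envs M" "f \<in> envs N" using neM neN by blast
    have "satisfies M e A \<longleftrightarrow> satisfies N f A" if "A \<in> kforms n 0" for A
      using true_sentence_transfer[OF eq _ _ ef, of A] that by (auto simp: kforms_def)
    then have "ktype n M 0 e = ktype n N 0 f" by (auto simp: ktype_def)
    then show "P {}" unfolding P_def using ef by (intro exI[of _ "0::nat"] exI[of _ e] exI[of _ f]) simp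
  next
    fix G a assume "P G" and a: "a \<in> sys_carrier M"
    then obtain k e f where ef: "e \<in> envs M" "f \<in> envs N" "G = (\<lambda>i. (e i, f i)) ` {..<k}"
      "ktype n M k e = ktype n N k f" unfolding P_def by (elim exE conjE)
    obtain Ds where D: "set Ds \<subseteq> kforms n (Suc k)" "\<forall>e\<in>envs M. \<forall>e'\<in>envs M.
      (\<forall>A\<in>set Ds. satisfies M e A \<longleftrightarrow> satisfies M e' A) \<longrightarrow> ktype n M (Suc k) e = ktype n M (Suc k) e'"
      using ex[of "Suc k"] by (elim exE conjE)
    define \<tau> where "\<tau> = {A. satisfies M (e(k := a)) A}"
    have 1: "satisfies M (e(k := a)) (lits \<tau> Ds)" by (simp add: satisfies_lits \<tau>_def)
    then have "satisfies M e (Neg (Forall k (Neg (lits \<tau> Ds))))" using a by auto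
    then have "satisfies N f (Neg (Forall k (Neg (lits \<tau> Ds))))" using exv[OF D(1) ef(4)] by simp
    then obtain b where b: "b \<in> sys_carrier N" "satisfies N (f(k := b)) (lits \<tau> Ds)" by auto
    have "ktype n M (Suc k) (e(k := a)) = ktype n N (Suc k) (f(k := b))"
      by (rule same[OF D envs_upd[OF ef(1) a] 1 envs_upd[OF ef(2) b(1)] b(2)])
    then have "P (insert (a, b) G)" unfolding P_def ef(3) ins
      using envs_upd[OF ef(1) a] envs_upd[OF ef(2) b(1)]
      by (intro exI[of _ "Suc k"] exI[of _ "e(k := a)"] exI[of _ "f(k := b)"]) simp
    then show "\<exists>b\<in>sys_carrier N. P (insert (a, b) G)" using b(1) by (rule bexI)
  next
    fix G b assume "P G" and b: "b \<in> sys_carrier N"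
    then obtain k e f where ef: "e \<in> envs M" "f \<in> envs N" "G = (\<lambda>i. (e i, f i)) ` {..<k}"
      "ktype n M k e = ktype n N k f" unfolding P_def by (elim exE conjE)
    obtain Ds where D: "set Ds \<subseteq> kforms n (Suc k)" "\<forall>e\<in>envs M. \<forall>e'\<in>envs M.
      (\<forall>A\<in>set Ds. satisfies M e A \<longleftrightarrow> satisfies M e' A) \<longrightarrow> ktype n M (Suc k) e = ktype n M (Suc k) e'"
      using ex[of "Suc k"] by (elim exE conjE)
    define \<tau> where "\<tau> = {A. satisfies N (f(k := b)) A}"
    have 1: "satisfies N (f(k := b)) (lits \<tau> Ds)" by (simp add: satisfies_lits \<tau>_def)
    then have "satisfies N f (Neg (Forall k (Neg (lits \<tau> Ds))))" using b by auto
    then have "satisfies M e (Neg (Forall k (Neg (lits \<tau> Ds))))" using exv[OF D(1) ef(4)] by simp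
    then obtain a where a: "a \<in> sys_carrier M" "satisfies M (e(k := a)) (lits \<tau> Ds)" by auto
    have "ktype n M (Suc k) (e(k := a)) = ktype n N (Suc k) (f(k := b))"
      by (rule same[OF D envs_upd[OF ef(1) a(1)] a(2) envs_upd[OF ef(2) b] 1])
    then have "P (insert (a, b) G)" unfolding P_def ef(3) ins
      using envs_upd[OF ef(1) a(1)] envs_upd[OF ef(2) b]
      by (intro exI[of _ "Suc k"] exI[of _ "e(k := a)"] exI[of _ "f(k := b)"]) simp
    then show "\<exists>a\<in>sys_carrier M. P (insert (a, b) G)" using a(1) by (rule bexI)
  qed
  then obtain H where H: "\<forall>a\<in>sys_carrier M. \<exists>b\<in>sys_carrier N. (a, b) \<in> H"
    "\<forall>b\<in>sys_carrier N. \<exists>a\<in>sys_carrier M. (a, b) \<in> H"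
    "\<forall>F. finite F \<longrightarrow> F \<subseteq> H \<longrightarrow> (\<exists>G. F \<subseteq> G \<and> P G)" by (elim exE conjE)
  \<comment> \<open>Three pairs lie in one finite partial map with equal types, so atomic formulas
    about them transfer. These give injectivity, zero, sums, products and predicates in
    turn.\<close>
  have fin3: "\<exists>e f. e \<in> envs M \<and> f \<in> envs N \<and> (\<exists>i j l. (a, b) = (e i, f i) \<and> (c, d) = (e j, f j) \<and> (x, y) = (e l, f l) \<and>
      (\<forall>A\<in>forms n. free_vars A \<subseteq> {i, j, l} \<longrightarrow> (satisfies M e A \<longleftrightarrow> satisfies N f A)))"
    if h: "(a, b) \<in> H" "(c, d) \<in> H" "(x, y) \<in> H" for a b c d x y
  proof -
    have "finite {(a, b), (c, d), (x, y)}" "{(a, b), (c, d), (x, y)} \<subseteq> H" using h by auto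
    then obtain G where G: "{(a, b), (c, d), (x, y)} \<subseteq> G" "P G" using H(3) by meson
    then obtain k e f where ef: "e \<in> envs M" "f \<in> envs N" "G = (\<lambda>i. (e i, f i)) ` {..<k}"
      "ktype n M k e = ktype n N k f" unfolding P_def by (elim exE conjE)
    obtain i j l where ijl: "i < k" "j < k" "l < k" "(a, b) = (e i, f i)" "(c, d) = (e j, f j)" "(x, y) = (e l, f l)"
      using G(1) unfolding ef(3) by auto
    have "satisfies M e A \<longleftrightarrow> satisfies N f A" if A: "A \<in> forms n" "free_vars A \<subseteq> {i, j, l}" for A
    proof -
      have "A \<in> kforms n k" using A ijl by (auto simp: kforms_def)
      then show ?thesis using ef(4) unfolding ktype_def by blast
    qed
    then show ?thesis using ef(1,2) ijl by (intro exI[of _ e] exI[of _ f] conjI exI[of _ i] exI[of _ j] exI[of _ l]) simp_all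
  qed
  show ?thesis
  proof (rule iso_of_relation[OF st H(1,2)])
    fix a b c d assume h: "(a, b) \<in> H" "(c, d) \<in> H"
    obtain e f i j l where *: "(a, b) = (e i, f i)" "(c, d) = (e j, f j)"
      "\<forall>A\<in>forms n. free_vars A \<subseteq> {i, j, l} \<longrightarrow> (satisfies M e A \<longleftrightarrow> satisfies N f A)"
      using fin3[OF h h(2)] by (elim exE conjE)
    show "a = c \<longleftrightarrow> b = d" using *(3)[rule_format, of "Equal (Var i) (Var j)"] *(1,2) by auto
  next
    fix b assume h: "(sys_zero M, b) \<in> H"
    obtain e f i j l where *: "(sys_zero M, b) = (e i, f i)"
      "\<forall>A\<in>forms n. free_vars A \<subseteq> {i, j, l} \<longrightarrow> (satisfies M e A \<longleftrightarrow> satisfies N f A)"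
      using fin3[OF h h h] by (elim exE conjE)
    show "b = sys_zero N" using *(2)[rule_format, of "Equal (Var i) Zero"] *(1) by auto
  next
    fix a b c d x assume h: "(a, b) \<in> H" "(c, d) \<in> H" "(sys_add M a c, x) \<in> H"
    obtain e f i j l where *: "(a, b) = (e i, f i)" "(c, d) = (e j, f j)" "(sys_add M a c, x) = (e l, f l)"
      "\<forall>A\<in>forms n. free_vars A \<subseteq> {i, j, l} \<longrightarrow> (satisfies M e A \<longleftrightarrow> satisfies N f A)"
      using fin3[OF h] by (elim exE conjE)
    show "x = sys_add N b d" using *(4)[rule_format, of "Equal (Var l) (Add (Var i) (Var j))"] *(1-3) by auto
  next
    fix a b c d x assume h: "(a, b) \<in> H" "(c, d) \<in> H" "(sys_mult M a c, x) \<in> H"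
    obtain e f i j l where *: "(a, b) = (e i, f i)" "(c, d) = (e j, f j)" "(sys_mult M a c, x) = (e l, f l)"
      "\<forall>A\<in>forms n. free_vars A \<subseteq> {i, j, l} \<longrightarrow> (satisfies M e A \<longleftrightarrow> satisfies N f A)"
      using fin3[OF h] by (elim exE conjE)
    show "x = sys_mult N b d" using *(4)[rule_format, of "Equal (Var l) (Mult (Var i) (Var j))"] *(1-3) by auto
  next
    fix a b m assume h: "(a, b) \<in> H" and m: "m < n"
    obtain e f i j l where *: "(a, b) = (e i, f i)"
      "\<forall>A\<in>forms n. free_vars A \<subseteq> {i, j, l} \<longrightarrow> (satisfies M e A \<longleftrightarrow> satisfies N f A)"
      using fin3[OF h h h] by (elim exE conjE)
    show "a \<in> sys_preds M ! m \<longleftrightarrow> b \<in> sys_preds N ! m"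
      using *(2)[rule_format, of "Pred m (Var i)"] *(1) m by auto
  qed
qed

section \<open>Boolean spaces\<close>

text \<open>\<open>B\<close> plays the role of the compact open sets of a locally compact
  zero-dimensional Hausdorff space; \<open>Z\<close> need not belong to it. \<open>B_compact\<close>
  expresses compactness through ideals of \<open>B\<close> instead of covers: the sets covered by
  finitely many members of a cover form such an ideal.\<close>

locale boolean_space =
  fixes Z :: "'z set" and B :: "'z set set"
  assumes B_sub: "b \<in> B \<Longrightarrow> b \<subseteq> Z"
    and B_empty: "{} \<in> B"
    and B_Un: "a \<in> B \<Longrightarrow> b \<in> B \<Longrightarrow> a \<union> b \<in> B"
    and B_Diff: "a \<in> B \<Longrightarrow> b \<in> B \<Longrightarrow> a - b \<in> B"
    and B_cover: "x \<in> Z \<Longrightarrow> \<exists>b\<in>B. x \<in> b"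
    and B_sep: "x \<in> Z \<Longrightarrow> y \<in> Z \<Longrightarrow> x \<noteq> y \<Longrightarrow> \<exists>b\<in>B. x \<in> b \<and> y \<notin> b"
    and B_compact: "I \<subseteq> B \<Longrightarrow> {} \<in> I \<Longrightarrow> (\<And>a b. a \<in> I \<Longrightarrow> b \<in> I \<Longrightarrow> a \<union> b \<in> I) \<Longrightarrow>
      (\<And>a b. a \<in> I \<Longrightarrow> b \<in> B \<Longrightarrow> b \<subseteq> a \<Longrightarrow> b \<in> I) \<Longrightarrow> b \<in> B \<Longrightarrow> b \<subseteq> \<Union>I \<Longrightarrow> b \<in> I"

definition sderived :: "'z set \<Rightarrow> 'z set set \<Rightarrow> 'z set \<Rightarrow> 'z set" where
  "sderived Z B A = {x \<in> Z. \<forall>b\<in>B. x \<in> b \<longrightarrow> (\<exists>y\<in>A \<inter> b. y \<noteq> x)}"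

definition sclosed :: "'z set \<Rightarrow> 'z set set \<Rightarrow> 'z set \<Rightarrow> bool" where
  "sclosed Z B A \<longleftrightarrow> A \<subseteq> Z \<and> (\<forall>x\<in>Z - A. \<exists>b\<in>B. x \<in> b \<and> b \<inter> A = {})"

context boolean_space
begin

lemma B_Int: "a \<in> B \<Longrightarrow> b \<in> B \<Longrightarrow> a \<inter> b \<in> B"
  using B_Diff[of a "a - b"] B_Diff[of a b] by (simp add: Diff_Diff_Int)

lemma B_avoid_finite:
  assumes "finite F" "F \<subseteq> Z" "x \<in> Z" "x \<notin> F"
  shows "\<exists>b\<in>B. x \<in> b \<and> b \<inter> F = {}"
  using assms
proof (induction F rule: finite_induct)
  case empty
  then show ?case using B_cover by auto
next
  case (insert y F)
  then obtain b c where "b \<in> B" "x \<in> b" "b \<inter> F = {}" "c \<in> B" "x \<in> c" "y \<notin> c"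
    using B_sep[of x y] by auto
  then show ?case by (intro bexI[of _ "b \<inter> c"]) (auto intro: B_Int)
qed

text \<open>A closed set inside a member of \<open>B\<close> is compact. The ideal used consists of
  the members of \<open>B\<close> whose share of \<open>K\<close> is already enclosed by a basic set
  inside \<open>U\<close>.\<close>

lemma B_separate:
  assumes K: "sclosed Z B K" "a \<in> B" "K \<subseteq> a"
    and U: "\<And>x. x \<in> K \<Longrightarrow> \<exists>b\<in>B. x \<in> b \<and> b \<subseteq> U"
  shows "\<exists>s\<in>B. K \<subseteq> s \<and> s \<subseteq> U"
proof -
  define I where "I = {c \<in> B. \<exists>s\<in>B. s \<subseteq> U \<and> (c - s) \<inter> K = {}}"
  have "a \<in> I"
  proof (rule B_compact)
    show "I \<subseteq> B" "{} \<in> I" using B_empty by (auto simp: I_def)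
    show "c \<union> d \<in> I" if cd: "c \<in> I" "d \<in> I" for c d
    proof -
      obtain s t where "s \<in> B" "s \<subseteq> U" "(c - s) \<inter> K = {}" "t \<in> B" "t \<subseteq> U" "(d - t) \<inter> K = {}"
        using cd unfolding I_def by blast
      then have "s \<union> t \<in> B" "s \<union> t \<subseteq> U" "(c \<union> d - (s \<union> t)) \<inter> K = {}" using B_Un by blast+
      then show ?thesis using cd B_Un unfolding I_def by blast
    qed
    show "d \<in> I" if "c \<in> I" "d \<in> B" "d \<subseteq> c" for c d
      using that unfolding I_def by blast
    show "a \<subseteq> \<Union>I"
    proof
      fix x assume x: "x \<in> a"
      show "x \<in> \<Union>I"
      proof (cases "x \<in> K")
        case True
        then obtain b where "b \<in> B" "x \<in> b" "b \<subseteq> U" using U by blast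
        moreover from this have "b \<in> I" unfolding I_def by blast
        ultimately show ?thesis by blast
      next
        case False
        then obtain b where "b \<in> B" "x \<in> b" "b \<inter> K = {}"
          using K(1) x B_sub[OF K(2)] unfolding sclosed_def by blast
        moreover from this have "b \<in> I" using B_empty unfolding I_def by blast
        ultimately show ?thesis by blast
      qed
    qed
  qed (rule K(2))
  then show ?thesis using K(3) unfolding I_def by blast
qed

text \<open>The Bolzano-Weierstrass property: without a limit point in \<open>b\<close>, the basic
  sets meeting \<open>A\<close> in finitely many points form an ideal that covers
  \<open>b\<close>.\<close>

lemma infinite_sderived:
  assumes "b \<in> B" "infinite (A \<inter> b)"
  shows "\<exists>x\<in>b. x \<in> sderived Z B A"
proof (rule ccontr)
  assume n: "\<not> ?thesis"
  define I where "I = {c \<in> B. finite (A \<inter> c)}"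
  have "b \<in> I"
  proof (rule B_compact)
    show "I \<subseteq> B" "{} \<in> I" using B_empty by (auto simp: I_def)
    show "c \<union> d \<in> I" if "c \<in> I" "d \<in> I" for c d
      using that B_Un by (auto simp: I_def Int_Un_distrib)
    show "d \<in> I" if "c \<in> I" "d \<in> B" "d \<subseteq> c" for c d
      using that unfolding I_def by (auto intro: rev_finite_subset)
    show "b \<subseteq> \<Union>I"
    proof
      fix x assume x: "x \<in> b"
      then have "x \<in> Z" "x \<notin> sderived Z B A" using n B_sub[OF assms(1)] by auto
      then obtain c where c: "c \<in> B" "x \<in> c" "\<forall>y\<in>A \<inter> c. y = x"
        unfolding sderived_def by blast
      then have "A \<inter> c \<subseteq> {x}" by blast
      then have "finite (A \<inter> c)" using finite_subset by blast
      then show "x \<in> \<Union>I" using c unfolding I_def by blast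
    qed
  qed (rule assms(1))
  then show False using assms(2) by (simp add: I_def)
qed

text \<open>Finitely many points other than \<open>x\<close> could be cut away by a smaller
  neighbourhood, which would then contain no point of \<open>A\<close> except possibly
  \<open>x\<close>.\<close>

lemma sderived_infinite:
  assumes "b \<in> B" "x \<in> b" "x \<in> sderived Z B A" "A \<subseteq> Z"
  shows "infinite (A \<inter> b)"
proof
  assume f: "finite (A \<inter> b)"
  have "\<exists>c\<in>B. x \<in> c \<and> c \<inter> (A \<inter> b - {x}) = {}"
    by (rule B_avoid_finite) (use f assms B_sub[OF assms(1)] in auto)
  then obtain c where c: "c \<in> B" "x \<in> c" "c \<inter> (A \<inter> b - {x}) = {}" by blast
  have "b \<inter> c \<in> B" using B_Int c assms by blast
  then obtain y where "y \<in> A \<inter> (b \<inter> c)" "y \<noteq> x"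
    using assms(2,3) c(2) unfolding sderived_def by blast
  then show False using c by blast
qed

lemma sderived_finite:
  assumes "finite A" "A \<subseteq> Z"
  shows "sderived Z B A = {}"
proof (rule equals0I)
  fix x assume x: "x \<in> sderived Z B A"
  then have "x \<in> Z" by (simp add: sderived_def)
  then obtain b where "b \<in> B" "x \<in> b" using B_cover by blast
  from sderived_infinite[OF this x assms(2)] show False using assms(1) by simp
qed

lemma sclosed_sderived: "A \<subseteq> Z \<Longrightarrow> sclosed Z B (sderived Z B A)"
  unfolding sclosed_def
proof (intro conjI ballI)
  show "sderived Z B A \<subseteq> Z" by (auto simp: sderived_def)
  fix x assume A: "A \<subseteq> Z" and x: "x \<in> Z - sderived Z B A"
  then obtain b where b: "b \<in> B" "x \<in> b" "\<forall>y\<in>A \<inter> b. y = x" unfolding sderived_def by blast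
  then have "A \<inter> b \<subseteq> {x}" by blast
  then have "finite (A \<inter> b)" using finite_subset by blast
  then have "b \<inter> sderived Z B A = {}" using sderived_infinite[OF b(1) _ _ A] by blast
  then show "\<exists>b\<in>B. x \<in> b \<and> b \<inter> sderived Z B A = {}" using b by blast
qed

lemma sderivedD: "x \<in> sderived Z B A \<Longrightarrow> b \<in> B \<Longrightarrow> x \<in> b \<Longrightarrow> \<exists>y\<in>A \<inter> b. y \<noteq> x"
  unfolding sderived_def mem_Collect_eq by simp

lemma sderivedI:
  assumes "x \<in> Z" "\<And>b. b \<in> B \<Longrightarrow> x \<in> b \<Longrightarrow> \<exists>y\<in>A \<inter> b. y \<noteq> x"
  shows "x \<in> sderived Z B A"
  using assms unfolding sderived_def mem_Collect_eq by simp

lemma sderived_mono: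
  assumes "A \<subseteq> C" shows "sderived Z B A \<subseteq> sderived Z B C"
proof
  fix x assume x: "x \<in> sderived Z B A"
  show "x \<in> sderived Z B C"
  proof (rule sderivedI)
    show "x \<in> Z" using x by (simp add: sderived_def)
    fix b assume "b \<in> B" "x \<in> b"
    from sderivedD[OF x this] show "\<exists>y\<in>C \<inter> b. y \<noteq> x" using assms by blast
  qed
qed

lemma sderived_Un: "sderived Z B (A \<union> C) = sderived Z B A \<union> sderived Z B C"
proof
  show "sderived Z B (A \<union> C) \<subseteq> sderived Z B A \<union> sderived Z B C"
  proof
    fix x assume x: "x \<in> sderived Z B (A \<union> C)"
    then have xZ: "x \<in> Z" by (simp add: sderived_def)
    show "x \<in> sderived Z B A \<union> sderived Z B C"
    proof (rule ccontr)
      assume "x \<notin> sderived Z B A \<union> sderived Z B C"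
      then have nA: "x \<notin> sderived Z B A" and nC: "x \<notin> sderived Z B C" by auto
      obtain b where b: "b \<in> B" "x \<in> b" "\<forall>y\<in>A \<inter> b. y = x"
        using nA xZ by (auto simp: sderived_def)
      obtain c where c: "c \<in> B" "x \<in> c" "\<forall>y\<in>C \<inter> c. y = x"
        using nC xZ by (auto simp: sderived_def)
      have "b \<inter> c \<in> B" "x \<in> b \<inter> c" using B_Int b c by simp_all
      from sderivedD[OF x this] obtain y where "y \<in> (A \<union> C) \<inter> (b \<inter> c)" "y \<noteq> x" by (elim bexE)
      then show False using b c by auto
    qed
  qed
  show "sderived Z B A \<union> sderived Z B C \<subseteq> sderived Z B (A \<union> C)"
    by (intro Un_least sderived_mono) simp_all
qed

lemma sderived_UN: "finite F \<Longrightarrow> sderived Z B (\<Union>F) = (\<Union>A\<in>F. sderived Z B A)"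
proof (induction F rule: finite_induct)
  case empty
  then show ?case using sderived_finite[of "{}"] by simp
qed (simp add: sderived_Un)

lemma sclosedD:
  assumes "sclosed Z B A" shows "sderived Z B A \<subseteq> A"
proof (rule subsetI, rule ccontr)
  fix x assume x: "x \<in> sderived Z B A" "x \<notin> A"
  then have "x \<in> Z - A" by (simp add: sderived_def)
  then obtain b where "b \<in> B" "x \<in> b" "b \<inter> A = {}" using assms unfolding sclosed_def by blast
  then show False using sderivedD[OF x(1), of b] by auto
qed

lemma sclosed_of_sderived:
  assumes "A \<subseteq> Z" "sderived Z B A \<subseteq> A"
  shows "sclosed Z B A"
  unfolding sclosed_def
proof (intro conjI ballI assms(1))
  fix x assume x: "x \<in> Z - A"
  then have "x \<notin> sderived Z B A" "x \<in> Z" using assms(2) by auto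
  then obtain b where b: "b \<in> B" "x \<in> b" "\<forall>y\<in>A \<inter> b. y = x" by (auto simp: sderived_def)
  then have "b \<inter> A = {}" using x by auto
  then show "\<exists>b\<in>B. x \<in> b \<and> b \<inter> A = {}" using b by auto
qed

lemma sclosed_UN:
  assumes "finite F" "\<And>A. A \<in> F \<Longrightarrow> sclosed Z B A"
  shows "sclosed Z B (\<Union>F)"
proof (rule sclosed_of_sderived)
  show "\<Union>F \<subseteq> Z" using assms(2) unfolding sclosed_def by blast
  show "sderived Z B (\<Union>F) \<subseteq> \<Union>F"
    unfolding sderived_UN[OF assms(1)] using sclosedD[OF assms(2)] by (rule UN_mono[of F F "sderived Z B" "\<lambda>A. A", simplified])
qed

end

text \<open>The purely topological share of \<open>realises\<close>, without the ideals. Compactness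
  of the closure is replaced by inclusion in a member of \<open>B\<close>, which is equivalent to it
  in Stone spaces.\<close>

definition sreal :: "'z set \<Rightarrow> 'z set set \<Rightarrow> 'p potuple \<Rightarrow> ('p \<Rightarrow> 'z set) \<Rightarrow> bool" where
  "sreal Z B T X \<longleftrightarrow>
     (\<forall>p\<in>po_points T. X p \<noteq> {}) \<and>
     disjoint_family_on X (po_points T) \<and>
     (\<Union>p\<in>po_points T. X p) = Z \<and>
     (\<forall>p\<in>po_points T. sderived Z B (X p) = (\<Union>q\<in>{q \<in> po_points T. (q, p) \<in> po_less T}. X q)) \<and>
     po_L T = {p \<in> po_points T. \<exists>b\<in>B. X p \<subseteq> b} \<and>
     (\<forall>p\<in>L_min_d T. finite (X p) \<and> card (X p) = po_f T p)"

text \<open>\<open>d\<close> sends a ring element to its compact open set. The points may have any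
  type, so prime ideals and paths are treated alike, and changing the carrier of the ring only
  changes \<open>d\<close>.\<close>

definition represented_on ::
    "nat \<Rightarrow> 'a bsystem \<Rightarrow> 'p potuple \<Rightarrow> 'z set \<Rightarrow> ('a \<Rightarrow> 'z set) \<Rightarrow> ('p \<Rightarrow> 'z set) \<Rightarrow> bool" where
  "represented_on n M T Z d X \<longleftrightarrow>
     is_structure n M \<and> T \<in> po_tuples n \<and>
     boolean_space Z (d ` sys_carrier M) \<and> inj_on d (sys_carrier M) \<and>
     d (sys_zero M) = {} \<and>
     (\<forall>a\<in>sys_carrier M. \<forall>b\<in>sys_carrier M.
        d (sys_add M a b) = (d a - d b) \<union> (d b - d a) \<and> d (sys_mult M a b) = d a \<inter> d b) \<and>
     sreal Z (d ` sys_carrier M) T X \<and>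
     (\<forall>i<n. sys_preds M ! i = {a \<in> sys_carrier M. d a \<inter> (\<Union>p\<in>po_Qs T ! i. X p) = {}})"

section \<open>The Stone space of a Boolean ring\<close>

locale bring =
  fixes M :: "'a bsystem"
  assumes br: "boolean_ring M"
begin

abbreviation R where "R \<equiv> sys_carrier M"
abbreviation add (infixl "\<oplus>" 65) where "a \<oplus> b \<equiv> sys_add M a b"
abbreviation mul (infixl "\<odot>" 70) where "a \<odot> b \<equiv> sys_mult M a b"
abbreviation zero ("\<zero>") where "\<zero> \<equiv> sys_zero M"

lemma ag: "comm_group (additive_group M)"
  using br by (simp add: boolean_ring_def)

lemma grp: "group (additive_group M)"
  using ag by (rule comm_group.axioms(2))

lemma ag_simps [simp]: "carrier (additive_group M) = R" "monoid.mult (additive_group M) = sys_add M"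
  "one (additive_group M) = \<zero>"
  by (auto simp: additive_group_def)

lemma add_cl [simp]: "x \<in> R \<Longrightarrow> y \<in> R \<Longrightarrow> x \<oplus> y \<in> R"
  using group.is_monoid[OF grp] monoid.m_closed ag_simps by metis

lemma zero_cl [simp]: "\<zero> \<in> R"
  using group.is_monoid[OF grp] monoid.one_closed ag_simps by metis

lemma mul_cl [simp]: "x \<in> R \<Longrightarrow> y \<in> R \<Longrightarrow> x \<odot> y \<in> R"
  using br by (simp add: boolean_ring_def)

lemma add_assoc: "x \<in> R \<Longrightarrow> y \<in> R \<Longrightarrow> z \<in> R \<Longrightarrow> x \<oplus> y \<oplus> z = x \<oplus> (y \<oplus> z)"
  using group.is_monoid[OF grp] monoid.m_assoc ag_simps by metis

lemma add_comm: "x \<in> R \<Longrightarrow> y \<in> R \<Longrightarrow> x \<oplus> y = y \<oplus> x"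
  using comm_monoid.m_comm[OF comm_group.axioms(1)[OF ag]] ag_simps by metis

lemma add_zero [simp]: "x \<in> R \<Longrightarrow> x \<oplus> \<zero> = x" "x \<in> R \<Longrightarrow> \<zero> \<oplus> x = x"
  using group.is_monoid[OF grp] monoid.r_one monoid.l_one ag_simps by metis+

lemma add_cancel: "x \<in> R \<Longrightarrow> y \<in> R \<Longrightarrow> z \<in> R \<Longrightarrow> x \<oplus> y = x \<oplus> z \<Longrightarrow> y = z"
  using monoid.Units_l_cancel[OF group.is_monoid[OF grp]] group.Units_eq[OF grp] ag_simps by metis

lemma add_lcomm: "x \<in> R \<Longrightarrow> y \<in> R \<Longrightarrow> z \<in> R \<Longrightarrow> x \<oplus> (y \<oplus> z) = y \<oplus> (x \<oplus> z)"
  using add_assoc[of x y z] add_assoc[of y x z] add_comm[of x y] by simp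

lemmas add_ac = add_assoc add_comm add_lcomm

lemma mul_assoc: "x \<in> R \<Longrightarrow> y \<in> R \<Longrightarrow> z \<in> R \<Longrightarrow> x \<odot> y \<odot> z = x \<odot> (y \<odot> z)"
  and distl: "x \<in> R \<Longrightarrow> y \<in> R \<Longrightarrow> z \<in> R \<Longrightarrow> x \<odot> (y \<oplus> z) = x \<odot> y \<oplus> x \<odot> z"
  and distr: "x \<in> R \<Longrightarrow> y \<in> R \<Longrightarrow> z \<in> R \<Longrightarrow> (x \<oplus> y) \<odot> z = x \<odot> z \<oplus> y \<odot> z"
  and idem [simp]: "x \<in> R \<Longrightarrow> x \<odot> x = x"
  using br by (simp_all add: boolean_ring_def)

lemma double [simp]: assumes x: "x \<in> R" shows "x \<oplus> x = \<zero>"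
proof -
  have "(x \<oplus> x) \<oplus> (x \<oplus> x) = (x \<oplus> x) \<odot> x \<oplus> (x \<oplus> x) \<odot> x" using x by (simp add: distr)
  also have "\<dots> = (x \<oplus> x) \<odot> (x \<oplus> x)" by (rule distl[symmetric]) (simp_all add: x)
  also have "\<dots> = (x \<oplus> x) \<oplus> \<zero>" using x by simp
  finally show ?thesis using add_cancel[of "x \<oplus> x" "x \<oplus> x" \<zero>] x by simp
qed

lemma add_left_double [simp]: "x \<in> R \<Longrightarrow> y \<in> R \<Longrightarrow> x \<oplus> (x \<oplus> y) = y"
  using add_assoc[of x x y] by simp

lemma mul_comm: assumes "x \<in> R" "y \<in> R" shows "x \<odot> y = y \<odot> x"
proof -
  have "x \<oplus> y = (x \<oplus> y) \<odot> (x \<oplus> y)" using assms by simp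
  also have "\<dots> = (x \<oplus> y) \<odot> x \<oplus> (x \<oplus> y) \<odot> y" by (rule distl) (simp_all add: assms)
  also have "\<dots> = (x \<oplus> y \<odot> x) \<oplus> (x \<odot> y \<oplus> y)" using assms by (simp add: distr)
  also have "\<dots> = x \<oplus> (y \<odot> x \<oplus> (x \<odot> y \<oplus> y))" by (rule add_assoc) (simp_all add: assms)
  finally have "y = y \<odot> x \<oplus> (x \<odot> y \<oplus> y)"
    by (rule add_cancel[rotated 3]) (simp_all add: assms)
  also have "\<dots> = (y \<odot> x \<oplus> x \<odot> y) \<oplus> y" by (rule add_assoc[symmetric]) (simp_all add: assms)
  also have "\<dots> = y \<oplus> (y \<odot> x \<oplus> x \<odot> y)" by (rule add_comm) (simp_all add: assms)
  finally have "y \<oplus> \<zero> = y \<oplus> (y \<odot> x \<oplus> x \<odot> y)" using assms by simp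
  then have "\<zero> = y \<odot> x \<oplus> x \<odot> y" by (rule add_cancel[rotated 3]) (simp_all add: assms)
  then have "y \<odot> x \<oplus> y \<odot> x = y \<odot> x \<oplus> x \<odot> y" using assms by simp
  then show ?thesis by (rule add_cancel[rotated 3, symmetric]) (simp_all add: assms)
qed

lemma mul_zero [simp]: assumes "x \<in> R" shows "x \<odot> \<zero> = \<zero>" "\<zero> \<odot> x = \<zero>"
proof -
  have "x \<odot> \<zero> = x \<odot> (\<zero> \<oplus> \<zero>)" by simp
  also have "\<dots> = \<zero>" using assms by (simp add: distl del: double add_zero)  (simp add: assms)
  finally show "x \<odot> \<zero> = \<zero>" .
  then show "\<zero> \<odot> x = \<zero>" using mul_comm[of x \<zero>] assms by simp
qed

lemma ideal_iff: "ring_ideal M J \<longleftrightarrow> J \<subseteq> R \<and> \<zero> \<in> J \<and> (\<forall>a\<in>J. \<forall>b\<in>J. a \<oplus> b \<in> J) \<and> (\<forall>a\<in>J. \<forall>x\<in>R. x \<odot> a \<in> J)"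
proof
  assume "ring_ideal M J"
  then show "J \<subseteq> R \<and> \<zero> \<in> J \<and> (\<forall>a\<in>J. \<forall>b\<in>J. a \<oplus> b \<in> J) \<and> (\<forall>a\<in>J. \<forall>x\<in>R. x \<odot> a \<in> J)"
    unfolding ring_ideal_def using subgroup.subset[of J "additive_group M"]
      subgroup.m_closed[of J "additive_group M"] subgroup.one_closed[of J "additive_group M"] by simp
next
  assume *: "J \<subseteq> R \<and> \<zero> \<in> J \<and> (\<forall>a\<in>J. \<forall>b\<in>J. a \<oplus> b \<in> J) \<and> (\<forall>a\<in>J. \<forall>x\<in>R. x \<odot> a \<in> J)"
  have "inv\<^bsub>additive_group M\<^esub> x = x" if "x \<in> R" for x
    by (rule group.inv_equality[OF grp]) (use that in simp_all)
  then have "subgroup J (additive_group M)"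
    by (intro subgroup.intro) (use * in \<open>auto simp: subset_iff\<close>)
  then show "ring_ideal M J" unfolding ring_ideal_def using * mul_comm by (metis subsetD)
qed

lemma ideal_sub: "ring_ideal M J \<Longrightarrow> a \<in> J \<Longrightarrow> a \<in> R"
  and ideal_zero: "ring_ideal M J \<Longrightarrow> \<zero> \<in> J"
  and ideal_add: "ring_ideal M J \<Longrightarrow> a \<in> J \<Longrightarrow> b \<in> J \<Longrightarrow> a \<oplus> b \<in> J"
  and ideal_mul: "ring_ideal M J \<Longrightarrow> a \<in> J \<Longrightarrow> x \<in> R \<Longrightarrow> x \<odot> a \<in> J"
  and ideal_mul2: "ring_ideal M J \<Longrightarrow> a \<in> J \<Longrightarrow> x \<in> R \<Longrightarrow> a \<odot> x \<in> J"
  by (auto simp: ideal_iff) (metis mul_comm subsetD)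

lemma ideal_cancel: "ring_ideal M J \<Longrightarrow> a \<in> J \<Longrightarrow> b \<in> R \<Longrightarrow> a \<oplus> b \<in> J \<Longrightarrow> b \<in> J"
  using ideal_add[of J a "a \<oplus> b"] ideal_sub[of J a] by simp

text \<open>By Zorn there is an ideal \<open>I\<close> maximal among those that contain
  \<open>J\<close> and miss \<open>a\<close>. Modulo \<open>I\<close>, the element \<open>a\<close>
  acts as an identity on every \<open>x\<close> outside \<open>I\<close> in the sense that
  \<open>a = ax\<close>, and this makes \<open>I\<close> prime.\<close>

lemma prime_exists:
  assumes J: "ring_ideal M J" and a: "a \<in> R" "a \<notin> J"
  shows "\<exists>I\<in>stone_points M. J \<subseteq> I \<and> a \<notin> I"
proof -
  define \<A> where "\<A> = {I. ring_ideal M I \<and> J \<subseteq> I \<and> a \<notin> I}"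
  have "\<exists>I\<in>\<A>. \<forall>K\<in>\<A>. I \<subseteq> K \<longrightarrow> K = I"
  proof (rule subset_Zorn_nonempty)
    show "\<A> \<noteq> {}" using assms by (auto simp: \<A>_def)
    fix C assume C: "C \<noteq> {}" "subset.chain \<A> C"
    then have id: "\<And>I. I \<in> C \<Longrightarrow> ring_ideal M I \<and> J \<subseteq> I \<and> a \<notin> I"
      and ch: "\<And>I K. I \<in> C \<Longrightarrow> K \<in> C \<Longrightarrow> I \<subseteq> K \<or> K \<subseteq> I"
      unfolding \<A>_def subset.chain_def by blast+
    have idl: "ring_ideal M I" if "I \<in> C" for I using id[OF that] by simp
    have "ring_ideal M (\<Union>C)" unfolding ideal_iff
    proof (intro conjI ballI)
      show "\<Union>C \<subseteq> R" using ideal_sub[OF idl] by auto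
      obtain I where "I \<in> C" using C(1) by auto
      then show "\<zero> \<in> \<Union>C" using ideal_zero[OF idl] by auto
      show "x \<oplus> y \<in> \<Union>C" if xy: "x \<in> \<Union>C" "y \<in> \<Union>C" for x y
      proof -
        obtain I K where IK: "I \<in> C" "x \<in> I" "K \<in> C" "y \<in> K" using xy by auto
        obtain L where "L \<in> C" "x \<in> L" "y \<in> L" using ch[of I K] IK by auto
        then show ?thesis using ideal_add[OF idl, of L x y] by auto
      qed
      show "x \<odot> y \<in> \<Union>C" if y: "y \<in> \<Union>C" and x: "x \<in> R" for x y
      proof -
        obtain L where "L \<in> C" "y \<in> L" using y by auto
        then show ?thesis using ideal_mul[OF idl, of L y x] x by auto
      qed
    qed
    moreover have "J \<subseteq> \<Union>C" using C(1) id by fastforce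
    moreover have "a \<notin> \<Union>C" using id by auto
    ultimately show "\<Union>C \<in> \<A>" unfolding \<A>_def by simp
  qed
  then obtain I where IA: "I \<in> \<A>" and mxA: "\<forall>K\<in>\<A>. I \<subseteq> K \<longrightarrow> K = I" by (elim bexE)
  have I: "ring_ideal M I" "J \<subseteq> I" "a \<notin> I" using IA by (simp_all add: \<A>_def)
  have mx: "K = I" if "ring_ideal M K" "J \<subseteq> K" "a \<notin> K" "I \<subseteq> K" for K
    using mxA that by (simp add: \<A>_def)
  have key: "a \<oplus> a \<odot> x \<in> I" if x: "x \<in> R" "x \<notin> I" for x
  proof (rule ccontr)
    assume n: "a \<oplus> a \<odot> x \<notin> I"
    \<comment> \<open>The ideal quotient of \<open>I\<close> by \<open>1 + x\<close>, written
      without an identity. It contains \<open>I\<close> and \<open>x\<close>, so by maximality of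
      \<open>I\<close> it must contain \<open>a\<close>.\<close>
    define K where "K = {z \<in> R. z \<oplus> z \<odot> x \<in> I}"
    have "ring_ideal M K" unfolding ideal_iff
    proof (intro conjI ballI)
      show "K \<subseteq> R" by (auto simp: K_def)
      show "\<zero> \<in> K" using ideal_zero[OF I(1)] x by (simp add: K_def)
      show "u \<oplus> v \<in> K" if uv: "u \<in> K" "v \<in> K" for u v
      proof -
        have "u \<in> R" "v \<in> R" using uv by (auto simp: K_def)
        then have "(u \<oplus> v) \<oplus> (u \<oplus> v) \<odot> x = (u \<oplus> u \<odot> x) \<oplus> (v \<oplus> v \<odot> x)"
          using x by (simp add: distr add_assoc add_lcomm[of v "u \<odot> x" "v \<odot> x"])
        then show ?thesis using uv ideal_add[OF I(1)] by (simp add: K_def)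
      qed
      show "w \<odot> u \<in> K" if uw: "u \<in> K" "w \<in> R" for u w
      proof -
        have "u \<in> R" using uw by (auto simp: K_def)
        then have "w \<odot> u \<oplus> w \<odot> u \<odot> x = w \<odot> (u \<oplus> u \<odot> x)"
          using x uw by (simp add: distl mul_assoc)
        then show ?thesis using uw ideal_mul[OF I(1)] by (simp add: K_def)
      qed
    qed
    moreover have IK: "I \<subseteq> K"
    proof
      fix z assume z: "z \<in> I"
      then show "z \<in> K" using ideal_sub[OF I(1)] ideal_add[OF I(1) z ideal_mul2[OF I(1) z x(1)]]
        by (simp add: K_def)
    qed
    moreover have "a \<notin> K" using n by (simp add: K_def)
    ultimately have "K = I" using I(2) by (intro mx) auto
    moreover have "x \<in> K" using x ideal_zero[OF I(1)] by (simp add: K_def)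
    ultimately show False using x by simp
  qed
  have "I \<in> stone_points M"
    unfolding stone_points_def
  proof (intro CollectI conjI I(1) ballI impI)
    show "I \<noteq> R" using I(3) a(1) by blast
    fix x y assume xy: "x \<in> R" "y \<in> R" "x \<odot> y \<in> I"
    show "x \<in> I \<or> y \<in> I"
    proof (rule ccontr)
      assume "\<not> ?thesis"
      then have 1: "a \<oplus> a \<odot> x \<in> I" "a \<oplus> a \<odot> y \<in> I" using key xy by auto
      \<comment> \<open>Multiplying \<open>a + ay\<close> by \<open>x\<close> leaves
        \<open>ax\<close> modulo \<open>I\<close>, because \<open>xy\<close> lies in
        \<open>I\<close>. So \<open>ax\<close> is in \<open>I\<close>, and with
        \<open>a + ax\<close> also \<open>a\<close>.\<close>
      have 2: "x \<odot> (a \<oplus> a \<odot> y) = a \<odot> (x \<odot> y) \<oplus> a \<odot> x"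
      proof -
        have xa: "x \<odot> a = a \<odot> x" by (rule mul_comm) fact+
        have "x \<odot> (a \<odot> y) = x \<odot> a \<odot> y" by (rule mul_assoc[symmetric]) fact+
        also have "\<dots> = a \<odot> (x \<odot> y)" unfolding xa by (rule mul_assoc) fact+
        finally have xay: "x \<odot> (a \<odot> y) = a \<odot> (x \<odot> y)" .
        have "x \<odot> (a \<oplus> a \<odot> y) = a \<odot> x \<oplus> a \<odot> (x \<odot> y)"
          unfolding xa[symmetric] xay[symmetric] by (rule distl) (use xy a in simp_all)
        also have "\<dots> = a \<odot> (x \<odot> y) \<oplus> a \<odot> x" by (rule add_comm) (use xy a in simp_all)
        finally show ?thesis .
      qed
      have "a \<odot> (x \<odot> y) \<oplus> a \<odot> x \<in> I"
        using ideal_mul[OF I(1) 1(2) xy(1)] unfolding 2 .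
      then have ax: "a \<odot> x \<in> I"
        by (rule ideal_cancel[OF I(1) ideal_mul[OF I(1) xy(3) a(1)], rotated]) (use xy a in simp_all)
      have "a \<odot> x \<oplus> a = a \<oplus> a \<odot> x" by (rule add_comm) (use xy a in simp_all)
      then have "a \<odot> x \<oplus> a \<in> I" using 1(1) by (rule ssubst)
      then have "a \<in> I" by (rule ideal_cancel[OF I(1) ax a(1)])
      then show False using I(3) by simp
    qed
  qed
  then show ?thesis using I by blast
qed

abbreviation S where "S \<equiv> stone_points M"
definition D where "D a = {I \<in> S. a \<notin> I}"

lemma S_ideal: "I \<in> S \<Longrightarrow> ring_ideal M I"
  by (simp add: stone_points_def)

lemma S_prime: "I \<in> S \<Longrightarrow> x \<in> R \<Longrightarrow> y \<in> R \<Longrightarrow> x \<odot> y \<in> I \<longleftrightarrow> x \<in> I \<or> y \<in> I"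
  using ideal_mul ideal_mul2 by (auto simp: stone_points_def)

lemma D_zero [simp]: "D \<zero> = {}"
  by (auto simp: D_def ideal_zero S_ideal)

lemma D_mul [simp]: "x \<in> R \<Longrightarrow> y \<in> R \<Longrightarrow> D (x \<odot> y) = D x \<inter> D y"
  by (auto simp: D_def S_prime)

text \<open>A prime ideal leaves only two residue classes, since \<open>(x + y)xy = 0\<close>:
  outside the ideal any two elements have their sum inside.\<close>

lemma S_add: assumes "I \<in> S" "x \<in> R" "y \<in> R" shows "x \<oplus> y \<in> I \<longleftrightarrow> (x \<in> I \<longleftrightarrow> y \<in> I)"
proof -
  have "x \<oplus> y \<in> I" if "x \<notin> I" "y \<notin> I"
  proof -
    have "(x \<oplus> y) \<odot> (x \<odot> y) = x \<odot> (x \<odot> y) \<oplus> y \<odot> (x \<odot> y)"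
      using assms distr[of x y "x \<odot> y"] by simp
    also have "y \<odot> (x \<odot> y) = x \<odot> y" using assms by (metis idem mul_assoc mul_comm)
    also have "x \<odot> (x \<odot> y) = x \<odot> y" using assms by (metis idem mul_assoc)
    finally have "(x \<oplus> y) \<odot> (x \<odot> y) \<in> I" using assms ideal_zero[OF S_ideal] by simp
    then show ?thesis using S_prime assms that by simp
  qed
  moreover have "y \<in> I" if "x \<in> I" "x \<oplus> y \<in> I" using ideal_cancel[OF S_ideal] assms that by blast
  moreover have "x \<in> I" if "y \<in> I" "x \<oplus> y \<in> I"
    using ideal_cancel[OF S_ideal[OF assms(1)] that(1) assms(2)] add_comm assms that by simp
  ultimately show ?thesis using ideal_add[OF S_ideal] assms by blast
qed

lemma D_add [simp]: "x \<in> R \<Longrightarrow> y \<in> R \<Longrightarrow> D (x \<oplus> y) = (D x - D y) \<union> (D y - D x)"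
  by (auto simp: D_def S_add)

text \<open>Ideals and closed sets determine each other. An element outside \<open>J\<close> is
  separated from \<open>J\<close> by a prime ideal, which is a common point of the two sets.\<close>

lemma D_closed_set:
  assumes J: "ring_ideal M J" and a: "a \<in> R"
  shows "D a \<inter> closed_set_of_ideal M J = {} \<longleftrightarrow> a \<in> J"
  using prime_exists[OF J a] unfolding D_def closed_set_of_ideal_def by blast

lemma D_inj: "inj_on D R"
proof
  fix x y assume xy: "x \<in> R" "y \<in> R" "D x = D y"
  have "ring_ideal M {\<zero>}" by (auto simp: ideal_iff)
  moreover have "D (x \<oplus> y) = {}" using xy by simp
  ultimately have "x \<oplus> y = \<zero>" using D_closed_set[of "{\<zero>}" "x \<oplus> y"] xy by simp
  then show "x = y" using add_cancel[of x x y] xy by simp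
qed

lemma D_Diff: "x \<in> R \<Longrightarrow> y \<in> R \<Longrightarrow> D x - D y = D (x \<oplus> x \<odot> y)"
  by auto

lemma D_Un: "x \<in> R \<Longrightarrow> y \<in> R \<Longrightarrow> D x \<union> D y = D (x \<oplus> (y \<oplus> x \<odot> y))"
  by auto

lemma stone_boolean_space: "boolean_space S (D ` R)"
proof
  show "b \<subseteq> S" if "b \<in> D ` R" for b using that by (auto simp: D_def)
  show "{} \<in> D ` R" using D_zero zero_cl by (metis imageI)
  show "a \<union> b \<in> D ` R" "a - b \<in> D ` R" if ab: "a \<in> D ` R" "b \<in> D ` R" for a b
  proof -
    obtain x y where xy: "x \<in> R" "y \<in> R" "a = D x" "b = D y" using ab by auto
    show "a \<union> b \<in> D ` R" unfolding xy D_Un[OF xy(1,2)] by (rule imageI) (use xy in simp)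
    show "a - b \<in> D ` R" unfolding xy D_Diff[OF xy(1,2)] by (rule imageI) (use xy in simp)
  qed
  have proper: "\<exists>a\<in>R. a \<notin> I" if "I \<in> S" for I
    using that S_ideal[OF that] by (auto simp: stone_points_def ideal_iff)
  show "\<exists>b\<in>D ` R. I \<in> b" if I: "I \<in> S" for I
    using proper[OF I] I by (auto simp: D_def)
  show "\<exists>b\<in>D ` R. I \<in> b \<and> K \<notin> b" if IK: "I \<in> S" "K \<in> S" "I \<noteq> K" for I K
  proof -
    \<comment> \<open>Distinct prime ideals are incomparable. If \<open>K\<close> were inside
      \<open>I\<close>, take \<open>x\<close> in \<open>I\<close> but not in \<open>K\<close> and
      \<open>a\<close> outside \<open>I\<close>: the product of \<open>x\<close> with
      \<open>a + xa\<close> is 0, which forces \<open>a + xa\<close> into \<open>K\<close> and hence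
      into \<open>I\<close>.\<close>
    have "\<exists>a. a \<in> K \<and> a \<notin> I"
    proof (rule ccontr)
      assume "\<not> ?thesis"
      then have KI: "K \<subseteq> I" by blast
      then obtain x where x: "x \<in> I" "x \<notin> K" using IK(3) by blast
      obtain a where a: "a \<in> R" "a \<notin> I" using proper[OF IK(1)] by auto
      have xR: "x \<in> R" by (rule ideal_sub[OF S_ideal[OF IK(1)] x(1)])
      have "x \<odot> (a \<oplus> x \<odot> a) = \<zero>" using xR a by (simp add: distl mul_assoc[symmetric])
      then have "x \<odot> (a \<oplus> x \<odot> a) \<in> K" using ideal_zero[OF S_ideal[OF IK(2)]] by simp
      then have "a \<oplus> x \<odot> a \<in> K" using S_prime[OF IK(2)] xR a x by simp
      then have "a \<oplus> x \<odot> a \<in> I" using KI by blast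
      moreover have "x \<odot> a \<in> I" using ideal_mul2[OF S_ideal[OF IK(1)] x(1) a(1)] .
      ultimately show False using S_add[OF IK(1)] a xR by simp
    qed
    then obtain a where "a \<in> K" "a \<notin> I" by blast
    moreover have "a \<in> R" by (rule ideal_sub[OF S_ideal[OF IK(2)] \<open>a \<in> K\<close>])
    ultimately show ?thesis using IK by (auto simp: D_def)
  qed
  fix \<I> b assume I: "\<I> \<subseteq> D ` R" "{} \<in> \<I>" "\<And>a b. a \<in> \<I> \<Longrightarrow> b \<in> \<I> \<Longrightarrow> a \<union> b \<in> \<I>"
    "\<And>a b. a \<in> \<I> \<Longrightarrow> b \<in> D ` R \<Longrightarrow> b \<subseteq> a \<Longrightarrow> b \<in> \<I>"
    and b: "b \<in> D ` R" "b \<subseteq> \<Union>\<I>"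
  \<comment> \<open>The ideal of sets is pulled back to an ideal of the ring. A prime ideal above it
    that misses \<open>a\<close> would be a point of \<open>D a\<close> left uncovered.\<close>
  define J where "J = {a \<in> R. D a \<in> \<I>}"
  have J: "ring_ideal M J" unfolding ideal_iff
  proof (intro conjI ballI)
    show "J \<subseteq> R" "\<zero> \<in> J" using I(2) by (auto simp: J_def)
    show "x \<oplus> y \<in> J" if xy: "x \<in> J" "y \<in> J" for x y
    proof -
      have "D x \<union> D y \<in> \<I>" using xy I(3) by (simp add: J_def)
      moreover have "D (x \<oplus> y) \<in> D ` R" by (rule imageI) (use xy in \<open>simp add: J_def\<close>)
      moreover have "D (x \<oplus> y) \<subseteq> D x \<union> D y" using xy by (auto simp: J_def)
      ultimately have "D (x \<oplus> y) \<in> \<I>" by (rule I(4))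
      then show ?thesis using xy by (simp add: J_def)
    qed
    show "x \<odot> y \<in> J" if xy: "y \<in> J" "x \<in> R" for x y
    proof -
      have y: "y \<in> R" "D y \<in> \<I>" using xy by (simp_all add: J_def)
      have "D (x \<odot> y) \<in> \<I>"
        by (rule I(4)[OF y(2)], rule imageI) (use xy y in \<open>simp, auto\<close>)
      then show ?thesis using xy y by (simp add: J_def)
    qed
  qed
  obtain a where a: "a \<in> R" "b = D a" using b(1) by blast
  have "a \<in> J"
  proof (rule ccontr)
    assume "a \<notin> J"
    then obtain P where P: "P \<in> S" "J \<subseteq> P" "a \<notin> P" using prime_exists[OF J a(1)] by blast
    then have "P \<in> b" using a by (simp add: D_def)
    then obtain c where "c \<in> R" "D c \<in> \<I>" "P \<in> D c" using b(2) I(1) by blast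
    then show False using P(2) by (auto simp: J_def D_def)
  qed
  then show "b \<in> \<I>" using a by (simp add: J_def)
qed

lemma openin_stone: "openin (stone_space M) U \<longleftrightarrow> U \<subseteq> S \<and> (\<forall>x\<in>U. \<exists>a\<in>R. x \<in> D a \<and> D a \<subseteq> U)"
proof
  interpret boolean_space S "D ` R" by (rule stone_boolean_space)
  have sp: "stone_space M = topology_generated_by (D ` R)"
    unfolding stone_space_def D_def by simp
  assume "openin (stone_space M) U"
  then have "generate_topology_on (D ` R) U" unfolding sp openin_topology_generated_by_iff .
  then show "U \<subseteq> S \<and> (\<forall>x\<in>U. \<exists>a\<in>R. x \<in> D a \<and> D a \<subseteq> U)"
  proof induction
    case (Int a b)
    show ?case
    proof (intro conjI ballI)
      show "a \<inter> b \<subseteq> S" using Int by blast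
      fix x assume "x \<in> a \<inter> b"
      then obtain u v where uv: "u \<in> R" "x \<in> D u" "D u \<subseteq> a" "v \<in> R" "x \<in> D v" "D v \<subseteq> b"
        using Int.IH by (metis IntE)
      then show "\<exists>c\<in>R. x \<in> D c \<and> D c \<subseteq> a \<inter> b"
        by (intro bexI[of _ "u \<odot> v"]) auto
    qed
  next
    case (UN K)
    then show ?case by (meson Sup_least UnionE Union_upper subset_trans)
  next
    case (Basis s)
    then show ?case by (auto simp: D_def)
  qed simp
next
  have sp: "stone_space M = topology_generated_by (D ` R)"
    unfolding stone_space_def D_def by simp
  assume U: "U \<subseteq> S \<and> (\<forall>x\<in>U. \<exists>a\<in>R. x \<in> D a \<and> D a \<subseteq> U)"
  then have eq: "U = \<Union>{D a |a. a \<in> R \<and> D a \<subseteq> U}" by blast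
  have "openin (stone_space M) (\<Union>{D a |a. a \<in> R \<and> D a \<subseteq> U})"
    unfolding sp by (rule openin_Union) (auto intro: topology_generated_by_Basis)
  then show "openin (stone_space M) U" by (subst eq)
qed

lemma topspace_stone: "topspace (stone_space M) = S"
proof -
  interpret boolean_space S "D ` R" by (rule stone_boolean_space)
  have "openin (stone_space M) S" unfolding openin_stone using B_cover B_sub by blast
  moreover have "topspace (stone_space M) \<subseteq> S"
    using openin_topspace[of "stone_space M"] unfolding openin_stone by blast
  ultimately show ?thesis using openin_subset by blast
qed

lemma derived_set_stone: "stone_space M derived_set_of A = sderived S (D ` R) A"
proof (intro equalityI subsetI)
  fix x assume x: "x \<in> stone_space M derived_set_of A"
  have op: "openin (stone_space M) (D a)" if "a \<in> R" for a
    unfolding openin_stone using that by (auto simp: D_def)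
  show "x \<in> sderived S (D ` R) A"
    unfolding sderived_def mem_Collect_eq
  proof (intro conjI ballI impI)
    show "x \<in> S" using x by (simp add: derived_set_of_def topspace_stone)
    fix b assume b: "b \<in> D ` R" "x \<in> b"
    then have "openin (stone_space M) b" using op by auto
    then have "\<exists>y. y \<noteq> x \<and> y \<in> A \<and> y \<in> b" using x b(2) unfolding derived_set_of_def by simp
    then show "\<exists>y\<in>A \<inter> b. y \<noteq> x" by (elim exE) (rule bexI, auto)
  qed
next
  fix x assume x: "x \<in> sderived S (D ` R) A"
  show "x \<in> stone_space M derived_set_of A"
    unfolding derived_set_of_def topspace_stone mem_Collect_eq
  proof (intro conjI allI impI)
    show "x \<in> S" using x by (simp add: sderived_def)
    fix U assume "x \<in> U \<and> openin (stone_space M) U"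
    then obtain a where a: "a \<in> R" "x \<in> D a" "D a \<subseteq> U" unfolding openin_stone by blast
    have "\<exists>y\<in>A \<inter> D a. y \<noteq> x"
      by (rule boolean_space.sderivedD[OF stone_boolean_space x]) (use a in simp_all)
    then obtain y where "y \<in> A \<inter> D a" "y \<noteq> x" by (elim bexE)
    then show "\<exists>y. y \<noteq> x \<and> y \<in> A \<and> y \<in> U" using a(3) by blast
  qed
qed

text \<open>The basic sets with a finite subcover form an ideal covering \<open>D a\<close>, so the
  ideal form of compactness gives the usual one.\<close>

lemma compactin_D: assumes a: "a \<in> R" shows "compactin (stone_space M) (D a)"
  unfolding compactin_def topspace_stone
proof (intro conjI allI impI)
  interpret boolean_space S "D ` R" by (rule stone_boolean_space)
  show "D a \<subseteq> S" by (auto simp: D_def)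
  fix \<U> assume U: "Ball \<U> (openin (stone_space M)) \<and> D a \<subseteq> \<Union>\<U>"
  define fc where "fc c \<longleftrightarrow> (\<exists>\<F>. finite \<F> \<and> \<F> \<subseteq> \<U> \<and> c \<subseteq> \<Union>\<F>)" for c
  have fcI: "fc c" if "finite F" "F \<subseteq> \<U>" "c \<subseteq> \<Union>F" for F c
    unfolding fc_def by (rule exI[of _ F]) (simp add: that)
  have "D a \<in> {c \<in> D ` R. fc c}"
  proof (rule B_compact)
    show "{} \<in> {c \<in> D ` R. fc c}" using B_empty fcI[of "{}" "{}"] by simp
    show "c \<union> d \<in> {c \<in> D ` R. fc c}" if cd: "c \<in> {c \<in> D ` R. fc c}" "d \<in> {c \<in> D ` R. fc c}" for c d
    proof -
      obtain F where F: "finite F" "F \<subseteq> \<U>" "c \<subseteq> \<Union>F" using cd(1) by (auto simp: fc_def)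
      obtain G where G: "finite G" "G \<subseteq> \<U>" "d \<subseteq> \<Union>G" using cd(2) by (auto simp: fc_def)
      have "fc (c \<union> d)" by (rule fcI[of "F \<union> G"]) (use F G in auto)
      then show ?thesis using cd B_Un by simp
    qed
    show "d \<in> {c \<in> D ` R. fc c}" if c: "c \<in> {c \<in> D ` R. fc c}" and d: "d \<in> D ` R" "d \<subseteq> c" for c d
    proof -
      obtain F where F: "finite F" "F \<subseteq> \<U>" "c \<subseteq> \<Union>F" using c by (auto simp: fc_def)
      have "fc d" by (rule fcI[OF F(1,2)]) (use F d in auto)
      then show ?thesis using d by simp
    qed
    show "D a \<in> D ` R" using a by (rule imageI)
    show "D a \<subseteq> \<Union>{c \<in> D ` R. fc c}"
    proof
      fix x assume "x \<in> D a"
      then obtain V where V: "V \<in> \<U>" "x \<in> V" using U by auto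
      then have "openin (stone_space M) V" using U by simp
      then obtain b where b: "b \<in> R" "x \<in> D b" "D b \<subseteq> V" using V(2) unfolding openin_stone by auto
      have "fc (D b)" by (rule fcI[of "{V}"]) (use V b in auto)
      then show "x \<in> \<Union>{c \<in> D ` R. fc c}" using b by auto
    qed
  qed auto
  then show "\<exists>\<F>. finite \<F> \<and> \<F> \<subseteq> \<U> \<and> D a \<subseteq> \<Union>\<F>" by (simp add: fc_def)
qed

lemma closedin_D: assumes "a \<in> R" shows "closedin (stone_space M) (D a)"
  unfolding closedin_def topspace_stone openin_stone
proof (intro conjI ballI)
  interpret boolean_space S "D ` R" by (rule stone_boolean_space)
  show "D a \<subseteq> S" by (auto simp: D_def)
  fix x assume x: "x \<in> S - D a"
  then obtain b where b: "b \<in> R" "x \<in> D b" using B_cover[of x] by auto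
  have "D (b \<oplus> b \<odot> a) = D b - D a" by (rule D_Diff[symmetric]) fact+
  moreover have "D b \<subseteq> S" by (auto simp: D_def)
  ultimately show "\<exists>c\<in>R. x \<in> D c \<and> D c \<subseteq> S - D a"
    by (intro bexI[of _ "b \<oplus> b \<odot> a"]) (use b x assms in \<open>auto simp del: D_add D_mul\<close>)
qed simp

lemma compact_closure_stone:
  assumes "A \<subseteq> S"
  shows "compactin (stone_space M) (stone_space M closure_of A) \<longleftrightarrow> (\<exists>b\<in>D ` R. A \<subseteq> b)"
proof
  interpret boolean_space S "D ` R" by (rule stone_boolean_space)
  let ?C = "stone_space M closure_of A"
  assume c: "compactin (stone_space M) ?C"
  have "\<forall>U\<in>D ` R. openin (stone_space M) U"
    unfolding openin_stone by (auto simp: D_def)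
  moreover have "?C \<subseteq> \<Union>(D ` R)"
    using closure_of_subset_topspace[of "stone_space M" A] B_cover unfolding topspace_stone by blast
  ultimately obtain F where F: "finite F" "F \<subseteq> D ` R" "?C \<subseteq> \<Union>F"
    using c unfolding compactin_def by meson
  from F(1,2) have "\<Union>F \<in> D ` R"
  proof (induction F rule: finite_induct)
    case empty
    then show ?case using B_empty by simp
  qed (simp add: B_Un)
  moreover have "A \<subseteq> ?C" using assms closure_of_subset topspace_stone by metis
  ultimately show "\<exists>b\<in>D ` R. A \<subseteq> b" using F(3) by blast
next
  assume "\<exists>b\<in>D ` R. A \<subseteq> b"
  then obtain a where a: "a \<in> R" "A \<subseteq> D a" by blast
  then have "stone_space M closure_of A \<subseteq> D a" using closedin_D closure_of_minimal by blast
  then show "compactin (stone_space M) (stone_space M closure_of A)"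
    using closed_compactin[OF compactin_D[OF a(1)]] closedin_closure_of by blast
qed

lemma realises_iff:
  "realises M T X \<longleftrightarrow> sreal S (D ` R) T X \<and>
    map (closed_set_of_ideal M) (sys_preds M) = map (\<lambda>Q. \<Union>p\<in>Q. X p) (po_Qs T)"
proof (cases "(\<Union>p\<in>po_points T. X p) = S")
  case True
  have eq: "{p \<in> po_points T. compactin (stone_space M) (stone_space M closure_of (X p))} =
      {p \<in> po_points T. \<exists>b\<in>D ` R. X p \<subseteq> b}"
  proof (intro Collect_cong conj_cong refl)
    fix p assume "p \<in> po_points T"
    then have "X p \<subseteq> S" using True by auto
    then show "compactin (stone_space M) (stone_space M closure_of (X p)) \<longleftrightarrow> (\<exists>b\<in>D ` R. X p \<subseteq> b)"
      by (rule compact_closure_stone)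
  qed
  show ?thesis unfolding realises_def sreal_def derived_set_stone eq by (simp only: conj_assoc)
next
  case False
  then show ?thesis unfolding realises_def sreal_def by (simp only: simp_thms)
qed

end

section \<open>Spaces partitioned according to a tuple\<close>

locale real_space = boolean_space Z B for Z :: "'z set" and B +
  fixes n :: nat and T :: "'p potuple" and X :: "'p \<Rightarrow> 'z set"
  assumes T: "T \<in> po_tuples n" and sr: "sreal Z B T X"
begin

abbreviation P where "P \<equiv> po_points T"
abbreviation r where "r \<equiv> po_less T"

lemma fin_P: "finite P"
  using T by (simp add: po_tuples_def finite_crowded_def)

lemma po: "po_system P r"
  using T by (simp add: po_tuples_def extended_po_system_def)

lemma r_P: "(q, p) \<in> r \<Longrightarrow> q \<in> P \<and> p \<in> P"
  using po by (auto simp: po_system_def)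

lemma r_trans: "(a, b) \<in> r \<Longrightarrow> (b, c) \<in> r \<Longrightarrow> (a, c) \<in> r"
  using po unfolding po_system_def trans_def by metis

lemma Q_lower: "i < n \<Longrightarrow> lower_subset P r (po_Qs T ! i)"
  using T by (simp add: po_tuples_def)

lemma len_Q: "length (po_Qs T) = n"
  using T by (simp add: po_tuples_def)

lemma X_ne: "p \<in> P \<Longrightarrow> X p \<noteq> {}"
  and X_disj: "disjoint_family_on X P"
  and X_cov: "(\<Union>p\<in>P. X p) = Z"
  and X_der: "p \<in> P \<Longrightarrow> sderived Z B (X p) = (\<Union>q\<in>{q \<in> P. (q, p) \<in> r}. X q)"
  and L_eq: "po_L T = {p \<in> P. \<exists>b\<in>B. X p \<subseteq> b}"
  and f_card: "p \<in> L_min_d T \<Longrightarrow> finite (X p) \<and> card (X p) = po_f T p"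
  using sr by (simp_all add: sreal_def)

lemma X_sub: "p \<in> P \<Longrightarrow> X p \<subseteq> Z"
  using X_cov by auto

lemma X_inj: "p \<in> P \<Longrightarrow> q \<in> P \<Longrightarrow> x \<in> X p \<Longrightarrow> x \<in> X q \<Longrightarrow> p = q"
  using X_disj unfolding disjoint_family_on_def by auto

text \<open>Finite-crowdedness places every irreflexive point in \<open>L_min_d\<close>, where
  \<open>po_f\<close> prescribes the number of points.\<close>

lemma discrete_X:
  assumes "p \<in> P" "(p, p) \<notin> r"
  shows "finite (X p)" "card (X p) = po_f T p" "p \<in> po_L T"
proof -
  have "p \<in> L_min_d T"
    using T assms by (auto simp: po_tuples_def finite_crowded_def L_min_d_def discrete_part_def)
  then show "finite (X p)" "card (X p) = po_f T p" "p \<in> po_L T"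
    using f_card by (auto simp: L_min_d_def L_min_def minimal_elements_def)
qed

lemma lower_sclosed:
  assumes "\<Lambda> \<subseteq> P" "\<And>p q. p \<in> \<Lambda> \<Longrightarrow> (q, p) \<in> r \<Longrightarrow> q \<in> \<Lambda>"
  shows "sclosed Z B (\<Union>p\<in>\<Lambda>. X p)"
proof (rule sclosed_of_sderived)
  show "(\<Union>p\<in>\<Lambda>. X p) \<subseteq> Z" using X_sub assms(1) by auto
  have "finite (X ` \<Lambda>)" using fin_P assms(1) finite_subset by auto
  then have "sderived Z B (\<Union>(X ` \<Lambda>)) = (\<Union>p\<in>\<Lambda>. sderived Z B (X p))"
    by (simp add: sderived_UN)
  also have "\<dots> = (\<Union>p\<in>\<Lambda>. \<Union>q\<in>{q \<in> P. (q, p) \<in> r}. X q)"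
    using X_der assms(1) by (intro SUP_cong refl) auto
  also have "\<dots> \<subseteq> (\<Union>p\<in>\<Lambda>. X p)" using assms(2) by auto
  finally show "sderived Z B (\<Union>p\<in>\<Lambda>. X p) \<subseteq> (\<Union>p\<in>\<Lambda>. X p)" .
qed

lemma above_infinite:
  assumes "(q, p) \<in> r" "x \<in> X q" "b \<in> B" "x \<in> b"
  shows "infinite (X p \<inter> b)"
proof (rule sderived_infinite[OF assms(3,4)])
  show "x \<in> sderived Z B (X p)" using X_der r_P[OF assms(1)] assms(1,2) by auto
  show "X p \<subseteq> Z" using X_sub r_P[OF assms(1)] by auto
qed

end


section \<open>Transport of partitions along bijections of the points\<close>

lemma sderived_image:
  assumes bij: "bij_betw \<phi> Z S" and A: "A \<subseteq> Z" and B: "\<And>b. b \<in> B \<Longrightarrow> b \<subseteq> Z"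
  shows "sderived S ((\<lambda>b. \<phi> ` b) ` B) (\<phi> ` A) = \<phi> ` sderived Z B A"
proof -
  have inj: "\<phi> x \<in> \<phi> ` C \<longleftrightarrow> x \<in> C" if "x \<in> Z" "C \<subseteq> Z" for x C
    using bij that unfolding bij_betw_def by (auto dest: inj_onD)
  have S: "S = \<phi> ` Z" using bij by (simp add: bij_betw_def)
  have *: "\<phi> x \<in> sderived S ((\<lambda>b. \<phi> ` b) ` B) (\<phi> ` A) \<longleftrightarrow> x \<in> sderived Z B A" if x: "x \<in> Z" for x
  proof -
    have e: "(\<exists>y\<in>\<phi> ` A \<inter> \<phi> ` b. y \<noteq> \<phi> x) \<longleftrightarrow> (\<exists>y\<in>A \<inter> b. y \<noteq> x)" if b: "b \<in> B" for b
    proof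
      assume "\<exists>y\<in>\<phi> ` A \<inter> \<phi> ` b. y \<noteq> \<phi> x"
      then obtain y where y: "y \<in> \<phi> ` A" "y \<in> \<phi> ` b" "y \<noteq> \<phi> x" by auto
      then obtain z where z: "z \<in> A" "y = \<phi> z" by auto
      then have "z \<in> b" using inj[of z b] y(2) A B[OF b] by auto
      then show "\<exists>y\<in>A \<inter> b. y \<noteq> x" using z y(3) by auto
    next
      assume "\<exists>y\<in>A \<inter> b. y \<noteq> x"
      then obtain y where y: "y \<in> A" "y \<in> b" "y \<noteq> x" by auto
      then have "\<phi> y \<noteq> \<phi> x" using bij x A unfolding bij_betw_def by (auto dest: inj_onD)
      then show "\<exists>y\<in>\<phi> ` A \<inter> \<phi> ` b. y \<noteq> \<phi> x" using y by auto
    qed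
    have "\<phi> x \<in> sderived S ((\<lambda>b. \<phi> ` b) ` B) (\<phi> ` A) \<longleftrightarrow>
        (\<forall>b\<in>B. \<phi> x \<in> \<phi> ` b \<longrightarrow> (\<exists>y\<in>\<phi> ` A \<inter> \<phi> ` b. y \<noteq> \<phi> x))"
      using x S unfolding sderived_def by simp
    also have "\<dots> \<longleftrightarrow> (\<forall>b\<in>B. x \<in> b \<longrightarrow> (\<exists>y\<in>A \<inter> b. y \<noteq> x))"
      by (intro ball_cong refl) (simp only: e inj[OF x B])
    also have "\<dots> \<longleftrightarrow> x \<in> sderived Z B A" using x unfolding sderived_def by simp
    finally show ?thesis .
  qed
  show ?thesis
  proof (intro equalityI subsetI)
    fix y assume y: "y \<in> sderived S ((\<lambda>b. \<phi> ` b) ` B) (\<phi> ` A)"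
    then have "y \<in> S" by (simp add: sderived_def)
    then obtain x where "x \<in> Z" "y = \<phi> x" using S by auto
    then show "y \<in> \<phi> ` sderived Z B A" using *[of x] y by auto
  next
    fix y assume "y \<in> \<phi> ` sderived Z B A"
    then obtain x where x: "x \<in> sderived Z B A" "y = \<phi> x" by auto
    then have "x \<in> Z" by (simp add: sderived_def)
    then show "y \<in> sderived S ((\<lambda>b. \<phi> ` b) ` B) (\<phi> ` A)" using * x by simp
  qed
qed

lemma sreal_image:
  assumes bij: "bij_betw \<phi> Z S" and B: "\<And>b. b \<in> B \<Longrightarrow> b \<subseteq> Z" and sr: "sreal Z B T X"
  shows "sreal S ((\<lambda>b. \<phi> ` b) ` B) T (\<lambda>p. \<phi> ` X p)"
proof -
  have inj: "inj_on \<phi> Z" and S: "S = \<phi> ` Z" using bij by (simp_all add: bij_betw_def)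
  have X: "X p \<subseteq> Z" if "p \<in> po_points T" for p using sr that unfolding sreal_def by auto
  have "\<phi> ` X p \<inter> \<phi> ` X q = {}" if "p \<in> po_points T" "q \<in> po_points T" "p \<noteq> q" for p q
  proof -
    have "X p \<inter> X q = {}" using sr that unfolding sreal_def disjoint_family_on_def by simp
    then show ?thesis using inj_on_image_Int[OF inj X X] that by (metis image_empty)
  qed
  moreover have "\<phi> ` X p \<noteq> {}" if "p \<in> po_points T" for p using sr that by (simp add: sreal_def)
  moreover have "(\<Union>p\<in>po_points T. \<phi> ` X p) = S" using sr S unfolding sreal_def by auto
  moreover have "sderived S ((\<lambda>b. \<phi> ` b) ` B) (\<phi> ` X p) = (\<Union>q\<in>{q \<in> po_points T. (q, p) \<in> po_less T}. \<phi> ` X q)"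
    if "p \<in> po_points T" for p
  proof -
    have "sderived S ((\<lambda>b. \<phi> ` b) ` B) (\<phi> ` X p) = \<phi> ` sderived Z B (X p)"
      by (rule sderived_image[OF bij X[OF that] B])
    also have "sderived Z B (X p) = (\<Union>q\<in>{q \<in> po_points T. (q, p) \<in> po_less T}. X q)"
      using sr that unfolding sreal_def by simp
    finally show ?thesis by (simp add: image_UN)
  qed
  moreover have "po_L T = {p \<in> po_points T. \<exists>b\<in>(\<lambda>b. \<phi> ` b) ` B. \<phi> ` X p \<subseteq> b}"
  proof -
    have "po_L T = {p \<in> po_points T. \<exists>b\<in>B. X p \<subseteq> b}" using sr by (simp add: sreal_def)
    also have "\<dots> = {p \<in> po_points T. \<exists>b\<in>(\<lambda>b. \<phi> ` b) ` B. \<phi> ` X p \<subseteq> b}"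
    proof (intro Collect_cong conj_cong refl)
      fix p assume p: "p \<in> po_points T"
      have "\<phi> ` X p \<subseteq> \<phi> ` b \<longleftrightarrow> X p \<subseteq> b" if "b \<in> B" for b
        using inj_on_image_subset_iff[OF inj X[OF p] B[OF that]] .
      then show "(\<exists>b\<in>B. X p \<subseteq> b) \<longleftrightarrow> (\<exists>b\<in>(\<lambda>b. \<phi> ` b) ` B. \<phi> ` X p \<subseteq> b)" by simp
    qed
    finally show ?thesis .
  qed
  moreover have "finite (\<phi> ` X p) \<and> card (\<phi> ` X p) = po_f T p" if p: "p \<in> L_min_d T" for p
  proof -
    have "p \<in> po_points T" using p by (simp add: L_min_d_def discrete_part_def)
    then have "card (\<phi> ` X p) = card (X p)" using inj_on_subset[OF inj X] by (intro card_image)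
    then show ?thesis using sr p by (simp add: sreal_def)
  qed
  ultimately show ?thesis unfolding sreal_def disjoint_family_on_def by simp
qed

lemma realises_represented_on:
  assumes "T \<in> po_tuples n" "is_structure n M" "boolean_ring M"
    and id: "\<forall>J\<in>set (sys_preds M). ring_ideal M J" and re: "realises M T X"
  shows "represented_on n M T (stone_points M) (\<lambda>a. {I \<in> stone_points M. a \<notin> I}) X"
proof -
  interpret bring M using assms(3) by unfold_locales
  have D: "(\<lambda>a. {I \<in> stone_points M. a \<notin> I}) = D" by (simp add: D_def fun_eq_iff)
  have sr: "sreal S (D ` R) T X" and mp: "map (closed_set_of_ideal M) (sys_preds M) = map (\<lambda>Q. \<Union>p\<in>Q. X p) (po_Qs T)"
    using re unfolding realises_iff by simp_all
  have "sys_preds M ! i = {a \<in> R. D a \<inter> (\<Union>p\<in>po_Qs T ! i. X p) = {}}" if i: "i < n" for i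
  proof -
    have len: "length (sys_preds M) = n" "length (po_Qs T) = n"
      using assms by (simp_all add: is_structure_def po_tuples_def)
    have J: "ring_ideal M (sys_preds M ! i)" using id i len by simp
    have "map (closed_set_of_ideal M) (sys_preds M) ! i = map (\<lambda>Q. \<Union>p\<in>Q. X p) (po_Qs T) ! i"
      using mp by simp
    then have "closed_set_of_ideal M (sys_preds M ! i) = (\<Union>p\<in>po_Qs T ! i. X p)"
      using i len by simp
    then show ?thesis using D_closed_set[OF J] ideal_sub[OF J] by auto
  qed
  then show ?thesis unfolding represented_on_def D
    using assms(1,2) stone_boolean_space D_inj D_zero D_add D_mul sr by simp
qed

section \<open>Systems represented on an arbitrary space\<close>

locale rep_system =
  fixes n :: nat and M :: "'a bsystem" and T :: "'p potuple" and Z :: "'z set" and d X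
  assumes rep: "represented_on n M T Z d X"
begin

abbreviation R where "R \<equiv> sys_carrier M"

lemma bs: "boolean_space Z (d ` R)" and st: "is_structure n M" and inj: "inj_on d R"
  and TT: "T \<in> po_tuples n" and srl: "sreal Z (d ` R) T X" and d_zero: "d (sys_zero M) = {}"
  using rep by (simp_all add: represented_on_def)

lemma d_add: "a \<in> R \<Longrightarrow> b \<in> R \<Longrightarrow> d (sys_add M a b) = (d a - d b) \<union> (d b - d a)"
  and d_mul: "a \<in> R \<Longrightarrow> b \<in> R \<Longrightarrow> d (sys_mult M a b) = d a \<inter> d b"
  and preds: "i < n \<Longrightarrow> sys_preds M ! i = {a \<in> R. d a \<inter> (\<Union>p\<in>po_Qs T ! i. X p) = {}}"
  using rep by (simp_all add: represented_on_def)

lemma zero_cl: "sys_zero M \<in> R"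
  and add_cl: "a \<in> R \<Longrightarrow> b \<in> R \<Longrightarrow> sys_add M a b \<in> R"
  and mul_cl: "a \<in> R \<Longrightarrow> b \<in> R \<Longrightarrow> sys_mult M a b \<in> R"
  and len: "length (sys_preds M) = n"
  using st by (simp_all add: is_structure_def)

end

sublocale rep_system \<subseteq> real_space Z "d ` R" n T X
  using bs TT srl by (intro real_space.intro real_space_axioms.intro)

context rep_system
begin

lemma d_eqI: "a \<in> R \<Longrightarrow> b \<in> R \<Longrightarrow> d a = d b \<Longrightarrow> a = b"
  using inj by (auto dest: inj_onD)

text \<open>The injection \<open>d\<close> turns sums into symmetric differences and products into
  intersections, so the ring laws are inherited from a ring of sets.\<close>

lemma rep_boolean_ring: "boolean_ring M"
  unfolding boolean_ring_def
proof (intro conjI ballI)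
  show "comm_group (additive_group M)"
  proof (rule comm_groupI; unfold additive_group_def; simp)
    show "\<And>x y. x \<in> R \<Longrightarrow> y \<in> R \<Longrightarrow> sys_add M x y \<in> R" by (rule add_cl)
    show "sys_zero M \<in> R" by (rule zero_cl)
    show "sys_add M (sys_add M x y) z = sys_add M x (sys_add M y z)"
      if "x \<in> R" "y \<in> R" "z \<in> R" for x y z
      by (rule d_eqI) (use that in \<open>auto simp: d_add add_cl\<close>)
    show "sys_add M x y = sys_add M y x" if "x \<in> R" "y \<in> R" for x y
      by (rule d_eqI) (use that in \<open>auto simp: d_add add_cl\<close>)
    show "sys_add M (sys_zero M) x = x" if "x \<in> R" for x
      by (rule d_eqI) (use that in \<open>auto simp: d_add add_cl zero_cl d_zero\<close>)
    show "\<exists>y\<in>R. sys_add M y x = sys_zero M" if "x \<in> R" for x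
    proof (rule bexI[OF _ that], rule d_eqI)
      show "d (sys_add M x x) = d (sys_zero M)" using that by (simp add: d_add d_zero)
    qed (use that add_cl zero_cl in auto)
  qed
next
  fix x y z assume xyz: "x \<in> R" "y \<in> R" "z \<in> R"
  show "sys_mult M (sys_mult M x y) z = sys_mult M x (sys_mult M y z)"
    by (rule d_eqI) (use xyz in \<open>auto simp: d_mul mul_cl\<close>)
  show "sys_mult M x (sys_add M y z) = sys_add M (sys_mult M x y) (sys_mult M x z)"
    by (rule d_eqI) (use xyz in \<open>auto simp: d_mul mul_cl d_add add_cl\<close>)
  show "sys_mult M (sys_add M x y) z = sys_add M (sys_mult M x z) (sys_mult M y z)"
    by (rule d_eqI) (use xyz in \<open>auto simp: d_mul mul_cl d_add add_cl\<close>)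
next
  show "sys_mult M x x = x" if "x \<in> R" for x
    by (rule d_eqI) (use that in \<open>auto simp: d_mul mul_cl\<close>)
qed (rule mul_cl)

lemma Q_sub: "i < n \<Longrightarrow> po_Qs T ! i \<subseteq> po_points T"
  using Q_lower by (simp add: lower_subset_def)

lemma Q_sclosed: "i < n \<Longrightarrow> sclosed Z (d ` R) (\<Union>p\<in>po_Qs T ! i. X p)"
  by (rule lower_sclosed[OF Q_sub]) (use Q_lower r_P in \<open>auto simp: lower_subset_def\<close>)

lemma rep_ideals: "\<forall>J\<in>set (sys_preds M). ring_ideal M J"
proof
  interpret b: bring M using rep_boolean_ring by unfold_locales
  fix J assume "J \<in> set (sys_preds M)"
  then obtain i where i: "i < n" "J = sys_preds M ! i" using len by (auto simp: in_set_conv_nth)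
  show "ring_ideal M J" unfolding b.ideal_iff i(2) preds[OF i(1)]
    by (auto simp: zero_cl add_cl mul_cl d_zero d_add d_mul)
qed

text \<open>Any representing space is the Stone space up to homeomorphism: a point \<open>z\<close>
  corresponds to the prime ideal of the elements whose set misses \<open>z\<close>.\<close>

lemma rep_represents: "represents T M"
proof -
  interpret b: bring M using rep_boolean_ring by unfold_locales
  define \<phi> where "\<phi> z = {a \<in> R. z \<notin> d a}" for z
  have dsub: "a \<in> R \<Longrightarrow> d a \<subseteq> Z" for a using B_sub by auto
  have \<phi>S: "\<phi> z \<in> stone_points M" if z: "z \<in> Z" for z
    unfolding stone_points_def
  proof (intro CollectI conjI ballI impI)
    show "ring_ideal M (\<phi> z)" unfolding b.ideal_iff \<phi>_def
      by (auto simp: zero_cl add_cl mul_cl d_zero d_add d_mul)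
    obtain a where "a \<in> R" "z \<in> d a" using B_cover[OF z] by auto
    then show "\<phi> z \<noteq> R" by (auto simp: \<phi>_def)
    fix x y assume "x \<in> R" "y \<in> R" "sys_mult M x y \<in> \<phi> z"
    then show "x \<in> \<phi> z \<or> y \<in> \<phi> z" by (auto simp: \<phi>_def d_mul)
  qed
  have bij: "bij_betw \<phi> Z (stone_points M)"
  proof (rule bij_betwI')
    fix x y assume xy: "x \<in> Z" "y \<in> Z"
    show "\<phi> x = \<phi> y \<longleftrightarrow> x = y"
    proof
      assume eq: "\<phi> x = \<phi> y"
      show "x = y"
      proof (rule ccontr)
        assume "x \<noteq> y"
        then obtain a where "a \<in> R" "x \<in> d a" "y \<notin> d a" using B_sep[OF xy] by auto
        then have "a \<in> \<phi> y" "a \<notin> \<phi> x" by (auto simp: \<phi>_def)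
        then show False using eq by simp
      qed
    qed simp
  next
    show "\<phi> x \<in> stone_points M" if "x \<in> Z" for x using \<phi>S that .
  next
    fix I assume I: "I \<in> stone_points M"
    have idl: "ring_ideal M I" using b.S_ideal[OF I] .
    have "\<exists>a\<in>R. a \<notin> I" using I idl by (auto simp: stone_points_def b.ideal_iff)
    then obtain a where a: "a \<in> R" "a \<notin> I" by auto
    \<comment> \<open>If the sets of the elements of \<open>I\<close> covered \<open>d a\<close>,
      compactness would put \<open>a\<close> itself into \<open>I\<close>. An uncovered point is the
      candidate preimage of \<open>I\<close>.\<close>
    have "\<exists>z\<in>d a. \<forall>c\<in>I. z \<notin> d c"
    proof (rule ccontr)
      assume neg: "\<not> ?thesis"
      have "d a \<in> d ` I"
      proof (rule B_compact)
        show "d ` I \<subseteq> d ` R" using b.ideal_sub[OF idl] by auto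
        show "{} \<in> d ` I" using b.ideal_zero[OF idl] d_zero by (metis imageI)
        show "u \<union> v \<in> d ` I" if uv: "u \<in> d ` I" "v \<in> d ` I" for u v
        proof -
          obtain s t where s: "s \<in> I" "u = d s" and t: "t \<in> I" "v = d t" using uv by auto
          have sR: "s \<in> R" "t \<in> R" using s t b.ideal_sub[OF idl] by auto
          have mI: "sys_mult M s t \<in> I" using b.ideal_mul[OF idl t(1) sR(1)] .
          have "sys_add M s (sys_add M t (sys_mult M s t)) \<in> I"
            by (rule b.ideal_add[OF idl s(1) b.ideal_add[OF idl t(1) mI]])
          moreover have "d (sys_add M s (sys_add M t (sys_mult M s t))) = u \<union> v"
            using sR s t by (auto simp: d_add d_mul add_cl mul_cl)
          ultimately show ?thesis by (metis imageI)
        qed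
        show "v \<in> d ` I" if u: "u \<in> d ` I" and v: "v \<in> d ` R" "v \<subseteq> u" for u v
        proof -
          obtain s t where s: "s \<in> I" "u = d s" and t: "t \<in> R" "v = d t" using u v by auto
          have sR: "s \<in> R" using s b.ideal_sub[OF idl] by auto
          have "d (sys_mult M t s) = v" using s t v sR by (auto simp: d_mul)
          moreover have "sys_mult M t s \<in> I" by (rule b.ideal_mul[OF idl s(1) t(1)])
          ultimately show ?thesis by (metis imageI)
        qed
        show "d a \<in> d ` R" using a by simp
        show "d a \<subseteq> \<Union>(d ` I)" using neg by auto
      qed
      then obtain c where "c \<in> I" "d a = d c" by auto
      then have "a = c" using d_eqI a b.ideal_sub[OF idl] by simp
      then show False using \<open>c \<in> I\<close> a by simp
    qed
    then obtain z where z: "z \<in> d a" "\<forall>c\<in>I. z \<notin> d c" by auto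
    have zZ: "z \<in> Z" using z(1) dsub a by auto
    \<comment> \<open>For \<open>c\<close> outside \<open>I\<close> the product of \<open>c\<close>
      with \<open>a + ca\<close> is 0, so primeness puts \<open>a + ca\<close> into
      \<open>I\<close>. The set of that element contains \<open>z\<close>, which was chosen to avoid
      all sets from \<open>I\<close>.\<close>
    have "\<phi> z \<subseteq> I"
    proof
      fix c assume c: "c \<in> \<phi> z"
      then have cR: "c \<in> R" "z \<notin> d c" by (auto simp: \<phi>_def)
      show "c \<in> I"
      proof (rule ccontr)
        assume cI: "c \<notin> I"
        let ?e = "sys_add M a (sys_mult M c a)"
        have e: "?e \<in> R" using a cR by (simp add: add_cl mul_cl)
        have "d (sys_mult M c ?e) = {}" using a cR by (auto simp: d_add d_mul add_cl mul_cl)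
        then have "sys_mult M c ?e = sys_zero M" using d_eqI e cR by (simp add: mul_cl zero_cl d_zero)
        then have "sys_mult M c ?e \<in> I" using b.ideal_zero[OF idl] by simp
        then have "?e \<in> I" using b.S_prime[OF I cR(1) e] cI by simp
        then have "z \<notin> d ?e" using z(2) by simp
        then show False using z(1) cR a by (auto simp: d_add d_mul mul_cl)
      qed
    qed
    moreover have "I \<subseteq> \<phi> z" using z(2) b.ideal_sub[OF idl] by (auto simp: \<phi>_def)
    ultimately have "I = \<phi> z" by simp
    then show "\<exists>z\<in>Z. I = \<phi> z" using zZ by auto
  qed
  have D: "b.D a = \<phi> ` d a" if a: "a \<in> R" for a
  proof (intro equalityI subsetI)
    fix I assume I: "I \<in> b.D a"
    then have "I \<in> \<phi> ` Z" using bij by (auto simp: b.D_def bij_betw_def)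
    then obtain z where z: "z \<in> Z" "I = \<phi> z" by auto
    then have "z \<in> d a" using I a by (auto simp: b.D_def \<phi>_def)
    then show "I \<in> \<phi> ` d a" using z by simp
  next
    fix I assume "I \<in> \<phi> ` d a"
    then obtain z where z: "z \<in> d a" "I = \<phi> z" by auto
    then show "I \<in> b.D a" using \<phi>S dsub[OF a] a by (auto simp: b.D_def \<phi>_def)
  qed
  have DR: "b.D ` R = (\<lambda>b. \<phi> ` b) ` d ` R" unfolding image_image using D by (intro image_cong refl)
  have "sreal (stone_points M) (b.D ` R) T (\<lambda>p. \<phi> ` X p)"
    unfolding DR by (rule sreal_image[OF bij B_sub sr])
  moreover have "map (closed_set_of_ideal M) (sys_preds M) = map (\<lambda>Q. \<Union>p\<in>Q. \<phi> ` X p) (po_Qs T)"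
  proof (rule nth_equalityI)
    show "length (map (closed_set_of_ideal M) (sys_preds M)) = length (map (\<lambda>Q. \<Union>p\<in>Q. \<phi> ` X p) (po_Qs T))"
      using len len_Q by simp
    fix i assume "i < length (map (closed_set_of_ideal M) (sys_preds M))"
    then have i: "i < n" using len by simp
    let ?W = "\<Union>p\<in>po_Qs T ! i. X p"
    have W: "?W \<subseteq> Z" using Q_sclosed[OF i] by (simp add: sclosed_def)
    have key: "sys_preds M ! i \<subseteq> \<phi> z \<longleftrightarrow> z \<in> ?W" if z: "z \<in> Z" for z
    proof
      assume s: "sys_preds M ! i \<subseteq> \<phi> z"
      show "z \<in> ?W"
      proof (rule ccontr)
        assume "z \<notin> ?W"
        then have "\<exists>b\<in>d ` R. z \<in> b \<and> b \<inter> ?W = {}"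
          using Q_sclosed[OF i] z unfolding sclosed_def by simp
        then obtain a where a: "a \<in> R" "z \<in> d a" "d a \<inter> ?W = {}" by auto
        then have "a \<in> sys_preds M ! i" unfolding preds[OF i] by simp
        then have "a \<in> \<phi> z" using s by auto
        then show False using a(2) by (simp add: \<phi>_def)
      qed
    next
      assume "z \<in> ?W"
      then show "sys_preds M ! i \<subseteq> \<phi> z" unfolding preds[OF i] \<phi>_def by auto
    qed
    have "closed_set_of_ideal M (sys_preds M ! i) = \<phi> ` ?W"
    proof (intro equalityI subsetI)
      fix I assume I: "I \<in> closed_set_of_ideal M (sys_preds M ! i)"
      then have "I \<in> \<phi> ` Z" using bij by (auto simp: closed_set_of_ideal_def bij_betw_def)
      then obtain z where z: "z \<in> Z" "I = \<phi> z" by auto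
      then show "I \<in> \<phi> ` ?W" using I key[OF z(1)] by (auto simp: closed_set_of_ideal_def)
    next
      fix I assume "I \<in> \<phi> ` ?W"
      then obtain z where z: "z \<in> ?W" "I = \<phi> z" by auto
      then have "z \<in> Z" using W by auto
      then show "I \<in> closed_set_of_ideal M (sys_preds M ! i)"
        unfolding closed_set_of_ideal_def using z key \<phi>S by simp
    qed
    then show "map (closed_set_of_ideal M) (sys_preds M) ! i = map (\<lambda>Q. \<Union>p\<in>Q. \<phi> ` X p) (po_Qs T) ! i"
      using i len len_Q by (simp add: image_UN)
  qed
  ultimately have "realises M T (\<lambda>p. \<phi> ` X p)" unfolding b.realises_iff by simp
  then show ?thesis unfolding represents_def by (rule exI[where x = "\<lambda>p. \<phi> ` X p"])
qed

end

section \<open>The back-and-forth system of two spaces with the same tuple\<close>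

text \<open>The hypothesis on \<open>U\<close> recurs below: the cells of a finite partition by ring
  elements are compact open or have a compact open complement.\<close>

lemma (in boolean_space) clopen_nbhd:
  assumes "U \<in> B \<or> (U \<subseteq> Z \<and> Z - U \<in> B)" "x \<in> U"
  shows "\<exists>b\<in>B. x \<in> b \<and> b \<subseteq> U"
proof (cases "U \<in> B")
  case True
  then show ?thesis using assms(2) by auto
next
  case False
  then have U: "U \<subseteq> Z" "Z - U \<in> B" using assms(1) by auto
  then obtain b where b: "b \<in> B" "x \<in> b" using B_cover[of x] assms(2) by auto
  then have "b - (Z - U) \<in> B" using B_Diff U by simp
  moreover have "b - (Z - U) \<subseteq> U" using B_sub[OF b(1)] by auto
  ultimately show ?thesis using b assms(2) by (intro bexI[of _ "b - (Z - U)"]) auto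
qed

lemma (in boolean_space) clopen_sclosed:
  assumes "U \<in> B \<or> (U \<subseteq> Z \<and> Z - U \<in> B)"
  shows "sclosed Z B U"
  unfolding sclosed_def
proof (intro conjI ballI)
  show U: "U \<subseteq> Z" using assms B_sub by auto
  fix x assume x: "x \<in> Z - U"
  show "\<exists>b\<in>B. x \<in> b \<and> b \<inter> U = {}"
  proof (cases "U \<in> B")
    case True
    obtain b where b: "b \<in> B" "x \<in> b" using B_cover[of x] x by auto
    have "b - U \<in> B" using B_Diff b(1) True by simp
    then show ?thesis using b x by (intro bexI[of _ "b - U"]) auto
  next
    case False
    then show ?thesis using assms x by (intro bexI[of _ "Z - U"]) auto
  qed
qed

lemma (in boolean_space) sclosed_Int:
  assumes "sclosed Z B A" "sclosed Z B C" shows "sclosed Z B (A \<inter> C)"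
  using assms unfolding sclosed_def
proof (elim conjE, intro conjI ballI)
  assume h: "\<forall>x\<in>Z - A. \<exists>b\<in>B. x \<in> b \<and> b \<inter> A = {}" "\<forall>x\<in>Z - C. \<exists>b\<in>B. x \<in> b \<and> b \<inter> C = {}"
  fix x assume "x \<in> Z - A \<inter> C"
  then have "x \<in> Z - A \<or> x \<in> Z - C" by auto
  then show "\<exists>b\<in>B. x \<in> b \<and> b \<inter> (A \<inter> C) = {}"
  proof
    assume "x \<in> Z - A"
    then obtain b where "b \<in> B" "x \<in> b" "b \<inter> A = {}" using h(1) by auto
    then show ?thesis by (intro bexI[of _ b]) auto
  next
    assume "x \<in> Z - C"
    then obtain b where "b \<in> B" "x \<in> b" "b \<inter> C = {}" using h(2) by auto
    then show ?thesis by (intro bexI[of _ b]) auto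
  qed
qed auto

lemma (in boolean_space) finite_sclosed: "finite F \<Longrightarrow> F \<subseteq> Z \<Longrightarrow> sclosed Z B F"
  using sclosed_of_sderived sderived_finite by simp

lemma (in boolean_space) B_bound:
  assumes "finite \<Lambda>" "\<And>q. q \<in> \<Lambda> \<Longrightarrow> \<exists>b\<in>B. A q \<subseteq> b"
  shows "\<exists>b\<in>B. (\<Union>q\<in>\<Lambda>. A q) \<subseteq> b"
  using assms
proof (induction \<Lambda> rule: finite_induct)
  case empty
  then show ?case using B_empty by auto
next
  case (insert q \<Lambda>)
  obtain b where b: "b \<in> B" "(\<Union>q\<in>\<Lambda>. A q) \<subseteq> b" using insert.IH insert.prems by auto
  obtain c where c: "c \<in> B" "A q \<subseteq> c" using insert.prems by auto
  show ?case by (rule bexI[of _ "b \<union> c"]) (use b c B_Un in auto)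
qed

lemma (in boolean_space) B_UN: "finite F \<Longrightarrow> F \<subseteq> B \<Longrightarrow> \<Union>F \<in> B"
  by (induction F rule: finite_induct) (simp_all add: B_empty B_Un)

locale real_pair = A: real_space Z B n T X + C: real_space Y D n T W
  for Z :: "'z set" and B and n and T :: "'p potuple" and X and Y :: "'y set" and D and W
begin

text \<open>The invariant kept by the back-and-forth. For \<open>p < p\<close>, an open set that
  meets \<open>X p\<close> does so in infinitely many points, so only meeting or missing is
  recorded. Compact cells are paired with compact ones and cocompact cells with cocompact
  ones.\<close>

definition sim :: "'z set \<Rightarrow> 'y set \<Rightarrow> bool" where
  "sim U V \<longleftrightarrow> ((U \<in> B \<and> V \<in> D) \<or> (U \<subseteq> Z \<and> Z - U \<in> B \<and> V \<subseteq> Y \<and> Y - V \<in> D)) \<and>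
     (\<forall>p\<in>A.P. (U \<inter> X p = {} \<longleftrightarrow> V \<inter> W p = {}) \<and>
       ((p, p) \<notin> A.r \<longrightarrow> card (U \<inter> X p) = card (V \<inter> W p)))"

lemma sim_UNIV: "sim Z Y"
proof -
  have "Z \<inter> X p = X p" "Y \<inter> W p = W p" if "p \<in> A.P" for p
    using A.X_sub[OF that] C.X_sub[OF that] by auto
  then show ?thesis
    using A.X_ne C.X_ne A.discrete_X C.discrete_X A.B_empty C.B_empty by (simp add: sim_def)
qed

text \<open>\<open>F\<close> and \<open>G\<close> are witnesses to be placed into the two halves of
  \<open>V\<close>. A finite part is divided exactly, by counting; where \<open>p < p\<close>, the
  infinitely many points of \<open>W p\<close> in \<open>V\<close> supply two distinct ones.\<close>

lemma split_points:
  assumes s: "sim U V" and S: "S \<subseteq> U" and p: "p \<in> A.P"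
  shows "\<exists>F G. finite F \<and> finite G \<and> F \<subseteq> V \<inter> W p \<and> G \<subseteq> V \<inter> W p \<and> F \<inter> G = {} \<and>
    (F = {} \<longleftrightarrow> S \<inter> X p = {}) \<and> (G = {} \<longleftrightarrow> (U - S) \<inter> X p = {}) \<and>
    ((p, p) \<notin> A.r \<longrightarrow> card F = card (S \<inter> X p) \<and> card G = card ((U - S) \<inter> X p) \<and> F \<union> G = V \<inter> W p)"
proof (cases "(p, p) \<in> A.r")
  case False
  have finX: "finite (X p)" and finW: "finite (W p)" using A.discrete_X C.discrete_X p False by auto
  have eq: "U \<inter> X p = (S \<inter> X p) \<union> ((U - S) \<inter> X p)" using S by auto
  have "card (V \<inter> W p) = card (U \<inter> X p)" using s p False unfolding sim_def by simp
  also have "\<dots> = card (S \<inter> X p) + card ((U - S) \<inter> X p)"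
    unfolding eq using finX by (intro card_Un_disjoint) auto
  finally have c: "card (V \<inter> W p) = card (S \<inter> X p) + card ((U - S) \<inter> X p)" .
  then obtain F where F: "F \<subseteq> V \<inter> W p" "card F = card (S \<inter> X p)" "finite F"
    using obtain_subset_with_card_n[of "card (S \<inter> X p)" "V \<inter> W p"] by (metis le_add1)
  define G where "G = V \<inter> W p - F"
  have finG: "finite G" using finW by (simp add: G_def)
  have cG: "card G = card ((U - S) \<inter> X p)" unfolding G_def using F c by (simp add: card_Diff_subset)
  have eF: "F = {} \<longleftrightarrow> S \<inter> X p = {}" using F(2,3) finX by (metis card_0_eq finite_Int)
  have eG: "G = {} \<longleftrightarrow> (U - S) \<inter> X p = {}"
    using cG finG finX by (metis card_0_eq finite_Int)
  have FG: "F \<inter> G = {}" "F \<union> G = V \<inter> W p" "G \<subseteq> V \<inter> W p" using F(1) by (auto simp: G_def)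
  show ?thesis
    by (rule exI[of _ F], rule exI[of _ G]) (simp only: F finG cG eF eG FG simp_thms)
next
  case True
  show ?thesis
  proof (cases "U \<inter> X p = {}")
    case True
    then show ?thesis using S \<open>(p, p) \<in> A.r\<close> by (intro exI[of _ "{}"]) auto
  next
    case False
    then obtain x where x: "x \<in> V" "x \<in> W p" using s p unfolding sim_def by auto
    have "\<exists>b\<in>D. x \<in> b \<and> b \<subseteq> V" by (rule C.clopen_nbhd) (use s x in \<open>auto simp: sim_def\<close>)
    then obtain b where b: "b \<in> D" "x \<in> b" "b \<subseteq> V" by auto
    have "infinite (W p \<inter> b)" by (rule C.above_infinite[OF True x(2) b(1,2)])
    then have "infinite (W p \<inter> b - {x})" by simp
    then have "W p \<inter> b - {x} \<noteq> {}" by (rule infinite_imp_nonempty)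
    then obtain y where y: "y \<in> W p" "y \<in> b" "y \<noteq> x" by auto
    define F where "F = (if S \<inter> X p = {} then {} else {x})"
    define G where "G = (if (U - S) \<inter> X p = {} then {} else {y})"
    show ?thesis
      by (rule exI[of _ F], rule exI[of _ G]) (use x y b True in \<open>auto simp: F_def G_def\<close>)
  qed
qed

text \<open>The half \<open>S'\<close> has to contain the witnesses \<open>F\<close> and every part
  that \<open>U - S\<close> misses, and to avoid the witnesses \<open>G\<close> and every part that
  \<open>S\<close> misses. The missed labels form lower sets, so the parts are closed, and the first
  requirement is a compact set inside the open room left by the second.\<close>

lemma sim_split:
  assumes s: "sim U V" and S: "S \<in> B" "S \<subseteq> U"
  shows "\<exists>S'\<in>D. S' \<subseteq> V \<and> sim S S' \<and> sim (U - S) (V - S')"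
proof -
  have cU: "U \<in> B \<or> (U \<subseteq> Z \<and> Z - U \<in> B)" and cV: "V \<in> D \<or> (V \<subseteq> Y \<and> Y - V \<in> D)"
    using s by (auto simp: sim_def)
  have VY: "V \<subseteq> Y" using cV C.B_sub by auto
  have cUS: "U - S \<in> B \<or> (U - S \<subseteq> Z \<and> Z - (U - S) \<in> B)"
  proof (cases "U \<in> B")
    case True
    then show ?thesis using A.B_Diff S by simp
  next
    case False
    then have "U \<subseteq> Z" "Z - U \<in> B" using cU by auto
    moreover have "Z - (U - S) = (Z - U) \<union> S" using A.B_sub[OF S(1)] by auto
    ultimately show ?thesis using A.B_Un S(1) by auto
  qed
  define q where "q p FG \<longleftrightarrow> finite (fst FG) \<and> finite (snd FG) \<and> fst FG \<subseteq> V \<inter> W p \<and> snd FG \<subseteq> V \<inter> W p \<and> fst FG \<inter> snd FG = {} \<and>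
    (fst FG = {} \<longleftrightarrow> S \<inter> X p = {}) \<and> (snd FG = {} \<longleftrightarrow> (U - S) \<inter> X p = {}) \<and>
    ((p, p) \<notin> A.r \<longrightarrow> card (fst FG) = card (S \<inter> X p) \<and> card (snd FG) = card ((U - S) \<inter> X p) \<and> fst FG \<union> snd FG = V \<inter> W p)"
    for p FG
  have "\<exists>FG. q p FG" if p: "p \<in> A.P" for p
  proof -
    obtain F G where "q p (F, G)" using split_points[OF s S(2) p] unfolding q_def fst_conv snd_conv by (elim exE)
    then show ?thesis by (rule exI)
  qed
  then have "\<forall>p\<in>A.P. \<exists>FG. q p FG" by simp
  from bchoice[OF this] obtain FG where FG: "\<forall>p\<in>A.P. q p (FG p)" by (elim exE)
  define F where "F p = fst (FG p)" for p
  define G where "G p = snd (FG p)" for p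
  have F1: "finite (F p)" "finite (G p)" "F p \<subseteq> V \<inter> W p" "G p \<subseteq> V \<inter> W p" "F p \<inter> G p = {}"
    and F2: "F p = {} \<longleftrightarrow> S \<inter> X p = {}" "G p = {} \<longleftrightarrow> (U - S) \<inter> X p = {}"
    and F3: "(p, p) \<notin> A.r \<Longrightarrow> card (F p) = card (S \<inter> X p) \<and> card (G p) = card ((U - S) \<inter> X p) \<and> F p \<union> G p = V \<inter> W p"
    if "p \<in> A.P" for p
    using FG that unfolding q_def F_def G_def by simp_all
  define FF where "FF = (\<Union>p\<in>A.P. F p)"
  define GG where "GG = (\<Union>p\<in>A.P. G p)"
  have fin: "finite FF" "finite GG" using F1 A.fin_P by (simp_all add: FF_def GG_def)
  have sub: "FF \<subseteq> V" "GG \<subseteq> V" unfolding FF_def GG_def using F1(3,4) by blast+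
  define t1 where "t1 = {p \<in> A.P. S \<inter> X p \<noteq> {}}"
  define t2 where "t2 = {p \<in> A.P. (U - S) \<inter> X p \<noteq> {}}"
  \<comment> \<open>The labels met by a clopen set are closed upwards, because the points of a
    smaller part are limits of the larger one. Hence the missed labels form a lower set.\<close>
  have up: "E \<inter> X p' \<noteq> {}"
    if E: "E \<in> B \<or> (E \<subseteq> Z \<and> Z - E \<in> B)" and p: "(p, p') \<in> A.r" "E \<inter> X p \<noteq> {}" for E p p'
  proof
    assume E': "E \<inter> X p' = {}"
    obtain x where px: "x \<in> E" "x \<in> X p" using p(2) by auto
    obtain b where b: "b \<in> B" "x \<in> b" "b \<subseteq> E" using A.clopen_nbhd[OF E px(1)] by auto
    have "infinite (X p' \<inter> b)" by (rule A.above_infinite[OF p(1) px(2) b(1,2)])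
    moreover have "X p' \<inter> b = {}" using b(3) E' by auto
    ultimately show False by simp
  qed
  have low1: "p \<in> A.P - t1" if p: "p' \<in> A.P - t1" "(p, p') \<in> A.r" for p p'
  proof -
    have "S \<inter> X p = {}"
    proof (rule ccontr)
      assume "S \<inter> X p \<noteq> {}"
      then have "S \<inter> X p' \<noteq> {}" using S(1) by (intro up[OF _ p(2)]) simp_all
      then show False using p(1) by (simp add: t1_def)
    qed
    then show ?thesis using A.r_P[OF p(2)] by (simp add: t1_def)
  qed
  have low2: "p \<in> A.P - t2" if p: "p' \<in> A.P - t2" "(p, p') \<in> A.r" for p p'
  proof -
    have "(U - S) \<inter> X p = {}"
    proof (rule ccontr)
      assume "(U - S) \<inter> X p \<noteq> {}"
      then have "(U - S) \<inter> X p' \<noteq> {}" by (rule up[OF cUS p(2)])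
      then show False using p(1) by (simp add: t2_def)
    qed
    then show ?thesis using A.r_P[OF p(2)] by (simp add: t2_def)
  qed
  \<comment> \<open>The points of \<open>V\<close> that have to go into \<open>S'\<close>, since
    \<open>U - S\<close> misses their parts.\<close>
  define K where "K = V \<inter> (\<Union>p\<in>A.P - t2. W p)"
  have K: "sclosed Y D K" unfolding K_def
    by (rule C.sclosed_Int[OF C.clopen_sclosed[OF cV] C.lower_sclosed[OF Diff_subset low2]])
  \<comment> \<open>The use of \<open>L\<close>. If \<open>U\<close> is cocompact, a part missed by
    \<open>U - S\<close> lies in the compact set \<open>S \<union> (Z - U)\<close>, so its label is
    in \<open>L\<close>, and the corresponding part of the other space is bounded as well.\<close>
  have Kb: "\<exists>b\<in>D. K \<subseteq> b"
  proof (cases "U \<in> B \<and> V \<in> D")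
    case True
    then show ?thesis by (auto simp: K_def)
  next
    case False
    then have UZ: "U \<subseteq> Z" "Z - U \<in> B" using s by (auto simp: sim_def)
    have "\<exists>b\<in>D. W p \<subseteq> b" if p: "p \<in> A.P - t2" for p
    proof -
      have "X p \<subseteq> S \<union> (Z - U)" using p A.X_sub[of p] by (auto simp: t2_def)
      moreover have "S \<union> (Z - U) \<in> B" using A.B_Un S UZ by simp
      ultimately have "p \<in> po_L T" using p A.L_eq by auto
      then show ?thesis using C.L_eq by auto
    qed
    then have "\<exists>b\<in>D. (\<Union>p\<in>A.P - t2. W p) \<subseteq> b" using A.fin_P by (intro C.B_bound) auto
    then show ?thesis by (auto simp: K_def)
  qed
  have FFb: "\<exists>b\<in>D. FF \<subseteq> b"
  proof -
    have "\<exists>b\<in>D. (\<Union>x\<in>FF. {x}) \<subseteq> b"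
      by (rule C.B_bound[OF fin(1)]) (use C.B_cover sub VY in auto)
    then show ?thesis by simp
  qed
  have KF: "sclosed Y D (K \<union> FF)"
  proof -
    have "sclosed Y D (\<Union>{K, FF})"
      by (rule C.sclosed_UN) (use K C.finite_sclosed[OF fin(1)] sub VY in auto)
    then show ?thesis by simp
  qed
  obtain a where a: "a \<in> D" "K \<union> FF \<subseteq> a"
  proof -
    obtain b c where "b \<in> D" "K \<subseteq> b" "c \<in> D" "FF \<subseteq> c" using Kb FFb by auto
    then have "b \<union> c \<in> D" "K \<union> FF \<subseteq> b \<union> c" using C.B_Un by auto
    then show thesis by (rule that)
  qed
  \<comment> \<open>The open region available to \<open>S'\<close>: the parts missed by
    \<open>S\<close> and the witnesses of the other half are removed.\<close>
  define O' where "O' = V - (\<Union>p\<in>A.P - t1. W p) - GG"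
  have t1I: "p \<in> t1" if "x \<in> V" "x \<in> W p" "p \<in> A.P" "p \<notin> t2" for x p
  proof -
    have "U \<inter> X p \<noteq> {}" using s that unfolding sim_def by auto
    then show ?thesis using that by (auto simp: t1_def t2_def)
  qed
  have KFO: "x \<in> O'" if x: "x \<in> K \<union> FF" for x
    using x
  proof
    assume xK: "x \<in> K"
    then obtain p where p: "p \<in> A.P" "p \<notin> t2" "x \<in> W p" "x \<in> V" by (auto simp: K_def)
    have "p \<in> t1" by (rule t1I[OF p(4,3,1,2)])
    then have 1: "x \<notin> (\<Union>p\<in>A.P - t1. W p)" using C.X_inj[OF p(1) _ p(3)] by auto
    have "x \<notin> GG"
    proof
      assume "x \<in> GG"
      then obtain p' where p': "p' \<in> A.P" "x \<in> G p'" by (auto simp: GG_def)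
      then have "p' = p" using C.X_inj[OF p(1) p'(1) p(3)] F1(4)[OF p'(1)] by auto
      then have "G p \<noteq> {}" using p' by auto
      then show False using F2(2)[OF p(1)] p by (auto simp: t2_def)
    qed
    then show "x \<in> O'" using 1 p by (simp add: O'_def)
  next
    assume "x \<in> FF"
    then obtain p where p: "p \<in> A.P" "x \<in> F p" by (auto simp: FF_def)
    then have xp: "x \<in> V" "x \<in> W p" using F1(3)[OF p(1)] by auto
    have "p \<in> t1" using F2(1)[OF p(1)] p by (auto simp: t1_def)
    then have 1: "x \<notin> (\<Union>p\<in>A.P - t1. W p)" using C.X_inj[OF p(1) _ xp(2)] by auto
    have "x \<notin> GG"
    proof
      assume "x \<in> GG"
      then obtain p' where p': "p' \<in> A.P" "x \<in> G p'" by (auto simp: GG_def)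
      then have "p' = p" using C.X_inj[OF p(1) p'(1) xp(2)] F1(4)[OF p'(1)] by auto
      then show False using F1(5)[OF p(1)] p p' by auto
    qed
    then show "x \<in> O'" using 1 xp by (simp add: O'_def)
  qed
  have "\<exists>s\<in>D. K \<union> FF \<subseteq> s \<and> s \<subseteq> O'"
  proof (rule C.B_separate[OF KF a])
    fix x assume "x \<in> K \<union> FF"
    then have x: "x \<in> V" "x \<notin> (\<Union>p\<in>A.P - t1. W p)" "x \<notin> GG" using KFO by (auto simp: O'_def)
    have xY: "x \<in> Y" using x VY by auto
    obtain b where b: "b \<in> D" "x \<in> b" "b \<subseteq> V" using C.clopen_nbhd[OF cV x(1)] by auto
    have "sclosed Y D (\<Union>p\<in>A.P - t1. W p)" by (rule C.lower_sclosed[OF Diff_subset low1])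
    then have "\<exists>c\<in>D. x \<in> c \<and> c \<inter> (\<Union>p\<in>A.P - t1. W p) = {}" using x xY unfolding sclosed_def by simp
    then obtain c where c: "c \<in> D" "x \<in> c" "c \<inter> (\<Union>p\<in>A.P - t1. W p) = {}" by (elim bexE conjE)
    obtain g where g: "g \<in> D" "x \<in> g" "g \<inter> GG = {}"
      using C.B_avoid_finite[OF fin(2) subset_trans[OF sub(2) VY] xY x(3)] by (elim bexE conjE)
    show "\<exists>b\<in>D. x \<in> b \<and> b \<subseteq> O'"
    proof (intro bexI conjI)
      show "b \<inter> c \<inter> g \<in> D" by (intro C.B_Int b c g)
      show "x \<in> b \<inter> c \<inter> g" using b c g by simp
      show "b \<inter> c \<inter> g \<subseteq> O'" unfolding O'_def using b(3) c(3) g(3) by auto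
    qed
  qed
  then obtain s' where s': "s' \<in> D" "K \<union> FF \<subseteq> s'" "s' \<subseteq> O'" by auto
  have s'V: "s' \<subseteq> V" using s'(3) by (auto simp: O'_def)
  have Fs: "F p \<subseteq> s' \<inter> W p" "G p \<subseteq> (V - s') \<inter> W p" if p: "p \<in> A.P" for p
  proof -
    show "F p \<subseteq> s' \<inter> W p" using s'(2) F1(3)[OF p] p by (auto simp: FF_def)
    show "G p \<subseteq> (V - s') \<inter> W p" using s'(3) F1(4)[OF p] p by (auto simp: O'_def GG_def)
  qed
  have e1: "s' \<inter> W p = {} \<longleftrightarrow> S \<inter> X p = {}" if p: "p \<in> A.P" for p
  proof
    assume "s' \<inter> W p = {}"
    then show "S \<inter> X p = {}" using Fs(1)[OF p] F2(1)[OF p] by auto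
  next
    assume "S \<inter> X p = {}"
    then have "p \<in> A.P - t1" using p by (simp add: t1_def)
    then show "s' \<inter> W p = {}" using s'(3) by (auto simp: O'_def)
  qed
  have e2: "(V - s') \<inter> W p = {} \<longleftrightarrow> (U - S) \<inter> X p = {}" if p: "p \<in> A.P" for p
  proof
    assume "(V - s') \<inter> W p = {}"
    then show "(U - S) \<inter> X p = {}" using Fs(2)[OF p] F2(2)[OF p] by auto
  next
    assume "(U - S) \<inter> X p = {}"
    then have "p \<in> A.P - t2" using p by (simp add: t2_def)
    then show "(V - s') \<inter> W p = {}" using s'(2) by (auto simp: K_def)
  qed
  have e3: "card (S \<inter> X p) = card (s' \<inter> W p)" "card ((U - S) \<inter> X p) = card ((V - s') \<inter> W p)"
    if p: "p \<in> A.P" "(p, p) \<notin> A.r" for p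
  proof -
    have "F p \<union> G p = V \<inter> W p" using F3[OF p] by simp
    then have "s' \<inter> W p = F p" "(V - s') \<inter> W p = G p" using Fs[OF p(1)] s'V by auto
    then show "card (S \<inter> X p) = card (s' \<inter> W p)" "card ((U - S) \<inter> X p) = card ((V - s') \<inter> W p)"
      using F3[OF p] by simp_all
  qed
  have "sim S s'" unfolding sim_def using S(1) s'(1) e1 e3(1) by simp
  moreover have "(U - S \<in> B \<and> V - s' \<in> D) \<or> (U - S \<subseteq> Z \<and> Z - (U - S) \<in> B \<and> V - s' \<subseteq> Y \<and> Y - (V - s') \<in> D)"
  proof (cases "U \<in> B \<and> V \<in> D")
    case True
    then show ?thesis using A.B_Diff C.B_Diff S s'(1) by simp
  next
    case False
    then have UZ: "U \<subseteq> Z" "Z - U \<in> B" "V \<subseteq> Y" "Y - V \<in> D" using s by (auto simp: sim_def)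
    have "Z - (U - S) = (Z - U) \<union> S" "Y - (V - s') = (Y - V) \<union> s'"
      using A.B_sub[OF S(1)] C.B_sub[OF s'(1)] by auto
    then show ?thesis using A.B_Un C.B_Un S s'(1) UZ by auto
  qed
  then have "sim (U - S) (V - s')" unfolding sim_def using e2 e3(2) by simp
  ultimately show ?thesis using s'(1) s'V by auto
qed

end

section \<open>Partial matchings of ring elements and the formulas they preserve\<close>

locale rep_pair = M: rep_system n M T Z d X + N: rep_system n N T Y g W
  for n and M :: "'a bsystem" and T :: "'p potuple" and Z :: "'z set" and d X
    and N :: "'b bsystem" and Y :: "'y set" and g W

sublocale rep_pair \<subseteq> real_pair Z "d ` sys_carrier M" n T X Y "g ` sys_carrier N" W
  by unfold_locales

definition piece :: "'z set \<Rightarrow> ('a \<Rightarrow> 'z set) \<Rightarrow> nat \<Rightarrow> (nat \<Rightarrow> 'a) \<Rightarrow> nat set \<Rightarrow> 'z set" where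
  "piece Z d k e E = {x \<in> Z. \<forall>i<k. x \<in> d (e i) \<longleftrightarrow> i \<in> E}"

lemma piece_Suc:
  "piece Z d (Suc k) (e(k := a)) E =
     (if k \<in> E then piece Z d k e (E - {k}) \<inter> d a else piece Z d k e E - d a)"
  by (auto simp: piece_def less_Suc_eq)

text \<open>Only the cell lying outside all the generators can fail to be compact; its complement is
  their union.\<close>

lemma (in boolean_space) piece_clopen:
  assumes "\<And>i. i < k \<Longrightarrow> d (e i) \<in> B"
  shows "(E \<inter> {..<k} \<noteq> {} \<longrightarrow> piece Z d k e E \<in> B) \<and> (E \<inter> {..<k} = {} \<longrightarrow> Z - piece Z d k e E \<in> B)"
  using assms
proof (induction k)
  case 0
  then show ?case using B_empty by (simp add: piece_def)
next
  case (Suc k)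
  have IH: "(E \<inter> {..<k} \<noteq> {} \<longrightarrow> piece Z d k e E \<in> B) \<and> (E \<inter> {..<k} = {} \<longrightarrow> Z - piece Z d k e E \<in> B)"
    using Suc by simp
  have dk: "d (e k) \<in> B" using Suc.prems by simp
  have eq: "piece Z d (Suc k) e E = (if k \<in> E then piece Z d k e E \<inter> d (e k) else piece Z d k e E - d (e k))"
    by (auto simp: piece_def less_Suc_eq)
  have sub: "piece Z d k e E \<subseteq> Z" by (auto simp: piece_def)
  show ?case
  proof (cases "E \<inter> {..<k} = {}")
    case True
    then have c: "Z - piece Z d k e E \<in> B" using IH by simp
    have "piece Z d k e E \<inter> d (e k) = d (e k) - (Z - piece Z d k e E)" using B_sub[OF dk] sub by auto
    then have 1: "piece Z d k e E \<inter> d (e k) \<in> B" using B_Diff[OF dk c] by simp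
    have "Z - (piece Z d k e E - d (e k)) = (Z - piece Z d k e E) \<union> d (e k)" using B_sub[OF dk] by auto
    then have 2: "Z - (piece Z d k e E - d (e k)) \<in> B" using B_Un[OF c dk] by simp
    have "E \<inter> {..<Suc k} = {} \<longleftrightarrow> k \<notin> E" using True by (auto simp: lessThan_Suc)
    then show ?thesis unfolding eq using 1 2 by simp
  next
    case False
    then have c: "piece Z d k e E \<in> B" using IH by simp
    have "E \<inter> {..<Suc k} \<noteq> {}" using False by (auto simp: lessThan_Suc)
    then show ?thesis unfolding eq using B_Int[OF c dk] B_Diff[OF c dk] by simp
  qed
qed

context rep_pair
begin

definition good :: "nat \<Rightarrow> (nat \<Rightarrow> 'a) \<Rightarrow> (nat \<Rightarrow> 'b) \<Rightarrow> bool" where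
  "good k e f \<longleftrightarrow> (\<forall>i<k. e i \<in> M.R \<and> f i \<in> N.R) \<and>
     (\<forall>E\<subseteq>{..<k}. sim (piece Z d k e E) (piece Y g k f E))"

lemma good_0: "good 0 e f"
  using sim_UNIV by (simp add: good_def piece_def)

text \<open>A new element cuts each cell in two, and the cells of the other side are cut
  independently to match. The chosen halves are then joined into one element.\<close>

lemma good_forth:
  assumes G: "good k e f" and a: "a \<in> M.R"
  shows "\<exists>b\<in>N.R. good (Suc k) (e(k := a)) (f(k := b))"
proof -
  let ?U = "piece Z d k e" and ?V = "piece Y g k f"
  have sm: "sim (?U E) (?V E)" if "E \<subseteq> {..<k}" for E using G that by (simp add: good_def)
  have "\<exists>S. S \<in> g ` N.R \<and> S \<subseteq> ?V E \<and> sim (?U E \<inter> d a) S \<and> sim (?U E - d a) (?V E - S)"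
    if E: "E \<subseteq> {..<k}" for E
  proof -
    have c: "?U E \<in> d ` M.R \<or> Z - ?U E \<in> d ` M.R"
      using sm[OF E] by (auto simp: sim_def)
    have "?U E \<inter> d a \<in> d ` M.R"
    proof (cases "?U E \<in> d ` M.R")
      case True
      then show ?thesis using M.B_Int a by simp
    next
      case False
      then have "d a - (Z - ?U E) \<in> d ` M.R" using c M.B_Diff a by simp
      moreover have "d a - (Z - ?U E) = ?U E \<inter> d a"
        using M.B_sub[of "d a"] a by (auto simp: piece_def)
      ultimately show ?thesis by simp
    qed
    from sim_split[OF sm[OF E] this] have "\<exists>S'\<in>g ` N.R. S' \<subseteq> ?V E \<and> sim (?U E \<inter> d a) S' \<and>
        sim (?U E - ?U E \<inter> d a) (?V E - S')" by simp
    moreover have "?U E - ?U E \<inter> d a = ?U E - d a" by auto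
    ultimately show ?thesis by (auto simp only: bex_simps Bex_def)
  qed
  then have "\<forall>E\<in>Pow {..<k}. \<exists>S. S \<in> g ` N.R \<and> S \<subseteq> ?V E \<and> sim (?U E \<inter> d a) S \<and> sim (?U E - d a) (?V E - S)"
    by simp
  from bchoice[OF this] obtain S where S: "\<forall>E\<in>Pow {..<k}. S E \<in> g ` N.R \<and> S E \<subseteq> ?V E \<and>
      sim (?U E \<inter> d a) (S E) \<and> sim (?U E - d a) (?V E - S E)" by (elim exE)
  \<comment> \<open>There are finitely many cells, so the union is again the set of a ring element.
    The cells are disjoint, so it cuts each of them in the chosen half.\<close>
  have "\<Union>(S ` Pow {..<k}) \<in> g ` N.R" by (rule N.B_UN) (use S in auto)
  then obtain b where b: "b \<in> N.R" "g b = (\<Union>E\<in>Pow {..<k}. S E)" by auto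
  have disj: "E = E'" if "x \<in> ?V E" "x \<in> ?V E'" "E \<subseteq> {..<k}" "E' \<subseteq> {..<k}" for x E E'
    using that unfolding piece_def by auto
  have Vb: "?V E \<inter> g b = S E" if E: "E \<subseteq> {..<k}" for E
  proof
    show "?V E \<inter> g b \<subseteq> S E"
    proof
      fix x assume x: "x \<in> ?V E \<inter> g b"
      then obtain E' where E': "E' \<subseteq> {..<k}" "x \<in> S E'" using b(2) by auto
      then have "x \<in> ?V E'" using S by auto
      then have "E = E'" using disj[OF _ _ E E'(1)] x by auto
      then show "x \<in> S E" using E' by simp
    qed
    show "S E \<subseteq> ?V E \<inter> g b" using S E b(2) by auto
  qed
  have "sim (piece Z d (Suc k) (e(k := a)) E) (piece Y g (Suc k) (f(k := b)) E)"
    if E: "E \<subseteq> {..<Suc k}" for E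
  proof (cases "k \<in> E")
    case True
    have E': "E - {k} \<subseteq> {..<k}" using E by (auto simp: lessThan_Suc)
    then have "sim (?U (E - {k}) \<inter> d a) (S (E - {k}))" using S by simp
    then show ?thesis unfolding piece_Suc using True Vb[OF E'] by simp
  next
    case False
    then have E': "E \<subseteq> {..<k}" using E by (auto simp: lessThan_Suc)
    then have "sim (?U E - d a) (?V E - S E)" using S by simp
    moreover have "?V E - g b = ?V E - S E" using Vb[OF E'] by auto
    ultimately show ?thesis unfolding piece_Suc using False by simp
  qed
  then have "good (Suc k) (e(k := a)) (f(k := b))"
    using G a b(1) unfolding good_def by (simp add: less_Suc_eq)
  then show ?thesis using b(1) by (rule bexI)
qed

end

context rep_pair
begin

lemma good_back:
  assumes G: "good k e f" and b: "b \<in> N.R"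
  shows "\<exists>a\<in>M.R. good (Suc k) (e(k := a)) (f(k := b))"
proof -
  \<comment> \<open>The invariant is symmetric in the two spaces, so the backward step is the
    forward step with the roles exchanged.\<close>
  interpret S: rep_pair n N T Y g W M Z d X by unfold_locales
  have sm: "S.sim V U \<longleftrightarrow> sim U V" for U V
    unfolding S.sim_def sim_def by auto
  have gd: "S.good k f e \<longleftrightarrow> good k e f" for k e f
    unfolding S.good_def good_def sm by auto
  show ?thesis using S.good_forth[of k f e b] G b unfolding gd by simp
qed

text \<open>Says that \<open>a\<close> and \<open>b\<close> are built from the same cells: on each
  pair of corresponding cells, both elements contain everything or nothing.\<close>

definition corr :: "nat \<Rightarrow> (nat \<Rightarrow> 'a) \<Rightarrow> (nat \<Rightarrow> 'b) \<Rightarrow> 'a \<Rightarrow> 'b \<Rightarrow> bool" where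
  "corr k e f a b \<longleftrightarrow> a \<in> M.R \<and> b \<in> N.R \<and>
     (\<forall>E\<subseteq>{..<k}. \<forall>x\<in>piece Z d k e E. \<forall>y\<in>piece Y g k f E. x \<in> d a \<longleftrightarrow> y \<in> g b)"

lemma corr_term:
  assumes G: "good k e f" and v: "\<forall>v\<in>term_vars t. \<exists>i<k. u v = e i \<and> w v = f i"
  shows "corr k e f (term_val M u t) (term_val N w t)"
  using v
proof (induction t)
  case (Var v)
  then obtain i where i: "i < k" "u v = e i" "w v = f i" by auto
  then show ?case using G by (auto simp: corr_def good_def piece_def)
next
  case Zero
  then show ?case by (simp add: corr_def M.zero_cl N.zero_cl M.d_zero N.d_zero)
next
  case (Add s t)
  then have s: "corr k e f (term_val M u s) (term_val N w s)" and t: "corr k e f (term_val M u t) (term_val N w t)"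
    by simp_all
  show ?case using s t unfolding corr_def
    by (simp add: M.add_cl N.add_cl M.d_add N.d_add)
next
  case (Mult s t)
  then have s: "corr k e f (term_val M u s) (term_val N w s)" and t: "corr k e f (term_val M u t) (term_val N w t)"
    by simp_all
  show ?case using s t unfolding corr_def
    by (simp add: M.mul_cl N.mul_cl M.d_mul N.d_mul)
qed

lemma corr_meets:
  assumes G: "good k e f" and c: "corr k e f a b" and p: "p \<in> M.P"
  shows "d a \<inter> X p = {} \<longleftrightarrow> g b \<inter> W p = {}"
proof
  assume da: "d a \<inter> X p = {}"
  show "g b \<inter> W p = {}"
  proof (rule ccontr)
    assume "g b \<inter> W p \<noteq> {}"
    then obtain y where y: "y \<in> g b" "y \<in> W p" by auto
    have yY: "y \<in> Y" using N.X_sub[OF p] y(2) by auto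
    define E where "E = {i. i < k \<and> y \<in> g (f i)}"
    have E: "E \<subseteq> {..<k}" "y \<in> piece Y g k f E" using yY by (auto simp: E_def piece_def)
    have "sim (piece Z d k e E) (piece Y g k f E)" using G E(1) by (simp add: good_def)
    moreover have "piece Y g k f E \<inter> W p \<noteq> {}" using E(2) y(2) by auto
    ultimately have "piece Z d k e E \<inter> X p \<noteq> {}" using p by (simp add: sim_def)
    then obtain x where x: "x \<in> piece Z d k e E" "x \<in> X p" by auto
    then have "x \<in> d a \<longleftrightarrow> y \<in> g b" using c E unfolding corr_def by simp
    then show False using da x(2) y(1) by auto
  qed
next
  assume gb: "g b \<inter> W p = {}"
  show "d a \<inter> X p = {}"
  proof (rule ccontr)
    assume "d a \<inter> X p \<noteq> {}"
    then obtain x where x: "x \<in> d a" "x \<in> X p" by auto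
    have xZ: "x \<in> Z" using M.X_sub[OF p] x(2) by auto
    define E where "E = {i. i < k \<and> x \<in> d (e i)}"
    have E: "E \<subseteq> {..<k}" "x \<in> piece Z d k e E" using xZ by (auto simp: E_def piece_def)
    have "sim (piece Z d k e E) (piece Y g k f E)" using G E(1) by (simp add: good_def)
    moreover have "piece Z d k e E \<inter> X p \<noteq> {}" using E(2) x(2) by auto
    ultimately have "piece Y g k f E \<inter> W p \<noteq> {}" using p by (simp add: sim_def)
    then obtain y where y: "y \<in> piece Y g k f E" "y \<in> W p" by auto
    then have "x \<in> d a \<longleftrightarrow> y \<in> g b" using c E unfolding corr_def by simp
    then show False using gb y(2) x(1) by auto
  qed
qed

end

text \<open>Equality is put into the form "this element misses these parts", the form in which the
  predicates are given, so that \<open>corr_meets\<close> settles both kinds of atomic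
  formula.\<close>

lemma (in rep_system) eq_iff_disjoint:
  assumes "a \<in> R" "b \<in> R"
  shows "a = b \<longleftrightarrow> (\<forall>p\<in>po_points T. d (sys_add M a b) \<inter> X p = {})"
proof
  assume "a = b"
  then show "\<forall>p\<in>po_points T. d (sys_add M a b) \<inter> X p = {}" using assms by (simp add: d_add)
next
  assume *: "\<forall>p\<in>po_points T. d (sys_add M a b) \<inter> X p = {}"
  have "d (sys_add M a b) \<subseteq> Z" using B_sub add_cl assms by simp
  then have "d (sys_add M a b) = {}" using * X_cov by auto
  then have "d a = d b" using assms by (auto simp: d_add)
  then show "a = b" using d_eqI assms by simp
qed

context rep_pair
begin

text \<open>The matched elements \<open>e\<close>, \<open>f\<close> are listed in the order of their
  choice, while \<open>u\<close>, \<open>w\<close> assign them to variables. Keeping the two apart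
  allows a quantifier to reuse a variable whose old value stays in the list.\<close>

lemma good_satisfies:
  assumes "A \<in> forms n" "good k e f" "\<forall>v\<in>free_vars A. \<exists>i<k. u v = e i \<and> w v = f i"
  shows "satisfies M u A \<longleftrightarrow> satisfies N w A"
  using assms
proof (induction A arbitrary: k e f u w)
  case (Equal s t)
  have st: "corr k e f (term_val M u s) (term_val N w s)" "corr k e f (term_val M u t) (term_val N w t)"
    "corr k e f (term_val M u (Add s t)) (term_val N w (Add s t))"
    by (rule corr_term[OF Equal.prems(2)]; use Equal.prems(3) in simp)+
  have R: "term_val M u s \<in> M.R" "term_val M u t \<in> M.R" "term_val N w s \<in> N.R" "term_val N w t \<in> N.R"
    using st by (simp_all add: corr_def)
  show ?case
    using corr_meets[OF Equal.prems(2) st(3)] M.eq_iff_disjoint[OF R(1,2)] N.eq_iff_disjoint[OF R(3,4)] by simp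
next
  case (Pred i t)
  have c: "corr k e f (term_val M u t) (term_val N w t)"
    by (rule corr_term[OF Pred.prems(2)]; use Pred.prems(3) in simp)
  have i: "i < n" using Pred.prems(1) by simp
  have eq: "d (term_val M u t) \<inter> X p = {} \<longleftrightarrow> g (term_val N w t) \<inter> W p = {}" if "p \<in> po_Qs T ! i" for p
    by (rule corr_meets[OF Pred.prems(2) c]) (use M.Q_sub[OF i] that in auto)
  have UN: "S \<inter> (\<Union>p\<in>Q. V p) = {} \<longleftrightarrow> (\<forall>p\<in>Q. S \<inter> V p = {})" for S :: "'z set" and Q :: "'p set" and V
    by auto
  have UN': "S \<inter> (\<Union>p\<in>Q. V p) = {} \<longleftrightarrow> (\<forall>p\<in>Q. S \<inter> V p = {})" for S :: "'y set" and Q :: "'p set" and V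
    by auto
  have "d (term_val M u t) \<inter> (\<Union>p\<in>po_Qs T ! i. X p) = {} \<longleftrightarrow>
      g (term_val N w t) \<inter> (\<Union>p\<in>po_Qs T ! i. W p) = {}"
    unfolding UN UN' by (rule ball_cong[OF refl eq])
  moreover have "term_val M u t \<in> M.R" "term_val N w t \<in> N.R" using c by (simp_all add: corr_def)
  ultimately show ?case by (simp add: M.preds[OF i] N.preds[OF i])
next
  case (Neg A)
  then show ?case using Neg.IH[of k e f u w] by simp
next
  case (Conj A B)
  have "satisfies M u A \<longleftrightarrow> satisfies N w A" "satisfies M u B \<longleftrightarrow> satisfies N w B"
    by (rule Conj.IH[OF _ Conj.prems(2)]; use Conj.prems in simp)+
  then show ?case by simp
next
  case (Forall v A)
  have A: "A \<in> forms n" using Forall.prems(1) by simp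
  have step: "satisfies M (u(v := a)) A \<longleftrightarrow> satisfies N (w(v := b)) A"
    if gd: "good (Suc k) (e(k := a)) (f(k := b))" for a b
  proof (rule Forall.IH[OF A gd], intro ballI)
    fix z assume z: "z \<in> free_vars A"
    show "\<exists>i<Suc k. (u(v := a)) z = (e(k := a)) i \<and> (w(v := b)) z = (f(k := b)) i"
    proof (cases "z = v")
      case True
      then show ?thesis by (intro exI[of _ k]) simp
    next
      case False
      then obtain i where "i < k" "u z = e i" "w z = f i" using Forall.prems(3) z by auto
      then show ?thesis using False by (intro exI[of _ i]) simp
    qed
  qed
  show ?case unfolding satisfies.simps
  proof
    assume L: "\<forall>x\<in>M.R. satisfies M (u(v := x)) A"
    show "\<forall>x\<in>N.R. satisfies N (w(v := x)) A"
    proof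
      fix b assume b: "b \<in> N.R"
      obtain a where a: "a \<in> M.R" "good (Suc k) (e(k := a)) (f(k := b))"
        using good_back[OF Forall.prems(2) b] by (elim bexE)
      show "satisfies N (w(v := b)) A" using L a(1) step[OF a(2)] by simp
    qed
  next
    assume L: "\<forall>x\<in>N.R. satisfies N (w(v := x)) A"
    show "\<forall>x\<in>M.R. satisfies M (u(v := x)) A"
    proof
      fix a assume a: "a \<in> M.R"
      obtain b where b: "b \<in> N.R" "good (Suc k) (e(k := a)) (f(k := b))"
        using good_forth[OF Forall.prems(2) a] by (elim bexE)
      show "satisfies M (u(v := a)) A" using L b(1) step[OF b(2)] by simp
    qed
  qed
qed

lemma pair_elem_equiv: "elem_equiv n M N"
proof (rule elem_equivI[OF M.st N.st])
  fix A assume A: "A \<in> sentences n" "true_in M A"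
  have fv: "free_vars A = {}" and fm: "A \<in> forms n" using A(1) by (simp_all add: sentences_def forms_def)
  have "satisfies M (\<lambda>_. sys_zero M) A \<longleftrightarrow> satisfies N (\<lambda>_. sys_zero N) A"
    by (rule good_satisfies[OF fm good_0]) (simp add: fv)
  then show "true_in N A"
    using A(2) true_in_sentence[OF fv envs_nonempty[OF M.st]] true_in_sentence[OF fv envs_nonempty[OF N.st]] by simp
qed

end

lemma finite_image_factor:
  assumes "finite (h ` A)" "\<And>x y. x \<in> A \<Longrightarrow> y \<in> A \<Longrightarrow> h x = h y \<Longrightarrow> f x = f y"
  shows "finite (f ` A)"
proof -
  have "f x = f (SOME y. y \<in> A \<and> h y = h x)" if x: "x \<in> A" for x
  proof -
    have "(SOME y. y \<in> A \<and> h y = h x) \<in> A \<and> h (SOME y. y \<in> A \<and> h y = h x) = h x"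
      by (rule someI[of _ x]) (simp add: x)
    then show ?thesis using assms(2)[OF x] by simp
  qed
  then have "f ` A = (\<lambda>c. f (SOME y. y \<in> A \<and> h y = c)) ` h ` A"
    unfolding image_image by (intro image_cong refl)
  then show ?thesis using assms(1) by simp
qed

context rep_system
begin

text \<open>Two tuples of \<open>M\<close> whose cells have equal invariants are a good position
  between \<open>M\<close> and itself, so they have the same type. Only finitely many values of the
  invariants are possible.\<close>

lemma finite_ktypes: "finite (ktype n M k ` envs M)"
proof -
  interpret pp: rep_pair n M T Z d X M Z d X by unfold_locales
  \<comment> \<open>Exactly the data compared by \<open>sim\<close>. The default 0 for
    \<open>p < p\<close> suppresses a cardinality that \<open>sim\<close> ignores.\<close>
  define h where "h e = (\<lambda>E\<in>Pow {..<k}. \<lambda>p\<in>P. (piece Z d k e E \<inter> X p = {},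
      if (p, p) \<in> r then 0 else card (piece Z d k e E \<inter> X p)))" for e
  have "finite (h ` envs M)"
  proof (rule finite_subset)
    show "h ` envs M \<subseteq> (\<Pi>\<^sub>E E\<in>Pow {..<k}. \<Pi>\<^sub>E p\<in>P. UNIV \<times> {..card (X p)})"
    proof
      fix y assume "y \<in> h ` envs M"
      then obtain e where y: "y = h e" by auto
      have "(if (p, p) \<in> r then 0 else card (piece Z d k e E \<inter> X p)) \<le> card (X p)" if "p \<in> P" for p E
      proof (cases "(p, p) \<in> r")
        case False
        then have "finite (X p)" using discrete_X(1)[OF that] by simp
        then show ?thesis using False by (simp add: card_mono)
      qed simp
      then show "y \<in> (\<Pi>\<^sub>E E\<in>Pow {..<k}. \<Pi>\<^sub>E p\<in>P. UNIV \<times> {..card (X p)})"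
        unfolding y h_def by (intro restrict_PiE_iff[THEN iffD2] ballI) simp
    qed
    show "finite (\<Pi>\<^sub>E E\<in>Pow {..<k}. \<Pi>\<^sub>E p\<in>P. (UNIV :: bool set) \<times> {..card (X p)})"
      by (intro finite_PiE finite_SigmaI) (use fin_P in simp_all)
  qed
  then show ?thesis
  proof (rule finite_image_factor)
    fix e f assume ef: "e \<in> envs M" "f \<in> envs M" "h e = h f"
    have eR: "e i \<in> R" "f i \<in> R" for i using ef by (auto simp: envs_def)
    have "pp.sim (piece Z d k e E) (piece Z d k f E)" if E: "E \<subseteq> {..<k}" for E
    proof -
      have c: "(piece Z d k e E \<inter> X p = {} \<longleftrightarrow> piece Z d k f E \<inter> X p = {}) \<and>
          ((p, p) \<notin> r \<longrightarrow> card (piece Z d k e E \<inter> X p) = card (piece Z d k f E \<inter> X p))"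
        if p: "p \<in> P" for p
      proof -
        have "h e E p = h f E p" using ef(3) by simp
        then show ?thesis using E p by (auto simp: h_def split: if_splits)
      qed
      have sub: "piece Z d k e E \<subseteq> Z" "piece Z d k f E \<subseteq> Z" by (auto simp: piece_def)
      have pe: "(E \<inter> {..<k} \<noteq> {} \<longrightarrow> piece Z d k e E \<in> d ` R) \<and> (E \<inter> {..<k} = {} \<longrightarrow> Z - piece Z d k e E \<in> d ` R)"
        by (rule piece_clopen) (rule imageI, rule eR)
      have pf: "(E \<inter> {..<k} \<noteq> {} \<longrightarrow> piece Z d k f E \<in> d ` R) \<and> (E \<inter> {..<k} = {} \<longrightarrow> Z - piece Z d k f E \<in> d ` R)"
        by (rule piece_clopen) (rule imageI, rule eR)
      show ?thesis unfolding pp.sim_def using c sub pe pf by auto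
    qed
    then have gd: "pp.good k e f" using eR by (simp add: pp.good_def)
    have "satisfies M e A \<longleftrightarrow> satisfies M f A" if A: "A \<in> kforms n k" for A
      by (rule pp.good_satisfies[OF _ gd]) (use A in \<open>auto simp: kforms_def\<close>)
    then show "ktype n M k e = ktype n M k f" by (auto simp: ktype_def)
  qed
qed

lemma rep_iso:
  assumes "countable R" "is_structure n N" "countable (sys_carrier N)" "elem_equiv n M N"
  shows "systems_isomorphic M N"
  by (rule finite_types_isomorphic[OF st assms(2,1,3) finite_ktypes assms(4)])

lemma rep_omega_categorical:
  assumes "countable R"
  shows "omega_categorical n M"
proof -
  obtain K :: "nat bsystem" and h where K: "system_iso M K h" "is_structure n K" "elem_equiv n M K"
    by (rule ex_nat_copy[OF st assms])
  show ?thesis unfolding omega_categorical_def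
  proof (intro exI[of _ K] conjI allI impI)
    show "countable_model n (first_order_theory n M) K"
      unfolding countable_model_iff[OF st] using K by simp
    fix N' :: "nat bsystem" assume "countable_model n (first_order_theory n M) N'"
    then have N': "is_structure n N'" "countable (sys_carrier N')" "elem_equiv n M N'"
      unfolding countable_model_iff[OF st] by simp_all
    obtain i where i: "system_iso M N' i" using rep_iso[OF assms N'] by (auto simp: systems_isomorphic_def)
    show "systems_isomorphic N' K" unfolding systems_isomorphic_def
      by (rule exI, rule system_iso_comp[OF system_iso_inv[OF i st] K(1)])
  qed
qed

lemma rep_omega_system:
  assumes "countable R" shows "M \<in> omega_categorical_systems n"
  unfolding omega_categorical_systems_def
  using st rep_boolean_ring assms rep_ideals rep_omega_categorical[OF assms] by simp

end

lemma (in rep_pair) pair_isomorphic: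
  "countable M.R \<Longrightarrow> countable N.R \<Longrightarrow> systems_isomorphic M N"
  by (rule M.rep_iso[OF _ N.st _ pair_elem_equiv])

section \<open>Invariance of representation under isomorphism\<close>

lemma represents_rep_system:
  assumes "T \<in> po_tuples n" "M \<in> omega_categorical_systems n" "represents T M"
  obtains X where "rep_system n M T (stone_points M) (\<lambda>a. {I \<in> stone_points M. a \<notin> I}) X" "realises M T X"
proof -
  obtain X where X: "realises M T X" using assms(3) unfolding represents_def by (elim exE)
  have "represented_on n M T (stone_points M) (\<lambda>a. {I \<in> stone_points M. a \<notin> I}) X"
    by (rule realises_represented_on[OF assms(1) _ _ _ X]) (use assms(2) in \<open>simp_all add: omega_categorical_systems_def\<close>)
  then show thesis using that[OF rep_system.intro X] by simp
qed

lemma represents_isomorphic: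
  assumes "T \<in> po_tuples n" "M \<in> omega_categorical_systems n" "represents T M"
    and "N \<in> omega_categorical_systems n" "represents T N"
  shows "systems_isomorphic M N"
proof -
  obtain X where X: "rep_system n M T (stone_points M) (\<lambda>a. {I \<in> stone_points M. a \<notin> I}) X"
    by (rule represents_rep_system[OF assms(1-3)])
  obtain W where W: "rep_system n N T (stone_points N) (\<lambda>a. {I \<in> stone_points N. a \<notin> I}) W"
    by (rule represents_rep_system[OF assms(1,4,5)])
  interpret rep_pair n M T "stone_points M" "\<lambda>a. {I \<in> stone_points M. a \<notin> I}" X
    N "stone_points N" "\<lambda>a. {I \<in> stone_points N. a \<notin> I}" W
    using X W by (intro rep_pair.intro)
  show ?thesis by (rule pair_isomorphic) (use assms(2,4) in \<open>simp_all add: omega_categorical_systems_def\<close>)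
qed

lemma represented_on_iso:
  assumes rp: "represented_on n M T Z d X" and h: "system_iso N M h" and stN: "is_structure n N"
  shows "represented_on n N T Z (d \<circ> h) X"
proof -
  interpret rep_system n M T Z d X using rp by unfold_locales
  have bij: "bij_betw h (sys_carrier N) R" and pr: "map (\<lambda>J. h ` J) (sys_preds N) = sys_preds M"
    and hz: "h (sys_zero N) = sys_zero M"
    and hom: "\<And>x y. x \<in> sys_carrier N \<Longrightarrow> y \<in> sys_carrier N \<Longrightarrow> h (sys_add N x y) = sys_add M (h x) (h y)"
      "\<And>x y. x \<in> sys_carrier N \<Longrightarrow> y \<in> sys_carrier N \<Longrightarrow> h (sys_mult N x y) = sys_mult M (h x) (h y)"
    using h by (simp_all add: system_iso_def)
  have hR: "h ` sys_carrier N = R" and hi: "inj_on h (sys_carrier N)" using bij by (simp_all add: bij_betw_def)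
  have im: "(d \<circ> h) ` sys_carrier N = d ` R" unfolding hR[symmetric] by (simp add: image_comp)
  have hm: "h x \<in> R" if "x \<in> sys_carrier N" for x using hR that by auto
  have "inj_on (d \<circ> h) (sys_carrier N)" by (rule comp_inj_on[OF hi]) (simp add: hR inj)
  moreover have "sys_preds N ! i = {a \<in> sys_carrier N. (d \<circ> h) a \<inter> (\<Union>p\<in>po_Qs T ! i. X p) = {}}" if i: "i < n" for i
  proof -
    have l: "i < length (sys_preds N)" using stN i by (simp add: is_structure_def)
    then have eq: "h ` (sys_preds N ! i) = sys_preds M ! i" using pr nth_map by metis
    have sub: "sys_preds N ! i \<subseteq> sys_carrier N" using stN l by (auto simp: is_structure_def)
    have "a \<in> sys_preds N ! i \<longleftrightarrow> h a \<in> sys_preds M ! i" if "a \<in> sys_carrier N" for a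
      unfolding eq[symmetric] using inj_on_image_mem_iff[OF hi that sub] by simp
    then show ?thesis using sub hm by (auto simp: preds[OF i])
  qed
  ultimately show ?thesis
    unfolding represented_on_def im using stN TT bs srl d_zero hz hom hm by (simp add: d_add d_mul)
qed

lemma represents_system_iso:
  assumes "T \<in> po_tuples n" "M \<in> omega_categorical_systems n" "represents T M"
    and "is_structure n N" "systems_isomorphic M N"
  shows "represents T N"
proof -
  obtain X where X: "rep_system n M T (stone_points M) (\<lambda>a. {I \<in> stone_points M. a \<notin> I}) X"
    by (rule represents_rep_system[OF assms(1-3)])
  obtain h where h: "system_iso M N h" using assms(5) by (auto simp: systems_isomorphic_def)
  have st: "is_structure n M" using assms(2) by (simp add: omega_categorical_systems_def)
  have "represented_on n N T (stone_points M) ((\<lambda>a. {I \<in> stone_points M. a \<notin> I}) \<circ> inv_into (sys_carrier M) h) X"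
    by (rule represented_on_iso[OF rep_system.rep[OF X] system_iso_inv[OF h st] assms(4)])
  from rep_system.rep_represents[OF rep_system.intro[OF this]] show ?thesis .
qed

lemma represents_potuple_iso:
  assumes T: "T \<in> po_tuples n" "T' \<in> po_tuples n" and h: "potuple_iso T T' h"
    and M: "M \<in> omega_categorical_systems n" "represents T M"
  shows "represents T' M"
proof -
  obtain X where X: "rep_system n M T (stone_points M) (\<lambda>a. {I \<in> stone_points M. a \<notin> I}) X"
    by (rule represents_rep_system[OF T(1) M])
  interpret rep_system n M T "stone_points M" "\<lambda>a. {I \<in> stone_points M. a \<notin> I}" X by (rule X)
  let ?B = "(\<lambda>a. {I \<in> stone_points M. a \<notin> I}) ` R"
  note T2 = assms(2)
  have bij: "bij_betw h P (po_points T')"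
    and ord: "\<And>p q. p \<in> P \<Longrightarrow> q \<in> P \<Longrightarrow> (p, q) \<in> r \<longleftrightarrow> (h p, h q) \<in> po_less T'"
    and hL: "h ` po_L T = po_L T'" and hQ: "map (\<lambda>Q. h ` Q) (po_Qs T) = po_Qs T'"
    and hf: "\<And>p. p \<in> L_min_d T \<Longrightarrow> po_f T' (h p) = po_f T p"
    using h by (simp_all add: potuple_iso_def)
  define k where "k = inv_into P h"
  have P': "po_points T' = h ` P" using bij by (simp add: bij_betw_def)
  have kh: "k (h p) = p" if "p \<in> P" for p using bij that by (simp add: k_def bij_betw_inv_into_left)
  have himg: "h ` {p \<in> P. \<phi> (X p)} = {p \<in> h ` P. \<phi> (X (k p))}" for \<phi>
    using kh by auto
  have "sreal (stone_points M) ?B T' (\<lambda>p. X (k p))" unfolding sreal_def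
  proof (intro conjI ballI)
    show "X (k p) \<noteq> {}" if "p \<in> po_points T'" for p using that X_ne by (auto simp: P' kh)
    show "disjoint_family_on (\<lambda>p. X (k p)) (po_points T')"
      unfolding disjoint_family_on_def P'
    proof (intro ballI impI)
      fix p q assume "p \<in> h ` P" "q \<in> h ` P" "p \<noteq> q"
      then obtain p0 q0 where pq: "p0 \<in> P" "p = h p0" "q0 \<in> P" "q = h q0" "p0 \<noteq> q0" by auto
      then show "X (k p) \<inter> X (k q) = {}" using X_disj kh unfolding disjoint_family_on_def by simp
    qed
    show "(\<Union>p\<in>po_points T'. X (k p)) = stone_points M" using X_cov by (simp add: P' kh)
    show "sderived (stone_points M) ?B (X (k p)) = (\<Union>q\<in>{q \<in> po_points T'. (q, p) \<in> po_less T'}. X (k q))"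
      if p: "p \<in> po_points T'" for p
    proof -
      obtain p0 where p0: "p0 \<in> P" "p = h p0" using p by (auto simp: P')
      have e: "{q \<in> po_points T'. (q, p) \<in> po_less T'} = h ` {q \<in> P. (q, p0) \<in> r}"
        using ord[OF _ p0(1)] unfolding P' p0(2) by auto
      have "(\<Union>q\<in>h ` {q \<in> P. (q, p0) \<in> r}. X (k q)) = (\<Union>q\<in>{q \<in> P. (q, p0) \<in> r}. X q)"
        using kh by auto
      then show ?thesis unfolding e using X_der[OF p0(1)] p0 kh by simp
    qed
    have "po_L T' = h ` {p \<in> P. \<exists>b\<in>?B. X p \<subseteq> b}" unfolding hL[symmetric] L_eq by simp
    also have "\<dots> = {p \<in> po_points T'. \<exists>b\<in>?B. X (k p) \<subseteq> b}" unfolding P' by (rule himg)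
    finally show "po_L T' = {p \<in> po_points T'. \<exists>b\<in>?B. X (k p) \<subseteq> b}" .
    fix p assume p: "p \<in> L_min_d T'"
    then have "p \<in> po_points T'" "(p, p) \<notin> po_less T'" by (simp_all add: L_min_d_def discrete_part_def)
    then obtain p0 where p0: "p0 \<in> P" "p = h p0" "(p0, p0) \<notin> r" using ord by (auto simp: P')
    then have "p0 \<in> L_min_d T"
      using T(1) by (auto simp: po_tuples_def finite_crowded_def L_min_d_def discrete_part_def)
    then show "finite (X (k p))" "card (X (k p)) = po_f T' p" using f_card hf p0 kh by simp_all
  qed
  moreover have "sys_preds M ! i = {a \<in> R. {I \<in> stone_points M. a \<notin> I} \<inter> (\<Union>p\<in>po_Qs T' ! i. X (k p)) = {}}" if i: "i < n" for i
  proof -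
    have "po_Qs T' ! i = h ` (po_Qs T ! i)" unfolding hQ[symmetric] using i len_Q by simp
    moreover have "k (h p) = p" if "p \<in> po_Qs T ! i" for p using Q_sub[OF i] that kh by auto
    ultimately have "(\<Union>p\<in>po_Qs T' ! i. X (k p)) = (\<Union>p\<in>po_Qs T ! i. X p)" by simp
    then show ?thesis using preds[OF i] by simp
  qed
  ultimately have "represented_on n M T' (stone_points M) (\<lambda>a. {I \<in> stone_points M. a \<notin> I}) (\<lambda>p. X (k p))"
    using rep T2 unfolding represented_on_def by simp
  from rep_system.rep_represents[OF rep_system.intro[OF this]] show ?thesis .
qed

section \<open>The system determines the tuple\<close>

lemma (in real_space) sderived_union:
  assumes "Q \<subseteq> P"
  shows "sderived Z B (\<Union>p\<in>Q. X p) = (\<Union>p\<in>po_derivative P r Q. X p)"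
proof -
  have "finite (X ` Q)" using fin_P assms finite_subset by auto
  then have "sderived Z B (\<Union>(X ` Q)) = (\<Union>p\<in>Q. sderived Z B (X p))" by (simp add: sderived_UN)
  also have "\<dots> = (\<Union>p\<in>Q. \<Union>q\<in>{q \<in> P. (q, p) \<in> r}. X q)"
    using X_der assms by (intro SUP_cong refl) auto
  also have "\<dots> = (\<Union>p\<in>po_derivative P r Q. X p)" by (auto simp: po_derivative_def)
  finally show ?thesis .
qed

locale same_space = A: real_space Z B n T X + C: real_space Z B n T' X'
  for Z :: "'z set" and B n and T :: "'p potuple" and X and T' :: "'q potuple" and X' +
  assumes Qs: "i < n \<Longrightarrow> (\<Union>p\<in>po_Qs T ! i. X p) = (\<Union>p\<in>po_Qs T' ! i. X' p)"
begin

text \<open>The sets \<open>Q\<close> with this property form an algebra closed under the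
  derivative, since both derivatives describe the derived set of one space. It contains the
  generators, so the generation condition makes it all of \<open>Pow A.P\<close>.\<close>

lemma unions:
  assumes "Q \<subseteq> A.P"
  shows "\<exists>Q'\<subseteq>C.P. (\<Union>p\<in>Q. X p) = (\<Union>p\<in>Q'. X' p)"
proof -
  define \<A> where "\<A> = {Q. Q \<subseteq> A.P \<and> (\<exists>Q'\<subseteq>C.P. (\<Union>p\<in>Q. X p) = (\<Union>p\<in>Q'. X' p))}"
  have AI: "Q \<in> \<A>" if "Q \<subseteq> A.P" "Q' \<subseteq> C.P" "(\<Union>p\<in>Q. X p) = (\<Union>p\<in>Q'. X' p)" for Q Q'
    unfolding \<A>_def mem_Collect_eq by (intro conjI exI[of _ Q'] that)
  have AE: "\<exists>Q'. Q' \<subseteq> C.P \<and> (\<Union>p\<in>Q. X p) = (\<Union>p\<in>Q'. X' p)" "Q \<subseteq> A.P" if "Q \<in> \<A>" for Q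
    using that unfolding \<A>_def by simp_all
  have "algebra A.P \<A>" unfolding algebra_iff_Un
  proof (intro conjI ballI)
    show "\<A> \<subseteq> Pow A.P" by (auto simp: \<A>_def)
    show "{} \<in> \<A>" by (rule AI[of "{}" "{}"]) simp_all
    show "A.P - Q \<in> \<A>" if Q: "Q \<in> \<A>" for Q
    proof -
      obtain Q' where Q': "Q' \<subseteq> C.P" "(\<Union>p\<in>Q. X p) = (\<Union>p\<in>Q'. X' p)" using AE(1)[OF Q] by (elim exE conjE)
      have "(\<Union>p\<in>A.P - Q. X p) = Z - (\<Union>p\<in>Q. X p)"
        using A.X_cov AE(2)[OF Q] A.X_inj by blast
      moreover have "(\<Union>p\<in>C.P - Q'. X' p) = Z - (\<Union>p\<in>Q'. X' p)"
        using C.X_cov Q'(1) C.X_inj by blast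
      ultimately show ?thesis using Q'(2) by (intro AI[of _ "C.P - Q'"]) auto
    qed
    show "Q1 \<union> Q2 \<in> \<A>" if Q: "Q1 \<in> \<A>" "Q2 \<in> \<A>" for Q1 Q2
    proof -
      obtain R1 where R1: "R1 \<subseteq> C.P" "(\<Union>p\<in>Q1. X p) = (\<Union>p\<in>R1. X' p)" using AE(1)[OF Q(1)] by (elim exE conjE)
      obtain R2 where R2: "R2 \<subseteq> C.P" "(\<Union>p\<in>Q2. X p) = (\<Union>p\<in>R2. X' p)" using AE(1)[OF Q(2)] by (elim exE conjE)
      show ?thesis by (rule AI[of _ "R1 \<union> R2"]) (use AE(2) Q R1 R2 in \<open>simp_all add: UN_Un\<close>)
    qed
  qed
  moreover have "set (po_Qs T) \<subseteq> \<A>"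
  proof
    fix Q assume "Q \<in> set (po_Qs T)"
    then obtain i where i: "i < n" "Q = po_Qs T ! i" using A.len_Q by (auto simp: in_set_conv_nth)
    show "Q \<in> \<A>" by (rule AI[of _ "po_Qs T' ! i"])
      (use A.Q_lower[OF i(1)] C.Q_lower[OF i(1)] i Qs[OF i(1)] in \<open>simp_all add: lower_subset_def\<close>)
  qed
  moreover have "\<forall>Q\<in>\<A>. po_derivative A.P A.r Q \<in> \<A>"
  proof
    fix Q assume Q: "Q \<in> \<A>"
    obtain Q' where Q': "Q' \<subseteq> C.P" "(\<Union>p\<in>Q. X p) = (\<Union>p\<in>Q'. X' p)" using AE(1)[OF Q] by (elim exE conjE)
    show "po_derivative A.P A.r Q \<in> \<A>"
    proof (rule AI[of _ "po_derivative C.P C.r Q'"])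
      show "po_derivative A.P A.r Q \<subseteq> A.P" "po_derivative C.P C.r Q' \<subseteq> C.P" by (auto simp: po_derivative_def)
      show "(\<Union>p\<in>po_derivative A.P A.r Q. X p) = (\<Union>p\<in>po_derivative C.P C.r Q'. X' p)"
        unfolding A.sderived_union[OF AE(2)[OF Q], symmetric] C.sderived_union[OF Q'(1), symmetric] Q'(2) ..
    qed
  qed
  ultimately have "generated_algebra A.P A.r (set (po_Qs T)) \<subseteq> \<A>"
    unfolding generated_algebra_def by (intro Inter_lower) simp
  moreover have "generated_algebra A.P A.r (set (po_Qs T)) = Pow A.P" using A.T by (simp add: po_tuples_def)
  ultimately have "Q \<in> \<A>" using assms by auto
  then show ?thesis using AE(1) by simp
qed

lemma sub_part:
  assumes "p \<in> A.P" shows "\<exists>p'\<in>C.P. X' p' \<subseteq> X p"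
proof -
  obtain Q' where Q': "Q' \<subseteq> C.P" "X p = (\<Union>p\<in>Q'. X' p)" using unions[of "{p}"] assms by auto
  then have "Q' \<noteq> {}" using A.X_ne[OF assms] by auto
  then show ?thesis using Q' by auto
qed

end

context same_space
begin

text \<open>A block of each partition contains a block of the other. Descending twice gives
  \<open>X q \<subseteq> X' p' \<subseteq> X p\<close>, and disjointness forces
  \<open>q = p\<close>.\<close>

lemma same_part:
  assumes p: "p \<in> A.P" shows "\<exists>p'\<in>C.P. X' p' = X p"
proof -
  interpret S: same_space Z B n T' X' T X by unfold_locales (simp add: Qs)
  obtain p' where p': "p' \<in> C.P" "X' p' \<subseteq> X p" using sub_part[OF p] by (elim bexE)
  obtain q where q: "q \<in> A.P" "X q \<subseteq> X' p'" using S.sub_part[OF p'(1)] by (elim bexE)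
  obtain x where "x \<in> X q" using A.X_ne[OF q(1)] by auto
  then have "q = p" using A.X_inj[OF q(1) p, of x] q(2) p'(2) by auto
  then have "X' p' = X p" using p'(2) q(2) by auto
  then show ?thesis using p'(1) by auto
qed

lemma same_iso: "\<exists>h. potuple_iso T T' h"
proof -
  interpret S: same_space Z B n T' X' T X by unfold_locales (simp add: Qs)
  have "\<forall>p\<in>A.P. \<exists>p'. p' \<in> C.P \<and> X' p' = X p" using same_part by auto
  from bchoice[OF this] obtain h where h: "\<forall>p\<in>A.P. h p \<in> C.P \<and> X' (h p) = X p" by (elim exE)
  then have hP: "h p \<in> C.P" and hX: "X' (h p) = X p" if "p \<in> A.P" for p using that by simp_all
  have uniq: "h p = p'" if pq: "p \<in> A.P" "p' \<in> C.P" "X' p' = X p" for p p'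
  proof -
    obtain x where x: "x \<in> X p" using A.X_ne[OF pq(1)] by auto
    show ?thesis by (rule C.X_inj[OF hP[OF pq(1)] pq(2), of x]) (use x hX pq in simp_all)
  qed
  have inj: "p = q" if pq: "p \<in> A.P" "q \<in> A.P" "h p = h q" for p q
  proof -
    have eq: "X p = X q" using hX[OF pq(1)] hX[OF pq(2)] pq(3) by simp
    obtain x where x: "x \<in> X p" using A.X_ne[OF pq(1)] by auto
    show ?thesis by (rule A.X_inj[OF pq(1,2), of x]) (use x eq in simp_all)
  qed
  have bij: "bij_betw h A.P C.P"
  proof (rule bij_betwI')
    show "h p = h q \<longleftrightarrow> p = q" if "p \<in> A.P" "q \<in> A.P" for p q using inj that by auto
    show "h p \<in> C.P" if "p \<in> A.P" for p by (rule hP[OF that])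
    fix p' assume p': "p' \<in> C.P"
    obtain p where p: "p \<in> A.P" "X p = X' p'" using S.same_part[OF p'] by (elim bexE)
    then show "\<exists>p\<in>A.P. p' = h p" using uniq[OF p(1) p'] by auto
  qed
  \<comment> \<open>The order is recovered from the blocks and the topology alone, and both are
    common to the two tuples once the blocks are matched.\<close>
  have o1: "(p, q) \<in> A.r \<longleftrightarrow> X p \<subseteq> sderived Z B (X q)" if pq: "p \<in> A.P" "q \<in> A.P" for p q
  proof
    assume "(p, q) \<in> A.r"
    then show "X p \<subseteq> sderived Z B (X q)" using A.X_der[OF pq(2)] pq(1) by auto
  next
    assume s: "X p \<subseteq> sderived Z B (X q)"
    obtain x where x: "x \<in> X p" using A.X_ne[OF pq(1)] by auto
    then obtain q' where q': "q' \<in> A.P" "(q', q) \<in> A.r" "x \<in> X q'" using s A.X_der[OF pq(2)] by auto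
    then show "(p, q) \<in> A.r" using A.X_inj[OF pq(1) q'(1) x q'(3)] by simp
  qed
  have o2: "(p, q) \<in> C.r \<longleftrightarrow> X' p \<subseteq> sderived Z B (X' q)" if pq: "p \<in> C.P" "q \<in> C.P" for p q
  proof
    assume "(p, q) \<in> C.r"
    then show "X' p \<subseteq> sderived Z B (X' q)" using C.X_der[OF pq(2)] pq(1) by auto
  next
    assume s: "X' p \<subseteq> sderived Z B (X' q)"
    obtain x where x: "x \<in> X' p" using C.X_ne[OF pq(1)] by auto
    then obtain q' where q': "q' \<in> C.P" "(q', q) \<in> C.r" "x \<in> X' q'" using s C.X_der[OF pq(2)] by auto
    then show "(p, q) \<in> C.r" using C.X_inj[OF pq(1) q'(1) x q'(3)] by simp
  qed
  have ord: "(p, q) \<in> A.r \<longleftrightarrow> (h p, h q) \<in> C.r" if "p \<in> A.P" "q \<in> A.P" for p q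
    unfolding o1[OF that] o2[OF hP[OF that(1)] hP[OF that(2)]] hX[OF that(1)] hX[OF that(2)] ..
  have hI: "h ` A.P = C.P" using bij by (simp add: bij_betw_def)
  have himg: "h ` Q = {p' \<in> C.P. \<phi> (X' p')}" if "Q = {p \<in> A.P. \<phi> (X p)}" for Q \<phi>
    unfolding that hI[symmetric] using hX by auto
  have "h ` po_L T = po_L T'" unfolding A.L_eq C.L_eq by (rule himg[OF refl])
  moreover have "h ` (po_Qs T ! i) = po_Qs T' ! i" if i: "i < n" for i
  proof -
    have s: "Q = {p \<in> A.P. X p \<subseteq> (\<Union>p\<in>Q. X p)}" if Q: "Q \<subseteq> A.P" for Q
    proof (intro equalityI subsetI)
      fix p assume "p \<in> {p \<in> A.P. X p \<subseteq> (\<Union>p\<in>Q. X p)}"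
      then have p: "p \<in> A.P" "X p \<subseteq> (\<Union>p\<in>Q. X p)" by simp_all
      obtain x where x: "x \<in> X p" using A.X_ne[OF p(1)] by auto
      then obtain q where "q \<in> Q" "x \<in> X q" using p(2) by auto
      then show "p \<in> Q" using A.X_inj[OF p(1) _ x] Q by auto
    qed (use Q in auto)
    have s': "Q = {p \<in> C.P. X' p \<subseteq> (\<Union>p\<in>Q. X' p)}" if Q: "Q \<subseteq> C.P" for Q
    proof (intro equalityI subsetI)
      fix p assume "p \<in> {p \<in> C.P. X' p \<subseteq> (\<Union>p\<in>Q. X' p)}"
      then have p: "p \<in> C.P" "X' p \<subseteq> (\<Union>p\<in>Q. X' p)" by simp_all
      obtain x where x: "x \<in> X' p" using C.X_ne[OF p(1)] by auto
      then obtain q where "q \<in> Q" "x \<in> X' q" using p(2) by auto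
      then show "p \<in> Q" using C.X_inj[OF p(1) _ x] Q by auto
    qed (use Q in auto)
    have sub: "po_Qs T ! i \<subseteq> A.P" "po_Qs T' ! i \<subseteq> C.P"
      using A.Q_lower[OF i] C.Q_lower[OF i] by (simp_all add: lower_subset_def)
    have "h ` (po_Qs T ! i) = {p' \<in> C.P. X' p' \<subseteq> (\<Union>p\<in>po_Qs T ! i. X p)}"
      by (rule himg) (rule s[OF sub(1)])
    also have "\<dots> = po_Qs T' ! i" unfolding Qs[OF i] by (rule s'[OF sub(2), symmetric])
    finally show ?thesis .
  qed
  then have "map (\<lambda>Q. h ` Q) (po_Qs T) = po_Qs T'"
    by (intro nth_equalityI) (simp_all add: A.len_Q C.len_Q)
  moreover have "po_f T' (h p) = po_f T p" if p: "p \<in> L_min_d T" for p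
  proof -
    have pp: "p \<in> A.P" "(p, p) \<notin> A.r" using p by (simp_all add: L_min_d_def discrete_part_def)
    then have "(h p, h p) \<notin> C.r" using ord by simp
    then show ?thesis using A.discrete_X(2)[OF pp] C.discrete_X(2)[OF hP[OF pp(1)]] hX[OF pp(1)] by simp
  qed
  ultimately have "potuple_iso T T' h" unfolding potuple_iso_def using bij ord by simp
  then show ?thesis by (rule exI[of _ h])
qed

end

lemma represents_unique:
  assumes T: "T \<in> po_tuples n" "T' \<in> po_tuples n"
    and M: "M \<in> omega_categorical_systems n" "represents T M" "represents T' M"
  shows "\<exists>h. potuple_iso T T' h"
proof -
  obtain X where X: "rep_system n M T (stone_points M) (\<lambda>a. {I \<in> stone_points M. a \<notin> I}) X" "realises M T X"
    by (rule represents_rep_system[OF T(1) M(1,2)])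
  obtain X' where X': "rep_system n M T' (stone_points M) (\<lambda>a. {I \<in> stone_points M. a \<notin> I}) X'" "realises M T' X'"
    by (rule represents_rep_system[OF T(2) M(1,3)])
  interpret A: rep_system n M T "stone_points M" "\<lambda>a. {I \<in> stone_points M. a \<notin> I}" X by (rule X(1))
  interpret C: rep_system n M T' "stone_points M" "\<lambda>a. {I \<in> stone_points M. a \<notin> I}" X' by (rule X'(1))
  have eq: "map (\<lambda>Q. \<Union>p\<in>Q. X p) (po_Qs T) = map (\<lambda>Q. \<Union>p\<in>Q. X' p) (po_Qs T')"
    using X(2) X'(2) unfolding realises_def by simp
  have Q: "(\<Union>p\<in>po_Qs T ! i. X p) = (\<Union>p\<in>po_Qs T' ! i. X' p)" if i: "i < n" for i
    using arg_cong[OF eq, of "\<lambda>xs. xs ! i"] i A.len_Q C.len_Q by simp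
  interpret same_space "stone_points M" "(\<lambda>a. {I \<in> stone_points M. a \<notin> I}) ` sys_carrier M" n T X T' X'
    by unfold_locales (rule Q)
  show ?thesis by (rule same_iso)
qed

section \<open>The space of a given tuple\<close>

locale path_space =
  fixes n :: nat and T :: "'p potuple"
  assumes T: "T \<in> po_tuples n"
begin

abbreviation P where "P \<equiv> po_points T"
abbreviation r where "r \<equiv> po_less T"

lemma fin: "finite P"
  using T by (simp add: po_tuples_def finite_crowded_def)

lemma po: "po_system P r"
  using T by (simp add: po_tuples_def extended_po_system_def)

lemma rP: "(p, q) \<in> r \<Longrightarrow> p \<in> P \<and> q \<in> P"
  using po by (auto simp: po_system_def)

lemma r_trans: "(a, b) \<in> r \<Longrightarrow> (b, c) \<in> r \<Longrightarrow> (a, c) \<in> r"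
  using po unfolding po_system_def trans_def by metis

lemma r_antisym: "(a, b) \<in> r \<Longrightarrow> (b, a) \<in> r \<Longrightarrow> a = b"
  using po unfolding po_system_def antisym_def by metis

lemma L_lower: "p \<in> po_L T \<Longrightarrow> (q, p) \<in> r \<Longrightarrow> q \<in> po_L T"
  using T rP unfolding po_tuples_def extended_po_system_def lower_subset_def by simp

lemma L_sub: "po_L T \<subseteq> P"
  using T unfolding po_tuples_def extended_po_system_def lower_subset_def by simp

text \<open>An irreflexive point is minimal in \<open>L\<close>, so anything below it would be the
  point itself, against irreflexivity. This is what keeps the label constant along paths counted by
  \<open>po_f\<close>.\<close>

lemma discrete:
  assumes "p \<in> P" "(p, p) \<notin> r"
  shows "p \<in> L_min_d T" "p \<in> po_L T" "po_f T p > 0" "(q, p) \<notin> r"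
proof -
  show m: "p \<in> L_min_d T"
    using T assms by (auto simp: po_tuples_def finite_crowded_def L_min_d_def discrete_part_def)
  then show L: "p \<in> po_L T" by (simp add: L_min_d_def L_min_def minimal_elements_def)
  show "po_f T p > 0" using T m by (simp add: po_tuples_def extended_po_system_def)
  show "(q, p) \<notin> r"
  proof
    assume q: "(q, p) \<in> r"
    then have "q = p" using m L_lower[OF L q]
      by (auto simp: L_min_d_def L_min_def minimal_elements_def po_le_def)
    then show False using q assms(2) by simp
  qed
qed

text \<open>The points are paths through labelled nodes: a node with label \<open>p\<close> has a main child
  \<open>(p, 0)\<close> and one further child \<open>(q, 1)\<close> for each \<open>q > p\<close>, including \<open>q = p\<close> when \<open>p < p\<close>.
  The label of a path is eventually constant, and its final value decides the part \<open>X\<^sub>p\<close>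
  to which the path belongs.\<close>

definition root :: "'p \<times> nat \<Rightarrow> bool" where
  "root u \<longleftrightarrow> fst u \<in> P \<and> (fst u \<in> po_L T \<longrightarrow>
     (if (fst u, fst u) \<in> r then snd u = 0 else snd u < po_f T (fst u)))"

definition step :: "'p \<times> nat \<Rightarrow> 'p \<times> nat \<Rightarrow> bool" where
  "step u v \<longleftrightarrow> v = (fst u, 0) \<or> (snd v = 1 \<and> (fst u, fst v) \<in> r)"

definition Z :: "(nat \<Rightarrow> 'p \<times> nat) set" where
  "Z = {x. root (x 0) \<and> (\<forall>k. step (x k) (x (Suc k)))}"

definition agree :: "nat \<Rightarrow> (nat \<Rightarrow> 'p \<times> nat) \<Rightarrow> (nat \<Rightarrow> 'p \<times> nat) \<Rightarrow> bool" where
  "agree k x y \<longleftrightarrow> (\<forall>i\<le>k. x i = y i)"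

definition det :: "nat \<Rightarrow> (nat \<Rightarrow> 'p \<times> nat) set \<Rightarrow> bool" where
  "det k b \<longleftrightarrow> (\<forall>x\<in>b. \<forall>y\<in>Z. agree k x y \<longrightarrow> y \<in> b)"

text \<open>The compact open sets of the path space. Each node has finitely many children, so a set
  determined at some finite depth is compact once its paths have finitely many starting
  nodes.\<close>

definition B :: "(nat \<Rightarrow> 'p \<times> nat) set set" where
  "B = {b. b \<subseteq> Z \<and> (\<exists>k. det k b) \<and> finite ((\<lambda>x. x 0) ` b)}"

definition X :: "'p \<Rightarrow> (nat \<Rightarrow> 'p \<times> nat) set" where
  "X p = {x \<in> Z. \<exists>k. \<forall>j\<ge>k. fst (x j) = p}"

lemma agree_refl [simp]: "agree k x x"
  by (simp add: agree_def)

lemma agree_sym: "agree k x y \<Longrightarrow> agree k y x"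
  by (simp add: agree_def)

lemma agree_trans: "agree k x y \<Longrightarrow> agree k y z \<Longrightarrow> agree k x z"
  by (simp add: agree_def)

lemma agree_mono: "agree l x y \<Longrightarrow> k \<le> l \<Longrightarrow> agree k x y"
  by (simp add: agree_def)

lemma detD: "det k b \<Longrightarrow> x \<in> b \<Longrightarrow> y \<in> Z \<Longrightarrow> agree k x y \<Longrightarrow> y \<in> b"
  by (simp add: det_def)

lemma det_mono: "det k b \<Longrightarrow> k \<le> l \<Longrightarrow> det l b"
  unfolding det_def using agree_mono by auto

lemma label_P: "x \<in> Z \<Longrightarrow> fst (x k) \<in> P"
proof (induction k)
  case 0
  then show ?case by (simp add: Z_def root_def)
next
  case (Suc k)
  then have "step (x k) (x (Suc k))" by (simp add: Z_def)
  then show ?case using Suc rP by (auto simp: step_def)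
qed

lemma label_mono:
  assumes "x \<in> Z" "i \<le> j"
  shows "fst (x i) = fst (x j) \<or> (fst (x i), fst (x j)) \<in> r"
  using assms(2)
proof (induction j rule: dec_induct)
  case (step j)
  have "step (x j) (x (Suc j))" using assms(1) by (simp add: Z_def)
  then have "fst (x j) = fst (x (Suc j)) \<or> (fst (x j), fst (x (Suc j))) \<in> r" by (auto simp: step_def)
  then show ?case using step.IH r_trans[of "fst (x i)" "fst (x j)" "fst (x (Suc j))"] by auto
qed simp

lemma label_between:
  assumes "x \<in> Z" "i \<le> j" "j \<le> k" "fst (x i) = fst (x k)"
  shows "fst (x j) = fst (x i)"
  using label_mono[OF assms(1,2)] label_mono[OF assms(1,3)] assms(4) r_antisym by metis

text \<open>Labels only increase and \<open>P\<close> is finite. Some label recurs infinitely often,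
  and antisymmetry forbids leaving it in between.\<close>

lemma X_cover: assumes x: "x \<in> Z" shows "\<exists>p\<in>P. x \<in> X p"
proof -
  have "finite (range (\<lambda>k. fst (x k)))"
    by (rule finite_subset[OF _ fin]) (use label_P[OF x] in auto)
  then obtain k0 where k0: "infinite {k \<in> UNIV. fst (x k) = fst (x k0)}"
    using pigeonhole_infinite[of "UNIV :: nat set" "\<lambda>k. fst (x k)"] by auto
  have "fst (x j) = fst (x k0)" if j: "j \<ge> k0" for j
  proof -
    obtain k where "k > j" "fst (x k) = fst (x k0)"
      using k0 unfolding infinite_nat_iff_unbounded by auto
    then show ?thesis using label_between[OF x j, of k] by simp
  qed
  then have "\<forall>j\<ge>k0. fst (x j) = fst (x k0)" by blast
  then have "x \<in> X (fst (x k0))" unfolding X_def using x by blast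
  then show ?thesis using label_P[OF x] by auto
qed

lemma X_unique:
  assumes "x \<in> X p" "x \<in> X q" shows "p = q"
proof -
  obtain k l where "\<And>j. j \<ge> k \<Longrightarrow> fst (x j) = p" "\<And>j. j \<ge> l \<Longrightarrow> fst (x j) = q"
    using assms by (auto simp: X_def)
  from this(1)[of "max k l"] this(2)[of "max k l"] show ?thesis by simp
qed

definition jump :: "(nat \<Rightarrow> 'p \<times> nat) \<Rightarrow> nat \<Rightarrow> 'p \<Rightarrow> nat \<Rightarrow> 'p \<times> nat" where
  "jump x k q j = (if j \<le> k then x j else (q, if j = Suc k then 1 else 0))"

text \<open>Leaving a path after level \<open>k\<close> through the side child \<open>(q, 1)\<close>
  and following main children from there gives points of \<open>X q\<close> arbitrarily close to the
  path.\<close>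

lemma jump_X:
  assumes "x \<in> Z" "(fst (x k), q) \<in> r"
  shows "jump x k q \<in> X q" "agree k x (jump x k q)"
proof -
  have "step (jump x k q j) (jump x k q (Suc j))" for j
  proof -
    have "step (x j) (x (Suc j))" using assms(1) by (simp add: Z_def)
    moreover have "j < k \<or> j = k \<or> j > k" by auto
    ultimately show ?thesis using assms(2) by (auto simp: jump_def step_def)
  qed
  moreover have "root (jump x k q 0)" using assms(1) by (simp add: jump_def Z_def)
  ultimately have "jump x k q \<in> Z" by (simp add: Z_def)
  moreover have "\<forall>j\<ge>Suc k. fst (jump x k q j) = q" by (simp add: jump_def)
  ultimately show "jump x k q \<in> X q" unfolding X_def by auto
  show "agree k x (jump x k q)" by (simp add: agree_def jump_def)
qed

lemma const_X:
  assumes "root u" shows "(\<lambda>j. if j = 0 then u else (fst u, 0)) \<in> X (fst u)"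
  using assms unfolding X_def Z_def by (auto simp: step_def)

lemma cone_B: assumes "x \<in> Z" shows "{z \<in> Z. agree k x z} \<in> B"
proof -
  have "det k {z \<in> Z. agree k x z}"
    unfolding det_def using agree_trans by auto
  moreover have "(\<lambda>z. z 0) ` {z \<in> Z. agree k x z} \<subseteq> {x 0}" by (auto simp: agree_def)
  then have "finite ((\<lambda>z. z 0) ` {z \<in> Z. agree k x z})" by (rule finite_subset) simp
  ultimately show ?thesis unfolding B_def by auto
qed

lemma B_Diff_Un:
  assumes "a \<in> B" "b \<in> B" shows "a \<union> b \<in> B" "a - b \<in> B"
proof -
  obtain k l where kl: "det k a" "det l b" using assms by (auto simp: B_def)
  have d: "det (max k l) a" "det (max k l) b"
    using det_mono[OF kl(1), of "max k l"] det_mono[OF kl(2), of "max k l"] by simp_all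
  have s: "a \<subseteq> Z" "b \<subseteq> Z" using assms by (auto simp: B_def)
  have f: "finite ((\<lambda>x. x 0) ` (a \<union> b))" "finite ((\<lambda>x. x 0) ` (a - b))"
    using assms by (auto simp: B_def image_Un intro: finite_subset[OF image_mono[of "a - b" a]])
  have "det (max k l) (a \<union> b)" using d unfolding det_def by auto
  then show "a \<union> b \<in> B" using s f unfolding B_def by auto
  have "det (max k l) (a - b)" unfolding det_def
  proof (intro ballI impI)
    fix x y assume xy: "x \<in> a - b" "y \<in> Z" "agree (max k l) x y"
    have "y \<in> a" by (rule detD[OF d(1) _ xy(2,3)]) (use xy(1) in simp)
    moreover have "y \<notin> b"
    proof
      assume "y \<in> b"
      then have "x \<in> b" by (rule detD[OF d(2) _ _ agree_sym[OF xy(3)]]) (use xy(1) s in auto)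
      then show False using xy(1) by simp
    qed
    ultimately show "y \<in> a - b" by simp
  qed
  then show "a - b \<in> B" using s f unfolding B_def by auto
qed

section \<open>Compactness of the path space\<close>

lemma B_lists:
  assumes "b \<in> B" shows "finite ((\<lambda>x. map x [0..<Suc k]) ` b)"
proof -
  define A where "A = (\<lambda>x. x 0) ` b \<union> P \<times> {0, 1}"
  have fA: "finite A" using assms fin by (simp add: A_def B_def)
  have el: "x i \<in> A" if x: "x \<in> b" for x i
  proof (cases i)
    case 0
    then show ?thesis using x by (simp add: A_def)
  next
    case (Suc j)
    have xZ: "x \<in> Z" using assms x by (auto simp: B_def)
    then have "step (x j) (x i)" using Suc by (simp add: Z_def)
    then have "snd (x i) \<in> {0, 1}" by (auto simp: step_def)
    then have "x i \<in> P \<times> {0, 1}" using label_P[OF xZ, of i] by (simp add: mem_Times_iff)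
    then show ?thesis by (simp add: A_def)
  qed
  have "(\<lambda>x. map x [0..<Suc k]) ` b \<subseteq> {xs. set xs \<subseteq> A \<and> length xs = Suc k}"
    by (rule image_subsetI) (simp add: el image_subset_iff)
  then show ?thesis using finite_lists_length_eq[OF fA, of "Suc k"] by (rule finite_subset)
qed

lemma agree_map: "agree k x y \<longleftrightarrow> map x [0..<Suc k] = map y [0..<Suc k]"
  unfolding agree_def map_eq_conv by auto

text \<open>By finite branching, \<open>b\<close> is the union of finitely many cones at depth
  \<open>k\<close>; if all of them were in the ideal, so would \<open>b\<close> be.\<close>

lemma konig:
  assumes I: "I \<subseteq> B" "{} \<in> I" "\<And>a b. a \<in> I \<Longrightarrow> b \<in> I \<Longrightarrow> a \<union> b \<in> I"
    and b: "b \<in> B" "b \<notin> I"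
  shows "\<exists>x\<in>b. {z \<in> b. agree k x z} \<notin> I"
proof (rule ccontr)
  assume n: "\<not> ?thesis"
  define c where "c xs = {z \<in> b. map z [0..<Suc k] = xs}" for xs
  have cI: "c xs \<in> I" if xs: "xs \<in> (\<lambda>x. map x [0..<Suc k]) ` b" for xs
  proof -
    obtain x where x: "x \<in> b" "xs = map x [0..<Suc k]" using xs by auto
    have "c xs = {z \<in> b. agree k x z}" unfolding c_def agree_map x(2) by auto
    then show ?thesis using n x(1) by auto
  qed
  have un: "\<Union>(c ` F) \<in> I" if "finite F" "F \<subseteq> (\<lambda>x. map x [0..<Suc k]) ` b" for F
    using that
  proof (induction F rule: finite_induct)
    case (insert xs F)
    then show ?case using I(3)[OF cI[of xs]] by simp
  qed (simp add: I(2))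
  have "b = \<Union>(c ` (\<lambda>x. map x [0..<Suc k]) ` b)" by (auto simp: c_def)
  moreover have "\<Union>(c ` (\<lambda>x. map x [0..<Suc k]) ` b) \<in> I" by (rule un[OF B_lists[OF b(1)]]) simp
  ultimately show False using b(2) by simp
qed

text \<open>A Koenig argument: if \<open>b\<close> is not in the ideal, nested cones that are not in
  it can be chosen at all depths. Their limit path lies in some member of the ideal, and this member
  contains a whole cone around the path.\<close>

lemma path_compact:
  assumes I: "I \<subseteq> B" "{} \<in> I" "\<And>a b. a \<in> I \<Longrightarrow> b \<in> I \<Longrightarrow> a \<union> b \<in> I"
    "\<And>a b. a \<in> I \<Longrightarrow> b \<in> B \<Longrightarrow> b \<subseteq> a \<Longrightarrow> b \<in> I"
    and b: "b \<in> B" "b \<subseteq> \<Union>I"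
  shows "b \<in> I"
proof (rule ccontr)
  assume nI: "b \<notin> I"
  have bZ: "b \<subseteq> Z" using b(1) by (simp add: B_def)
  have cB: "{z \<in> b. agree k x z} \<in> B" if x: "x \<in> b" for k x
  proof -
    have "{z \<in> Z. agree k x z} \<in> B" using cone_B bZ x by auto
    then have "b - (b - {z \<in> Z. agree k x z}) \<in> B" by (intro B_Diff_Un b)
    moreover have "b - (b - {z \<in> Z. agree k x z}) = {z \<in> b. agree k x z}" using bZ by auto
    ultimately show ?thesis by simp
  qed
  have "\<exists>s. \<forall>k. (s k \<in> b \<and> {z \<in> b. agree k (s k) z} \<notin> I) \<and> agree k (s k) (s (Suc k))"
  proof (rule dependent_nat_choice)
    show "\<exists>x. x \<in> b \<and> {z \<in> b. agree 0 x z} \<notin> I" using konig[OF I(1-3) b(1) nI] by (auto simp: Bex_def)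
    fix x k assume x: "x \<in> b \<and> {z \<in> b. agree k x z} \<notin> I"
    have "\<exists>y\<in>{z \<in> b. agree k x z}. {w \<in> {z \<in> b. agree k x z}. agree (Suc k) y w} \<notin> I"
      by (rule konig[OF I(1-3) cB]) (use x in simp_all)
    then obtain y where y: "y \<in> b" "agree k x y" "{w \<in> {z \<in> b. agree k x z}. agree (Suc k) y w} \<notin> I" by auto
    have "agree k x w" if "agree (Suc k) y w" for w
      using agree_trans[OF y(2) agree_mono[OF that, of k]] by simp
    then have "{w \<in> {z \<in> b. agree k x z}. agree (Suc k) y w} = {z \<in> b. agree (Suc k) y z}" by auto
    then show "\<exists>y. (y \<in> b \<and> {z \<in> b. agree (Suc k) y z} \<notin> I) \<and> agree k x y" using y by auto
  qed
  then obtain s where s0: "\<forall>k. (s k \<in> b \<and> {z \<in> b. agree k (s k) z} \<notin> I) \<and> agree k (s k) (s (Suc k))"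
    by (elim exE)
  then have s: "\<And>k. s k \<in> b" "\<And>k. {z \<in> b. agree k (s k) z} \<notin> I" "\<And>k. agree k (s k) (s (Suc k))"
    by simp_all
  have ag: "agree i (s i) (s j)" if "i \<le> j" for i j
    using that
  proof (induction j rule: dec_induct)
    case (step j)
    then show ?case using agree_trans[OF step.IH agree_mono[OF s(3)[of j], of i]] by simp
  qed simp
  \<comment> \<open>The diagonal path is the limit of the chosen cones, because consecutive choices
    agree up to the current depth.\<close>
  define y where "y j = s j j" for j
  have ay: "agree k y (s k)" for k
    unfolding agree_def y_def using ag unfolding agree_def by simp
  have sZ: "s k \<in> Z" for k using s(1) bZ by auto
  have "step (y k) (y (Suc k))" for k
  proof -
    have "y k = s (Suc k) k" "y (Suc k) = s (Suc k) (Suc k)" using ay[of "Suc k"] by (simp_all add: agree_def)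
    then show ?thesis using sZ[of "Suc k"] by (simp add: Z_def)
  qed
  moreover have "root (y 0)" using sZ[of 0] by (simp add: y_def Z_def)
  ultimately have yZ: "y \<in> Z" by (simp add: Z_def)
  obtain k0 where k0: "det k0 b" using b(1) by (auto simp: B_def)
  have "y \<in> b" by (rule detD[OF k0 s(1)[of k0] yZ agree_sym[OF ay]])
  then obtain c where c: "c \<in> I" "y \<in> c" using b(2) by auto
  then obtain l where l: "det l c" using I(1) by (auto simp: B_def)
  have "{z \<in> b. agree l (s l) z} \<subseteq> c"
  proof
    fix z assume z: "z \<in> {z \<in> b. agree l (s l) z}"
    have "agree l y z" using agree_trans[OF ay[of l]] z by simp
    then show "z \<in> c" by (intro detD[OF l c(2)]) (use z bZ in auto)
  qed
  then have "{z \<in> b. agree l (s l) z} \<in> I" by (rule I(4)[OF c(1) cB[OF s(1)]])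
  then show False using s(2) by simp
qed

lemma path_boolean_space: "boolean_space Z B"
proof
  show "b \<subseteq> Z" if "b \<in> B" for b using that by (simp add: B_def)
  show "{} \<in> B" by (auto simp: B_def det_def)
  show "a \<union> b \<in> B" "a - b \<in> B" if "a \<in> B" "b \<in> B" for a b using B_Diff_Un that by simp_all
  show "\<exists>b\<in>B. x \<in> b" if "x \<in> Z" for x
    by (rule bexI[OF _ cone_B[OF that, of 0]]) (use that in simp)
  show "\<exists>b\<in>B. x \<in> b \<and> y \<notin> b" if xy: "x \<in> Z" "y \<in> Z" "x \<noteq> y" for x y
  proof -
    obtain j where j: "x j \<noteq> y j" using xy(3) by auto
    show ?thesis by (rule bexI[OF _ cone_B[OF xy(1), of j]]) (use xy j in \<open>auto simp: agree_def\<close>)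
  qed
qed (rule path_compact)

lemma path_derived:
  assumes q: "q \<in> P"
  shows "sderived Z B (X q) = (\<Union>p\<in>{p \<in> P. (p, q) \<in> r}. X p)"
proof (intro equalityI subsetI)
  interpret boolean_space Z B by (rule path_boolean_space)
  fix x assume "x \<in> (\<Union>p\<in>{p \<in> P. (p, q) \<in> r}. X p)"
  then obtain p where p: "p \<in> P" "(p, q) \<in> r" "x \<in> X p" by auto
  then obtain k where k: "\<And>j. j \<ge> k \<Longrightarrow> fst (x j) = p" and xZ: "x \<in> Z" by (auto simp: X_def)
  show "x \<in> sderived Z B (X q)"
  proof (rule sderivedI[OF xZ])
    fix b assume b: "b \<in> B" "x \<in> b"
    then obtain l where l: "det l b" by (auto simp: B_def)
    define m where "m = max k l"
    have d: "det m b" "det (Suc m) b" using det_mono[OF l] by (simp_all add: m_def)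
    have r1: "(fst (x m), q) \<in> r" "(fst (x (Suc m)), q) \<in> r" using k p(2) by (simp_all add: m_def)
    note j1 = jump_X[OF xZ r1(1)] and j2 = jump_X[OF xZ r1(2)]
    have in1: "jump x m q \<in> X q \<inter> b" using j1 detD[OF d(1) b(2)] by (auto simp: X_def)
    have in2: "jump x (Suc m) q \<in> X q \<inter> b" using j2 detD[OF d(2) b(2)] by (auto simp: X_def)
    \<comment> \<open>One jump could coincide with \<open>x\<close> when \<open>q\<close> is the
      label of \<open>x\<close> itself. Two jumps at consecutive levels differ from each other, so
      at least one of them differs from \<open>x\<close>.\<close>
    have "jump x m q (Suc (Suc m)) \<noteq> jump x (Suc m) q (Suc (Suc m))" by (simp add: jump_def)
    then have "jump x m q \<noteq> x \<or> jump x (Suc m) q \<noteq> x" by auto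
    then show "\<exists>y\<in>X q \<inter> b. y \<noteq> x" using in1 in2 by auto
  qed
next
  interpret boolean_space Z B by (rule path_boolean_space)
  fix x assume x: "x \<in> sderived Z B (X q)"
  then have xZ: "x \<in> Z" by (simp add: sderived_def)
  obtain p where p: "p \<in> P" "x \<in> X p" using X_cover[OF xZ] by auto
  then obtain k where k: "\<And>j. j \<ge> k \<Longrightarrow> fst (x j) = p" by (auto simp: X_def)
  have "\<exists>y\<in>X q \<inter> {z \<in> Z. agree k x z}. y \<noteq> x"
    by (rule sderivedD[OF x cone_B[OF xZ]]) (use xZ in simp)
  then obtain y where y: "y \<in> X q" "y \<in> Z" "agree k x y" "y \<noteq> x" by auto
  obtain l where l: "\<And>j. j \<ge> l \<Longrightarrow> fst (y j) = q" using y(1) by (auto simp: X_def)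
  have yk: "fst (y k) = p" using y(3) k by (simp add: agree_def) (metis order_refl)
  have pq: "p = q \<or> (p, q) \<in> r"
    using label_mono[OF y(2), of k "max k l"] yk l[of "max k l"] by simp
  \<comment> \<open>If \<open>p = q\<close> is irreflexive, a path that keeps the label
    \<open>p\<close> can only follow main children, so \<open>y\<close> would coincide with
    \<open>x\<close>.\<close>
  have "(p, q) \<in> r"
  proof (rule ccontr)
    assume n: "(p, q) \<notin> r"
    then have eq: "p = q" "(p, p) \<notin> r" using pq by auto
    have yp: "fst (y j) = p" if "j \<ge> k" for j
      using label_between[OF y(2) that, of "max j l"] l[of "max j l"] yk eq(1) by simp
    have "y j = x j" for j
    proof (induction j)
      case 0
      show ?case using y(3) by (simp add: agree_def)
    next
      case (Suc j)
      show ?case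
      proof (cases "Suc j \<le> k")
        case True
        then show ?thesis using y(3) by (simp add: agree_def)
      next
        case False
        then have j: "j \<ge> k" "Suc j \<ge> k" by simp_all
        have "step (y j) (y (Suc j))" "step (x j) (x (Suc j))" using y(2) xZ by (simp_all add: Z_def)
        then show ?thesis using yp[OF j(1)] yp[OF j(2)] k[OF j(1)] k[OF j(2)] eq(2) by (simp add: step_def)
      qed
    qed
    then show False using y(4) by auto
  qed
  then show "x \<in> (\<Union>p\<in>{p \<in> P. (p, q) \<in> r}. X p)" using p by auto
qed

text \<open>For \<open>p\<close> in \<open>L\<close> a path ending in label \<open>p\<close> starts
  at a label at or below \<open>p\<close>, and \<open>root\<close> permits finitely many starting
  nodes for each of these. For \<open>p\<close> outside \<open>L\<close> every \<open>(p, i)\<close>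
  is a root, which no member of \<open>B\<close> can cover.\<close>

lemma path_L: "po_L T = {p \<in> P. \<exists>b\<in>B. X p \<subseteq> b}"
proof (intro equalityI subsetI)
  fix p assume p: "p \<in> po_L T"
  define F where "F = {q \<in> P. q = p \<or> (q, p) \<in> r}"
  define b where "b = {x \<in> Z. fst (x 0) \<in> F}"
  have FL: "F \<subseteq> po_L T" using p L_lower by (auto simp: F_def)
  have "det 0 b" by (auto simp: det_def b_def agree_def)
  moreover have "finite ((\<lambda>x. x 0) ` b)"
  proof (rule finite_subset)
    show "(\<lambda>x. x 0) ` b \<subseteq> (SIGMA q:F. {..po_f T q})"
    proof
      fix u assume "u \<in> (\<lambda>x. x 0) ` b"
      then obtain x where x: "x \<in> Z" "fst (x 0) \<in> F" "u = x 0" by (auto simp: b_def)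
      then have "root u" by (simp add: Z_def)
      then have "snd u \<le> po_f T (fst u)" using x FL by (auto simp: root_def split: if_splits)
      then have "(fst u, snd u) \<in> (SIGMA q:F. {..po_f T q})" using x by (intro SigmaI) simp_all
      then show "u \<in> (SIGMA q:F. {..po_f T q})" by simp
    qed
    show "finite (SIGMA q:F. {..po_f T q})" using fin by (intro finite_SigmaI) (simp_all add: F_def)
  qed
  ultimately have "b \<in> B" by (auto simp: B_def b_def)
  moreover have "X p \<subseteq> b"
  proof
    fix x assume x: "x \<in> X p"
    then obtain k where k: "fst (x k) = p" and xZ: "x \<in> Z" by (auto simp: X_def)
    show "x \<in> b" using label_mono[OF xZ, of 0 k] label_P[OF xZ, of 0] k xZ by (auto simp: b_def F_def)
  qed
  ultimately show "p \<in> {p \<in> P. \<exists>b\<in>B. X p \<subseteq> b}" using p L_sub by auto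
next
  fix p assume "p \<in> {p \<in> P. \<exists>b\<in>B. X p \<subseteq> b}"
  then obtain b where p: "p \<in> P" and b: "b \<in> B" "X p \<subseteq> b" by auto
  show "p \<in> po_L T"
  proof (rule ccontr)
    assume "p \<notin> po_L T"
    then have rt: "root (p, i)" for i using p by (simp add: root_def)
    have "(\<lambda>j. if j = 0 then (p, i) else (p, 0)) \<in> b" for i
      by (rule subsetD[OF b(2)]) (rule const_X[OF rt[of i], unfolded fst_conv])
    then have "(\<lambda>x. x 0) (\<lambda>j::nat. if j = 0 then (p, i) else (p, 0)) \<in> (\<lambda>x. x 0) ` b" for i :: nat
      by (rule imageI)
    then have "range (\<lambda>i::nat. (p, i)) \<subseteq> (\<lambda>x. x 0) ` b" by auto
    moreover have "finite ((\<lambda>x. x 0) ` b)" using b(1) by (simp add: B_def)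
    ultimately have "finite (range (\<lambda>i::nat. (p, i)))" by (rule finite_subset)
    moreover have "inj (\<lambda>i::nat. (p, i))" by (simp add: inj_on_def)
    ultimately show False using finite_imageD by blast
  qed
qed

text \<open>Nothing lies below an irreflexive label, so such a path carries one label throughout and
  is determined by its root, for which there are \<open>po_f T p\<close> choices.\<close>

lemma path_card:
  assumes "p \<in> L_min_d T" shows "finite (X p)" "card (X p) = po_f T p"
proof -
  have p: "p \<in> P" "(p, p) \<notin> r" using assms by (simp_all add: L_min_d_def discrete_part_def)
  define c where "c i = (\<lambda>j::nat. if j = 0 then (p, i) else (p, 0 :: nat))" for i
  have "X p = c ` {..<po_f T p}"
  proof (intro equalityI subsetI)
    fix x assume x: "x \<in> X p"
    then obtain k where k: "\<And>j. j \<ge> k \<Longrightarrow> fst (x j) = p" and xZ: "x \<in> Z" by (auto simp: X_def)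
    have lab: "fst (x j) = p" for j
      using label_mono[OF xZ, of j "max j k"] k[of "max j k"] discrete(4)[OF p] by auto
    have "root (x 0)" using xZ by (simp add: Z_def)
    then have i: "snd (x 0) < po_f T p" using lab[of 0] discrete(2)[OF p] p by (simp add: root_def)
    have "x j = c (snd (x 0)) j" for j
    proof (cases j)
      case 0
      then show ?thesis using lab[of 0] by (simp add: c_def prod_eq_iff)
    next
      case (Suc l)
      have "step (x l) (x (Suc l))" using xZ by (simp add: Z_def)
      then show ?thesis using Suc lab[of l] lab[of "Suc l"] p by (simp add: step_def c_def)
    qed
    then have "x = c (snd (x 0))" by (rule ext)
    then show "x \<in> c ` {..<po_f T p}" by (rule image_eqI) (simp add: i)
  next
    fix x assume "x \<in> c ` {..<po_f T p}"
    then obtain i where i: "i < po_f T p" "x = c i" by auto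
    have "root (p, i)" using i p by (simp add: root_def)
    then show "x \<in> X p" unfolding i(2) c_def by (rule const_X[of "(p, i)", unfolded fst_conv])
  qed
  moreover have "inj_on c {..<po_f T p}"
  proof (rule inj_onI)
    fix i j assume "c i = c j"
    then have "c i 0 = c j 0" by simp
    then show "i = j" by (simp add: c_def)
  qed
  ultimately show "finite (X p)" "card (X p) = po_f T p" by (simp_all add: card_image)
qed

lemma path_sreal: "sreal Z B T X"
  unfolding sreal_def
proof (intro conjI ballI)
  show "X p \<noteq> {}" if p: "p \<in> P" for p
  proof -
    have "root (p, 0)" using p discrete(3)[OF p] by (auto simp: root_def)
    from const_X[OF this] show ?thesis by auto
  qed
  show "disjoint_family_on X P" using X_unique by (auto simp: disjoint_family_on_def)
  show "(\<Union>p\<in>P. X p) = Z" using X_cover by (auto simp: X_def)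
  show "sderived Z B (X p) = (\<Union>q\<in>{q \<in> P. (q, p) \<in> r}. X q)" if "p \<in> P" for p
    by (rule path_derived[OF that])
  show "po_L T = {p \<in> P. \<exists>b\<in>B. X p \<subseteq> b}" by (rule path_L)
  show "finite (X p)" "card (X p) = po_f T p" if "p \<in> L_min_d T" for p
    using path_card[OF that] by simp_all
qed

text \<open>A member of \<open>B\<close> is determined by a depth and the finite set of initial
  segments of that length.\<close>

lemma countable_B: "countable B"
proof -
  let ?S = "{A. finite A \<and> A \<subseteq> lists (P \<times> (UNIV :: nat set))}"
  have "countable (P \<times> (UNIV :: nat set))" 
    by (rule countable_SIGMA) (simp_all add: countable_finite fin)
  then have "countable ?S" by (intro countable_Collect_finite_subset countable_lists)
  then have "countable ((\<lambda>(k, A). {z \<in> Z. map z [0..<Suc k] \<in> A}) ` (UNIV \<times> ?S))"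
    by (intro countable_image countable_SIGMA) auto
  moreover have "B \<subseteq> (\<lambda>(k, A). {z \<in> Z. map z [0..<Suc k] \<in> A}) ` (UNIV \<times> ?S)"
  proof
    fix b assume b: "b \<in> B"
    then obtain k where k: "det k b" and bZ: "b \<subseteq> Z" by (auto simp: B_def)
    let ?A = "(\<lambda>x. map x [0..<Suc k]) ` b"
    have "b = {z \<in> Z. map z [0..<Suc k] \<in> ?A}"
    proof (intro equalityI subsetI)
      fix z assume "z \<in> {z \<in> Z. map z [0..<Suc k] \<in> ?A}"
      then obtain x where "z \<in> Z" "x \<in> b" "map x [0..<Suc k] = map z [0..<Suc k]" by auto
      then show "z \<in> b" using detD[OF k] unfolding agree_map[symmetric] by simp
    qed (use bZ in auto)
    moreover have "?A \<in> ?S"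
    proof -
      have "map x [0..<Suc k] \<in> lists (P \<times> UNIV)" if "x \<in> b" for x
      proof -
        have "x \<in> Z" using bZ that by auto
        then have "x i \<in> P \<times> UNIV" for i using label_P[of x i] by (simp add: mem_Times_iff)
        then show ?thesis by (simp only: in_lists_conv_set set_map ball_simps) simp
      qed
      then have "?A \<subseteq> lists (P \<times> UNIV)" by (rule image_subsetI)
      then show ?thesis using B_lists[OF b, of k] by blast
    qed
    ultimately show "b \<in> (\<lambda>(k, A). {z \<in> Z. map z [0..<Suc k] \<in> A}) ` (UNIV \<times> ?S)"
      by (intro image_eqI[of _ _ "(k, ?A)"]) simp_all
  qed
  ultimately show ?thesis by (rule countable_subset[rotated])
qed

definition path_system :: "(nat \<Rightarrow> 'p \<times> nat) set bsystem" where
  "path_system = \<lparr>sys_carrier = B, sys_add = (\<lambda>a b. (a - b) \<union> (b - a)), sys_mult = (\<lambda>a b. a \<inter> b),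
     sys_zero = {}, sys_preds = map (\<lambda>Q. {b \<in> B. b \<inter> (\<Union>p\<in>Q. X p) = {}}) (po_Qs T)\<rparr>"

lemma path_represented: "represented_on n path_system T Z id X"
proof -
  interpret boolean_space Z B by (rule path_boolean_space)
  have "is_structure n path_system"
    using T B_empty B_Un B_Diff B_Int by (auto simp: is_structure_def path_system_def po_tuples_def)
  then show ?thesis
    unfolding represented_on_def using T path_boolean_space path_sreal
    by (simp add: path_system_def po_tuples_def)
qed

end

text \<open>The ring of compact open sets of paths is countable, so it has a copy on a subset of any
  infinite type.\<close>

theorem represents_exists:
  fixes T :: "'p potuple"
  assumes "infinite (UNIV :: 'a set)" "T \<in> po_tuples n"
  shows "\<exists>M :: 'a bsystem. M \<in> omega_categorical_systems n \<and> represents T M"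
proof -
  interpret path_space n T using assms(2) by unfold_locales
  obtain f :: "nat \<Rightarrow> 'a" where f: "inj f" using infinite_countable_subset[OF assms(1)] by auto
  let ?g = "f \<circ> to_nat_on B"
  let ?M = "transport ?g path_system"
  have car: "sys_carrier path_system = B" by (simp add: path_system_def)
  have st: "is_structure n path_system" using path_represented by (simp add: represented_on_def)
  have "inj_on ?g B"
    by (intro comp_inj_on inj_on_to_nat_on countable_B inj_on_subset[OF f]) simp
  then have iso: "system_iso path_system ?M ?g" using system_iso_transport[of ?g path_system] car by simp
  have rp: "represented_on n ?M T Z (id \<circ> inv_into (sys_carrier path_system) ?g) X"
    by (rule represented_on_iso[OF path_represented system_iso_inv[OF iso st] system_iso_structure[OF iso st]])
  interpret R: rep_system n ?M T Z "id \<circ> inv_into (sys_carrier path_system) ?g" X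
    using rp by unfold_locales
  have "countable (sys_carrier ?M)" using countable_B by (simp add: transport_def car)
  then show ?thesis using R.rep_omega_system R.rep_represents by (intro exI[of _ ?M]) simp
qed

section \<open>The tuple of a countably categorical system\<close>

locale oc_system = bring M for M :: "'a bsystem" +
  fixes n :: nat
  assumes oms: "M \<in> omega_categorical_systems n"

sublocale oc_system \<subseteq> bs: boolean_space "stone_points M" "D ` sys_carrier M"
  by (rule stone_boolean_space)

context oc_system
begin

abbreviation der where "der \<equiv> sderived S (D ` R)"

lemma st: "is_structure n M" and co: "countable R"
  and idl: "J \<in> set (sys_preds M) \<Longrightarrow> ring_ideal M J" and oc: "omega_categorical n M"
  using oms by (simp_all add: omega_categorical_systems_def)

lemma len: "length (sys_preds M) = n"
  using st by (simp add: is_structure_def)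

definition DS where "DS = definable_sets n M"

lemma fin_DS: "finite DS"
  unfolding DS_def by (rule finite_definable_sets[OF oc st co])

lemma DS_I: "definable n M (\<lambda>e. \<phi> (e 0)) \<Longrightarrow> {a \<in> R. \<phi> a} \<in> DS"
  unfolding DS_def definable_sets_def
  by (simp, erule definable_cong) (auto simp: envs_def)

lemma DS_sub: "A \<in> DS \<Longrightarrow> A \<subseteq> R"
  by (simp add: DS_def definable_sets_def)

lemma DS_R: "R \<in> DS"
  unfolding DS_def by (rule definable_sets_UNIV)

lemma DS_Diff: "A \<in> DS \<Longrightarrow> B \<in> DS \<Longrightarrow> A - B \<in> DS"
  unfolding DS_def by (rule definable_sets_Diff)

lemma DS_Int: assumes "A \<in> DS" "B \<in> DS" shows "A \<inter> B \<in> DS"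
proof -
  have "A - (A - B) \<in> DS" by (intro DS_Diff assms)
  then show ?thesis by (simp add: Diff_Diff_Int)
qed

lemma DS_INT: "finite F \<Longrightarrow> (\<And>i. i \<in> F \<Longrightarrow> A i \<in> DS) \<Longrightarrow> {a \<in> R. \<forall>i\<in>F. a \<in> A i} \<in> DS"
proof (induction F rule: finite_induct)
  case empty
  then show ?case using DS_R by simp
next
  case (insert i F)
  have "{a \<in> R. \<forall>j\<in>insert i F. a \<in> A j} = A i \<inter> {a \<in> R. \<forall>j\<in>F. a \<in> A j}"
    using DS_sub[OF insert.prems[of i]] by auto
  then show ?case using DS_Int[of "A i"] insert by simp
qed

lemma def_mem: "A \<in> DS \<Longrightarrow> definable n M (\<lambda>e. e v \<in> A)"
  unfolding DS_def by (rule definable_mem)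

text \<open>The value of the term is named by an auxiliary variable \<open>v\<close>, because
  membership in a definable set is available for variables.\<close>

lemma def_term:
  assumes A: "A \<in> DS" and v: "v \<notin> term_vars t"
  shows "definable n M (\<lambda>e. term_val M e t \<in> A)"
proof -
  have tR: "term_val M e t \<in> R" if "e \<in> envs M" for e
    by (induction t) (use that in \<open>auto simp: envs_def\<close>)
  have tv: "term_val M (e(v := x)) t = term_val M e t" for e x
    by (rule term_val_cong) (use v in auto)
  have "definable n M (\<lambda>e. \<exists>x\<in>R. term_val M (e(v := x)) (Var v) = term_val M (e(v := x)) t \<and> (e(v := x)) v \<in> A)"
    by (rule definable_ex[of n M "\<lambda>e. term_val M e (Var v) = term_val M e t \<and> e v \<in> A"])
      (intro definable_conj definable_eq def_mem A)
  then show ?thesis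
    by (rule definable_cong) (use tR DS_sub[OF A] in \<open>auto simp: tv\<close>)
qed

lemma pred_DS: assumes "i < n" shows "sys_preds M ! i \<in> DS"
proof -
  have s: "sys_preds M ! i \<subseteq> R" using st assms by (auto simp: is_structure_def)
  have "{a \<in> R. a \<in> sys_preds M ! i} \<in> DS"
    by (rule DS_I, rule definable_cong[OF definable_pred[OF assms, of M "Var 0"]]) simp
  moreover have "{a \<in> R. a \<in> sys_preds M ! i} = sys_preds M ! i" using s by auto
  ultimately show ?thesis by simp
qed

section \<open>Closed sets with definable ideals\<close>

lemma closed_nbhd:
  assumes "sclosed S (D ` R) H" "x \<in> S" "x \<notin> H"
  shows "\<exists>b\<in>R. x \<in> D b \<and> D b \<inter> H = {}"
proof -
  have "x \<in> S - H" using assms by simp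
  then have "\<exists>b\<in>D ` R. x \<in> b \<and> b \<inter> H = {}" using assms(1) unfolding sclosed_def by blast
  then show ?thesis by simp
qed

text \<open>The ideal belonging to the closure of \<open>A\<close>, also for sets \<open>A\<close>
  that are not closed. A set of points counts as accessible to formulas when this ideal is
  definable.\<close>

definition K where "K A = {a \<in> R. D a \<inter> A = {}}"

lemma K_ideal: "ring_ideal M (K A)"
  unfolding ideal_iff K_def by auto

lemma K_closed: assumes "sclosed S (D ` R) H" shows "closed_set_of_ideal M (K H) = H"
proof (intro equalityI subsetI)
  fix x assume x: "x \<in> closed_set_of_ideal M (K H)"
  then have xS: "x \<in> S" "K H \<subseteq> x" by (simp_all add: closed_set_of_ideal_def)
  show "x \<in> H"
  proof (rule ccontr)
    assume xH: "x \<notin> H"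
    obtain b where b: "b \<in> R" "x \<in> D b" "D b \<inter> H = {}"
      using closed_nbhd[OF assms xS(1) xH] by (elim bexE conjE)
    then have "b \<in> K H" by (simp add: K_def)
    then show False using xS(2) b(2) by (auto simp: D_def)
  qed
next
  fix x assume x: "x \<in> H"
  then have "x \<in> S" using assms by (auto simp: sclosed_def)
  moreover have "a \<in> x" if "a \<in> K H" for a using that x \<open>x \<in> S\<close> by (auto simp: K_def D_def)
  ultimately show "x \<in> closed_set_of_ideal M (K H)" by (auto simp: closed_set_of_ideal_def)
qed

lemma closed_set_sclosed:
  assumes J: "ring_ideal M J" shows "sclosed S (D ` R) (closed_set_of_ideal M J)"
  unfolding sclosed_def
proof (intro conjI ballI)
  show "closed_set_of_ideal M J \<subseteq> S" by (auto simp: closed_set_of_ideal_def)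
  fix x assume "x \<in> S - closed_set_of_ideal M J"
  then obtain a where a: "x \<in> S" "a \<in> J" "a \<notin> x" by (auto simp: closed_set_of_ideal_def)
  show "\<exists>b\<in>D ` R. x \<in> b \<and> b \<inter> closed_set_of_ideal M J = {}"
    by (rule bexI[of _ "D a"]) (use a ideal_sub[OF J] in \<open>auto simp: D_def closed_set_of_ideal_def\<close>)
qed

definition CC where "CC = {closed_set_of_ideal M J |J. J \<in> DS \<and> ring_ideal M J}"

lemma fin_CC: "finite CC"
proof -
  have "CC \<subseteq> closed_set_of_ideal M ` DS" by (auto simp: CC_def)
  then show ?thesis using fin_DS finite_subset by blast
qed

lemma CC_sclosed: "C \<in> CC \<Longrightarrow> sclosed S (D ` R) C"
  using closed_set_sclosed by (auto simp: CC_def)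

lemma K_DS_CC: "sclosed S (D ` R) H \<Longrightarrow> K H \<in> DS \<Longrightarrow> H \<in> CC"
  unfolding CC_def using K_closed[of H] K_ideal[of H] by auto

text \<open>The complement of \<open>C\<close> is the union of the sets of the elements of
  \<open>J\<close>, so missing \<open>A - C\<close> means that all products with elements of
  \<open>J\<close> miss \<open>A\<close>.\<close>

lemma K_minus:
  assumes A: "A \<subseteq> S" "K A \<in> DS" and C: "C \<in> CC"
  shows "K (A - C) \<in> DS"
proof -
  obtain J where J: "J \<in> DS" "ring_ideal M J" "C = closed_set_of_ideal M J" using C by (auto simp: CC_def)
  have "K (A - C) = {a \<in> R. \<forall>b\<in>R. b \<in> J \<longrightarrow> a \<odot> b \<in> K A}"
  proof (intro equalityI subsetI)
    fix a assume a: "a \<in> K (A - C)"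
    have "a \<odot> b \<in> K A" if b: "b \<in> J" "b \<in> R" for b
      using a b D_closed_set[OF J(2) b(2)] J(3) by (auto simp: K_def)
    then show "a \<in> {a \<in> R. \<forall>b\<in>R. b \<in> J \<longrightarrow> a \<odot> b \<in> K A}" using a by (simp add: K_def)
  next
    fix a assume "a \<in> {a \<in> R. \<forall>b\<in>R. b \<in> J \<longrightarrow> a \<odot> b \<in> K A}"
    then have a: "a \<in> R" "\<And>b. b \<in> R \<Longrightarrow> b \<in> J \<Longrightarrow> a \<odot> b \<in> K A" by simp_all
    have "x \<notin> D a \<inter> (A - C)" for x
    proof
      assume x: "x \<in> D a \<inter> (A - C)"
      then have "x \<in> S" using A(1) by auto
      then obtain b where b: "b \<in> J" "b \<notin> x" using x J(3) by (auto simp: closed_set_of_ideal_def)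
      have bR: "b \<in> R" by (rule ideal_sub[OF J(2) b(1)])
      have "x \<in> D b" using b \<open>x \<in> S\<close> by (simp add: D_def)
      then show False using a(2)[OF bR b(1)] a(1) bR x by (auto simp: K_def)
    qed
    then show "a \<in> K (A - C)" using a(1) unfolding K_def by auto
  qed
  moreover have "{a \<in> R. \<forall>b\<in>R. b \<in> J \<longrightarrow> a \<odot> b \<in> K A} \<in> DS"
  proof (rule DS_I, rule definable_cong)
    show "definable n M (\<lambda>e. \<forall>b\<in>R. (e(1 := b)) 1 \<in> J \<longrightarrow> term_val M (e(1 := b)) (Mult (Var 0) (Var 1)) \<in> K A)"
      by (rule definable_all[of n M "\<lambda>e. e 1 \<in> J \<longrightarrow> term_val M e (Mult (Var 0) (Var 1)) \<in> K A"],
          rule definable_imp[OF def_mem[OF J(1)] def_term[OF A(2), of 2]]) simp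
  qed simp
  ultimately show ?thesis by simp
qed

text \<open>If \<open>D a\<close> misses \<open>A \<inter> C\<close>, then
  \<open>A \<inter> D a\<close> is a compact set disjoint from \<open>C\<close>, so one element
  \<open>b\<close> of \<open>J\<close> covers it. Closedness of \<open>A\<close> provides this
  compactness and makes the condition existential.\<close>

lemma K_inter:
  assumes A: "sclosed S (D ` R) A" "K A \<in> DS" and C: "C \<in> CC"
  shows "K (A \<inter> C) \<in> DS"
proof -
  obtain J where J: "J \<in> DS" "ring_ideal M J" "C = closed_set_of_ideal M J" using C by (auto simp: CC_def)
  have "K (A \<inter> C) = {a \<in> R. \<exists>b\<in>R. b \<in> J \<and> a \<oplus> a \<odot> b \<in> K A}"
  proof (intro equalityI subsetI)
    fix a assume a: "a \<in> K (A \<inter> C)"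
    then have aR: "a \<in> R" and dis: "D a \<inter> (A \<inter> C) = {}" by (simp_all add: K_def)
    have "\<exists>s\<in>D ` R. A \<inter> D a \<subseteq> s \<and> s \<subseteq> S - C"
    proof (rule bs.B_separate[OF bs.sclosed_Int[OF A(1) bs.clopen_sclosed]])
      show "D a \<in> D ` R \<or> D a \<subseteq> S \<and> S - D a \<in> D ` R" "D a \<in> D ` R" using aR by auto
      show "A \<inter> D a \<subseteq> D a" by simp
      fix x assume "x \<in> A \<inter> D a"
      then have xA: "x \<in> A" "x \<in> D a" by simp_all
      have xC: "x \<in> S" using xA(2) by (simp add: D_def)
      have xC': "x \<notin> C" using xA dis by blast
      obtain b where b: "b \<in> R" "x \<in> D b" "D b \<inter> C = {}"
        using closed_nbhd[OF CC_sclosed[OF C] xC xC'] by (elim bexE conjE)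
      have "D b \<subseteq> S" by (auto simp: D_def)
      then have "D b \<subseteq> S - C" using b(3) by blast
      then show "\<exists>b\<in>D ` R. x \<in> b \<and> b \<subseteq> S - C" using b(1,2) by blast
    qed
    then obtain b where b: "b \<in> R" "A \<inter> D a \<subseteq> D b" "D b \<subseteq> S - C" by auto
    have "b \<in> J" using D_closed_set[OF J(2) b(1)] b(3) J(3) by auto
    moreover have "a \<oplus> a \<odot> b \<in> K A" using aR b by (auto simp: K_def)
    ultimately show "a \<in> {a \<in> R. \<exists>b\<in>R. b \<in> J \<and> a \<oplus> a \<odot> b \<in> K A}" using aR b(1) by auto
  next
    fix a assume "a \<in> {a \<in> R. \<exists>b\<in>R. b \<in> J \<and> a \<oplus> a \<odot> b \<in> K A}"
    then obtain b where b: "a \<in> R" "b \<in> R" "b \<in> J" "a \<oplus> a \<odot> b \<in> K A" by auto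
    have "D b \<inter> C = {}" using D_closed_set[OF J(2) b(2)] b(3) J(3) by simp
    then show "a \<in> K (A \<inter> C)" using b by (auto simp: K_def)
  qed
  moreover have "{a \<in> R. \<exists>b\<in>R. b \<in> J \<and> a \<oplus> a \<odot> b \<in> K A} \<in> DS"
  proof (rule DS_I, rule definable_cong)
    show "definable n M (\<lambda>e. \<exists>b\<in>R. (e(1 := b)) 1 \<in> J \<and>
        term_val M (e(1 := b)) (Add (Var 0) (Mult (Var 0) (Var 1))) \<in> K A)"
      by (rule definable_ex[of n M "\<lambda>e. e 1 \<in> J \<and> term_val M e (Add (Var 0) (Mult (Var 0) (Var 1))) \<in> K A"],
          rule definable_conj[OF def_mem[OF J(1)] def_term[OF A(2), of 2]]) simp
  qed simp
  ultimately show ?thesis by simp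
qed

definition sig where "sig x = {C \<in> CC. x \<in> C}"

text \<open>\<open>CC\<close> is finite, so the saturated sets are the Boolean combinations, within
  the Stone space, of its members.\<close>

definition Sat where "Sat A \<longleftrightarrow> A \<subseteq> S \<and> (\<forall>x\<in>A. \<forall>y\<in>S. sig x = sig y \<longrightarrow> y \<in> A)"

lemma fin_Sat: "finite {A. Sat A}"
proof (rule finite_subset)
  show "{A. Sat A} \<subseteq> (\<lambda>F. {x \<in> S. sig x \<in> F}) ` Pow (Pow CC)"
  proof
    fix A assume "A \<in> {A. Sat A}"
    then have A: "A \<subseteq> S" "\<And>x y. x \<in> A \<Longrightarrow> y \<in> S \<Longrightarrow> sig x = sig y \<Longrightarrow> y \<in> A" by (simp_all add: Sat_def)
    have "A = {x \<in> S. sig x \<in> sig ` A}"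
    proof (intro equalityI subsetI)
      fix y assume "y \<in> {x \<in> S. sig x \<in> sig ` A}"
      then obtain x where "y \<in> S" "x \<in> A" "sig x = sig y" by auto
      then show "y \<in> A" using A(2) by simp
    qed (use A(1) in auto)
    moreover have "sig ` A \<in> Pow (Pow CC)" by (auto simp: sig_def)
    ultimately show "A \<in> (\<lambda>F. {x \<in> S. sig x \<in> F}) ` Pow (Pow CC)" by (rule image_eqI)
  qed
  show "finite ((\<lambda>F. {x \<in> S. sig x \<in> F}) ` Pow (Pow CC))" using fin_CC by simp
qed

lemma CC_Sat: "C \<in> CC \<Longrightarrow> Sat C"
  using CC_sclosed[of C] unfolding Sat_def sclosed_def sig_def by blast

text \<open>A signature class is an intersection of members of \<open>CC\<close> from which the
  remaining members are removed. Intersections come first, since \<open>K_inter\<close> asks for a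
  closed set and \<open>K_minus\<close> does not.\<close>

lemma K_class:
  assumes "F \<subseteq> CC" shows "K {x \<in> S. sig x = F} \<in> DS"
proof -
  have KS: "K S \<in> DS"
  proof -
    have "K S = {a \<in> R. a = \<zero>}"
    proof (intro equalityI subsetI)
      fix a assume a: "a \<in> K S"
      then have aR: "a \<in> R" "D a \<inter> S = {}" by (simp_all add: K_def)
      moreover have "D a \<subseteq> S" by (auto simp: D_def)
      ultimately have "a \<in> R" "D a = D \<zero>" by auto
      then show "a \<in> {a \<in> R. a = \<zero>}" using inj_onD[OF D_inj, of a \<zero>] by simp
    qed (auto simp: K_def)
    moreover have "{a \<in> R. a = \<zero>} \<in> DS"
      by (rule DS_I, rule definable_cong[OF definable_eq[of n M "Var 0" Zero]]) simp
    ultimately show ?thesis by simp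
  qed
  have SC: "sclosed S (D ` R) S" unfolding sclosed_def by simp
  have 1: "sclosed S (D ` R) (S \<inter> \<Inter>G) \<and> K (S \<inter> \<Inter>G) \<in> DS" if "finite G" "G \<subseteq> CC" for G
    using that
  proof (induction G rule: finite_induct)
    case empty
    then show ?case using KS SC by simp
  next
    case (insert C G)
    have "S \<inter> \<Inter>(insert C G) = (S \<inter> \<Inter>G) \<inter> C" by auto
    then show ?case using insert bs.sclosed_Int[OF _ CC_sclosed[of C]] K_inter[of "S \<inter> \<Inter>G" C] by simp
  qed
  have 2: "K (A - \<Union>G) \<in> DS" if "finite G" "G \<subseteq> CC" "A \<subseteq> S" "K A \<in> DS" for A G
    using that(1,2)
  proof (induction G rule: finite_induct)
    case empty
    then show ?case using that(4) by simp
  next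
    case (insert C G)
    have "A - \<Union>(insert C G) = (A - \<Union>G) - C" by auto
    moreover have "A - \<Union>G \<subseteq> S" using that(3) by auto
    ultimately show ?case using insert K_minus[of "A - \<Union>G" C] by simp
  qed
  have f: "finite F" "finite (CC - F)" using fin_CC assms finite_subset by auto
  have "{x \<in> S. sig x = F} = (S \<inter> \<Inter>F) - \<Union>(CC - F)" using assms by (auto simp: sig_def)
  then show ?thesis using 2[OF f(2), of "S \<inter> \<Inter>F"] 1[OF f(1) assms] by simp
qed

lemma K_Sat: assumes A: "Sat A" shows "K A \<in> DS"
proof -
  have "finite (Pow CC)" using fin_CC by simp
  moreover have "sig ` A \<subseteq> Pow CC" by (auto simp: sig_def)
  ultimately have f: "finite (sig ` A)" by (rule finite_subset[rotated])
  have "{a \<in> R. \<forall>F\<in>sig ` A. a \<in> K {x \<in> S. sig x = F}} \<in> DS"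
    by (rule DS_INT[OF f], rule K_class) (auto simp: sig_def)
  moreover have "K A = {a \<in> R. \<forall>F\<in>sig ` A. a \<in> K {x \<in> S. sig x = F}}"
  proof (intro equalityI subsetI)
    fix a assume a: "a \<in> K A"
    then show "a \<in> {a \<in> R. \<forall>F\<in>sig ` A. a \<in> K {x \<in> S. sig x = F}}"
      using A by (auto simp: K_def Sat_def)
  next
    fix a assume a: "a \<in> {a \<in> R. \<forall>F\<in>sig ` A. a \<in> K {x \<in> S. sig x = F}}"
    have "x \<notin> D a" if x: "x \<in> A" for x
    proof -
      have "a \<in> K {y \<in> S. sig y = sig x}" using a x by auto
      moreover have "x \<in> S" using A x by (auto simp: Sat_def)
      ultimately show ?thesis by (auto simp: K_def)
    qed
    then show "a \<in> K A" using a by (auto simp: K_def)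
  qed
  ultimately show ?thesis by simp
qed

section \<open>Counting points inside compact open sets\<close>

definition N where "N A m = {a \<in> R. \<exists>F. F \<subseteq> D a \<inter> A \<and> finite F \<and> card F = m}" for A and m :: nat

text \<open>At least \<open>m + 1\<close> points means: some \<open>b\<close> below \<open>a\<close>
  keeps \<open>m\<close> of them, and a further one lies in the rest \<open>a + b\<close>. In this
  form the condition is first-order in \<open>m\<close>-step recursion.\<close>

lemma N_Suc:
  assumes A: "A \<subseteq> S"
  shows "N A (Suc m) = {a \<in> R. \<exists>b\<in>R. a \<odot> b = b \<and> a \<oplus> b \<notin> K A \<and> b \<in> N A m}"
proof (intro equalityI subsetI)
  fix a assume "a \<in> N A (Suc m)"
  then obtain F where F: "a \<in> R" "F \<subseteq> D a \<inter> A" "finite F" "card F = Suc m" by (auto simp: N_def)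
  then obtain x where x: "x \<in> F" by fastforce
  have "\<exists>c\<in>D ` R. x \<in> c \<and> c \<inter> (F - {x}) = {}"
    by (rule bs.B_avoid_finite) (use F x A in auto)
  then obtain c where c: "c \<in> R" "x \<in> D c" "D c \<inter> (F - {x}) = {}" by auto
  let ?b = "a \<oplus> a \<odot> c"
  have bR: "?b \<in> R" using F(1) c(1) by simp
  have Db: "D ?b = D a - D c" by (rule D_Diff[symmetric, OF F(1) c(1)])
  have "a \<odot> ?b = ?b" by (rule inj_onD[OF D_inj]) (use F(1) bR Db in auto)
  moreover have "a \<oplus> ?b \<notin> K A"
  proof -
    have "x \<in> D a" "x \<in> A" using x F(2) by auto
    moreover have "x \<notin> D ?b" unfolding Db using c(2) by simp
    ultimately have "x \<in> D (a \<oplus> ?b) \<inter> A" unfolding D_add[OF F(1) bR] by simp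
    then show ?thesis unfolding K_def by blast
  qed
  moreover have "?b \<in> N A m"
  proof -
    have "F - {x} \<subseteq> D ?b \<inter> A" unfolding Db using F(2) c(3) by blast
    moreover have "card (F - {x}) = m" using F(3,4) x by simp
    ultimately show ?thesis using bR F(3) unfolding N_def by blast
  qed
  ultimately show "a \<in> {a \<in> R. \<exists>b\<in>R. a \<odot> b = b \<and> a \<oplus> b \<notin> K A \<and> b \<in> N A m}"
    using F(1) bR by blast
next
  fix a assume "a \<in> {a \<in> R. \<exists>b\<in>R. a \<odot> b = b \<and> a \<oplus> b \<notin> K A \<and> b \<in> N A m}"
  then obtain b F where b: "a \<in> R" "b \<in> R" "a \<odot> b = b" "a \<oplus> b \<notin> K A" "F \<subseteq> D b \<inter> A" "finite F" "card F = m"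
    by (auto simp: N_def)
  have "D a \<inter> D b = D b" using D_mul[OF b(1,2)] b(3) by simp
  then have ba: "D b \<subseteq> D a" by auto
  have "D (a \<oplus> b) \<inter> A \<noteq> {}" using b(1,2,4) unfolding K_def by simp
  then obtain x where x: "x \<in> D a - D b" "x \<in> A" unfolding D_add[OF b(1,2)] using ba by blast
  have "insert x F \<subseteq> D a \<inter> A" using b(5) ba x by blast
  moreover have "x \<notin> F" using b(5) x(1) by blast
  then have "card (insert x F) = Suc m" using b(6,7) by simp
  moreover have "finite (insert x F)" using b(6) by simp
  ultimately show "a \<in> N A (Suc m)" using b(1) unfolding N_def by blast
qed

lemma N_DS: assumes "A \<subseteq> S" "K A \<in> DS" shows "N A m \<in> DS"
proof (induction m)
  case 0
  have "\<exists>F. F \<subseteq> D a \<inter> A \<and> finite F \<and> card F = 0" for a by (rule exI[of _ "{}"]) simp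
  then have "N A 0 = R" unfolding N_def by simp
  then show ?case using DS_R by simp
next
  case (Suc m)
  show ?case unfolding N_Suc[OF assms(1)]
  proof (rule DS_I, rule definable_cong)
    show "definable n M (\<lambda>e. \<exists>b\<in>R. term_val M (e(1 := b)) (Mult (Var 0) (Var 1)) = term_val M (e(1 := b)) (Var 1) \<and>
        \<not> term_val M (e(1 := b)) (Add (Var 0) (Var 1)) \<in> K A \<and> (e(1 := b)) 1 \<in> N A m)"
      by (rule definable_ex[of n M "\<lambda>e. term_val M e (Mult (Var 0) (Var 1)) = term_val M e (Var 1) \<and>
          \<not> term_val M e (Add (Var 0) (Var 1)) \<in> K A \<and> e 1 \<in> N A m"],
          intro definable_conj definable_eq definable_not def_term[OF assms(2), of 2] def_mem Suc.IH) simp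
  qed simp
qed

text \<open>There are finitely many definable sets, so the decreasing sequence repeats a value and
  is constant from there on. An element with the threshold number of points then has infinitely
  many.\<close>

lemma N_stable:
  assumes "A \<subseteq> S" "K A \<in> DS"
  shows "\<exists>i. \<forall>a\<in>R. a \<notin> N A i \<longleftrightarrow> finite (D a \<inter> A)"
proof -
  have anti: "N A (Suc m) \<subseteq> N A m" for m
  proof
    fix a assume "a \<in> N A (Suc m)"
    then obtain F where F: "a \<in> R" "F \<subseteq> D a \<inter> A" "finite F" "card F = Suc m" by (auto simp: N_def)
    obtain G where "G \<subseteq> F" "card G = m" "finite G"
      using obtain_subset_with_card_n[of m F] F(4) by auto
    then show "a \<in> N A m" using F unfolding N_def by auto
  qed
  have mono: "N A j \<subseteq> N A i" if "i \<le> j" for i j by (rule lift_Suc_antimono_le[of "N A", OF anti that])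
  have "finite (range (N A))" using N_DS[OF assms] fin_DS by (meson finite_subset image_subsetI)
  then have "\<not> inj (N A)" using finite_imageD infinite_UNIV_nat by blast
  then obtain i0 j0 where "N A i0 = N A j0" "i0 \<noteq> j0" by (auto simp: inj_on_def)
  then obtain i j where ij: "N A i = N A j" "i < j" by (metis linorder_neqE_nat)
  have eq: "N A i = N A (Suc i)" using mono[of "Suc i" j] anti[of i] ij by auto
  \<comment> \<open>Each term of the sequence is a fixed function of the preceding one, so a single
    repetition makes the rest constant.\<close>
  have all: "N A (i + k) = N A i" for k
  proof (induction k)
    case (Suc k)
    have "N A (i + Suc k) = N A (Suc i)"
      unfolding add_Suc_right N_Suc[OF assms(1)] Suc.IH ..
    then show ?case using eq by (rule trans[OF _ sym])
  qed simp
  show ?thesis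
  proof (intro exI[of _ i] ballI iffI)
    fix a assume a: "a \<in> R" "a \<notin> N A i"
    show "finite (D a \<inter> A)"
    proof (rule ccontr)
      assume "infinite (D a \<inter> A)"
      then obtain F where "F \<subseteq> D a \<inter> A" "finite F" "card F = i" using infinite_arbitrarily_large by metis
      then show False using a unfolding N_def by auto
    qed
  next
    fix a assume a: "a \<in> R" "finite (D a \<inter> A)"
    show "a \<notin> N A i"
    proof
      assume "a \<in> N A i"
      then have "a \<in> N A (i + Suc (card (D a \<inter> A)))" by (simp only: all)
      then obtain F where "F \<subseteq> D a \<inter> A" "card F = i + Suc (card (D a \<inter> A))" by (auto simp: N_def)
      then show False using card_mono[OF a(2), of F] by simp
    qed
  qed
qed

text \<open>A compact open set meets the derived set of \<open>A\<close> exactly when it contains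
  infinitely many points of \<open>A\<close>, and this is definable by the threshold.\<close>

lemma der_CC: assumes A: "Sat A" shows "der A \<in> CC"
proof -
  have AS: "A \<subseteq> S" using A by (simp add: Sat_def)
  obtain i where i: "\<forall>a\<in>R. a \<notin> N A i \<longleftrightarrow> finite (D a \<inter> A)" using N_stable[OF AS K_Sat[OF A]] by (elim exE)
  have "K (der A) = R - N A i"
  proof (intro equalityI subsetI)
    fix a assume a: "a \<in> K (der A)"
    then have aR: "a \<in> R" "D a \<inter> der A = {}" by (simp_all add: K_def)
    have "finite (A \<inter> D a)"
    proof (rule ccontr)
      assume "infinite (A \<inter> D a)"
      then obtain x where "x \<in> D a" "x \<in> der A" using bs.infinite_sderived[of "D a" A] aR(1) by auto
      then show False using aR(2) by auto
    qed
    moreover have "A \<inter> D a = D a \<inter> A" by (rule Int_commute)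
    ultimately show "a \<in> R - N A i" using i aR(1) by simp
  next
    fix a assume a: "a \<in> R - N A i"
    then have "a \<in> R" "finite (D a \<inter> A)" using i[rule_format, of a] by simp_all
    moreover have "D a \<inter> A = A \<inter> D a" by (rule Int_commute)
    ultimately have f: "a \<in> R" "finite (A \<inter> D a)" by simp_all
    have "x \<notin> der A" if "x \<in> D a" for x
      using bs.sderived_infinite[OF _ that _ AS] f by auto
    then show "a \<in> K (der A)" using f(1) by (auto simp: K_def)
  qed
  then have "K (der A) \<in> DS" using DS_Diff[OF DS_R N_DS[OF AS K_Sat[OF A]]] by simp
  then show ?thesis by (rule K_DS_CC[OF bs.sclosed_sderived[OF AS]])
qed

text \<open>In an infinite set without limit points of its own, as many points as the threshold
  demands could be enclosed in one compact open set meeting \<open>A\<close> finitely, which the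
  threshold excludes.\<close>

lemma discrete_finite:
  assumes A: "Sat A" and d: "A \<inter> der A = {}"
  shows "finite A"
proof (rule ccontr)
  assume inf: "infinite A"
  have AS: "A \<subseteq> S" using A by (simp add: Sat_def)
  obtain i where i: "\<forall>a\<in>R. a \<notin> N A i \<longleftrightarrow> finite (D a \<inter> A)" using N_stable[OF AS K_Sat[OF A]] by (elim exE)
  obtain F where F: "F \<subseteq> A" "finite F" "card F = i" using infinite_arbitrarily_large[OF inf] by metis
  have "\<exists>b. b \<in> D ` R \<and> x \<in> b \<and> finite (A \<inter> b)" if x: "x \<in> F" for x
  proof -
    have "x \<notin> der A" "x \<in> S" using x F(1) d AS by auto
    then obtain b where b: "b \<in> D ` R" "x \<in> b" "\<forall>y\<in>A \<inter> b. y = x" by (auto simp: sderived_def)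
    then have "A \<inter> b \<subseteq> {x}" by auto
    then have "finite (A \<inter> b)" by (rule finite_subset) simp
    then show ?thesis using b by auto
  qed
  then have "\<forall>x\<in>F. \<exists>b. b \<in> D ` R \<and> x \<in> b \<and> finite (A \<inter> b)" by simp
  from bchoice[OF this] obtain h where h: "\<forall>x\<in>F. h x \<in> D ` R \<and> x \<in> h x \<and> finite (A \<inter> h x)" by (elim exE)
  have "\<Union>(h ` F) \<in> D ` R" by (rule bs.B_UN) (use h F(2) in auto)
  then obtain a where a: "a \<in> R" "D a = \<Union>(h ` F)" by auto
  have Da: "D a \<inter> A = (\<Union>x\<in>F. A \<inter> h x)" using a(2) by auto
  have "finite (D a \<inter> A)" unfolding Da by (rule finite_UN_I[OF F(2)]) (use h in simp)
  moreover have "F \<subseteq> D a \<inter> A" using a(2) h F(1) by auto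
  then have "a \<in> N A i" using a(1) F(2,3) by (auto simp: N_def)
  ultimately show False using i[rule_format, OF a(1)] by blast
qed

section \<open>The algebra generated by the closed sets of the ideals, and its atoms\<close>

definition closed_fam where
  "closed_fam F \<longleftrightarrow> F \<subseteq> Pow S \<and> {} \<in> F \<and> (\<forall>A\<in>F. S - A \<in> F) \<and> (\<forall>A\<in>F. \<forall>B\<in>F. A \<union> B \<in> F) \<and>
     (\<forall>A\<in>F. der A \<in> F) \<and> (\<forall>J\<in>set (sys_preds M). closed_set_of_ideal M J \<in> F)"

definition AA where "AA = \<Inter>{F. closed_fam F}"

text \<open>This bounds the generated algebra by the finite family of saturated sets. Closure under
  derived sets is the essential point and rests on \<open>der_CC\<close>.\<close>

lemma Sat_closed_fam: "closed_fam {A. Sat A}"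
  unfolding closed_fam_def
proof (intro conjI ballI)
  show "{A. Sat A} \<subseteq> Pow S" by (auto simp: Sat_def)
  show "{} \<in> {A. Sat A}" by (simp add: Sat_def)
  show "S - A \<in> {A. Sat A}" if "A \<in> {A. Sat A}" for A
    using that unfolding Sat_def mem_Collect_eq by (metis DiffD1 DiffD2 DiffI Diff_subset)
  show "A \<union> B \<in> {A. Sat A}" if "A \<in> {A. Sat A}" "B \<in> {A. Sat A}" for A B
    using that by (auto simp: Sat_def)
  show "der A \<in> {A. Sat A}" if "A \<in> {A. Sat A}" for A using CC_Sat[OF der_CC] that by simp
  show "closed_set_of_ideal M J \<in> {A. Sat A}" if J: "J \<in> set (sys_preds M)" for J
  proof -
    obtain i where i: "i < n" "J = sys_preds M ! i" using J len by (auto simp: in_set_conv_nth)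
    have "closed_set_of_ideal M J \<in> CC" unfolding CC_def using pred_DS[OF i(1)] idl[OF J] i(2) by auto
    then show ?thesis using CC_Sat by simp
  qed
qed

lemma AA_min: "closed_fam F \<Longrightarrow> AA \<subseteq> F"
  by (auto simp: AA_def)

lemma AA_Sat: "A \<in> AA \<Longrightarrow> Sat A"
  using AA_min[OF Sat_closed_fam] by auto

lemma fin_AA: "finite AA"
  using AA_min[OF Sat_closed_fam] fin_Sat by (rule finite_subset)

lemma closed_famD:
  assumes "closed_fam F"
  shows "F \<subseteq> Pow S" "{} \<in> F" "A \<in> F \<Longrightarrow> S - A \<in> F" "A \<in> F \<Longrightarrow> C \<in> F \<Longrightarrow> A \<union> C \<in> F"
    "A \<in> F \<Longrightarrow> der A \<in> F" "J \<in> set (sys_preds M) \<Longrightarrow> closed_set_of_ideal M J \<in> F"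
  using assms unfolding closed_fam_def by simp_all

lemma AA_I: "(\<And>F. closed_fam F \<Longrightarrow> A \<in> F) \<Longrightarrow> A \<in> AA"
  unfolding AA_def by (rule InterI) simp

lemma AA_D: "A \<in> AA \<Longrightarrow> closed_fam F \<Longrightarrow> A \<in> F"
  using AA_min by (rule subsetD)

lemma AA_sub: "A \<in> AA \<Longrightarrow> A \<subseteq> S"
  using AA_Sat by (simp add: Sat_def)

lemma AA_empty: "{} \<in> AA"
  by (rule AA_I, rule closed_famD)

lemma AA_compl: "A \<in> AA \<Longrightarrow> S - A \<in> AA"
  by (rule AA_I, rule closed_famD(3), assumption, rule AA_D)

lemma AA_Un: "A \<in> AA \<Longrightarrow> C \<in> AA \<Longrightarrow> A \<union> C \<in> AA"
  by (rule AA_I, rule closed_famD(4), assumption; rule AA_D)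

lemma AA_der: "A \<in> AA \<Longrightarrow> der A \<in> AA"
  by (rule AA_I, rule closed_famD(5), assumption, rule AA_D)

lemma AA_pred: "J \<in> set (sys_preds M) \<Longrightarrow> closed_set_of_ideal M J \<in> AA"
  by (rule AA_I, rule closed_famD(6))

lemma AA_Int: assumes "A \<in> AA" "B \<in> AA" shows "A \<inter> B \<in> AA"
proof -
  have "S - ((S - A) \<union> (S - B)) \<in> AA" by (intro AA_compl AA_Un assms)
  moreover have "S - ((S - A) \<union> (S - B)) = A \<inter> B" using AA_sub[OF assms(1)] by auto
  ultimately show ?thesis by simp
qed

definition atom where "atom x = S \<inter> \<Inter>{A \<in> AA. x \<in> A}"

lemma atom_AA: "atom x \<in> AA"
proof -
  have "S \<inter> \<Inter>F \<in> AA" if "finite F" "F \<subseteq> AA" for F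
    using that
  proof (induction F rule: finite_induct)
    case empty
    then show ?case using AA_compl[OF AA_empty] by simp
  next
    case (insert A F)
    then have AF: "A \<in> AA" "S \<inter> \<Inter>F \<in> AA" by simp_all
    have "A \<inter> (S \<inter> \<Inter>F) \<in> AA" by (rule AA_Int[OF AF])
    moreover have "A \<inter> (S \<inter> \<Inter>F) = S \<inter> \<Inter>(insert A F)" by auto
    ultimately show ?case by simp
  qed
  moreover have "finite {A \<in> AA. x \<in> A}" using fin_AA by simp
  ultimately show ?thesis unfolding atom_def by simp
qed

lemma atom_self: "x \<in> S \<Longrightarrow> x \<in> atom x"
  by (simp add: atom_def)

lemma atom_sub: "A \<in> AA \<Longrightarrow> x \<in> A \<Longrightarrow> atom x \<subseteq> A"
  by (auto simp: atom_def)

lemma atom_meets: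
  assumes A: "A \<in> AA" and x: "x \<in> S" "y \<in> atom x" "y \<in> A" shows "atom x \<subseteq> A"
proof (cases "x \<in> A")
  case False
  then have "atom x \<subseteq> S - A" using x(1) by (intro atom_sub AA_compl A) simp
  then show ?thesis using x by auto
qed (rule atom_sub[OF A])

text \<open>On a small enough open set no member of \<open>CC\<close> separates points of the two
  atoms. As each atom accumulates at the other, both have points there, with equal signatures, and
  saturation puts these points into one atom.\<close>

lemma atom_antisym:
  assumes x: "x \<in> S" "y \<in> S" and s: "atom x \<subseteq> der (atom y)" "atom y \<subseteq> der (atom x)"
  shows "atom x = atom y"
proof -
  let ?H = "atom x \<union> atom y"
  \<comment> \<open>The neighbourhood is shrunk once for each closed set: if some point of
    \<open>b\<close> in the two atoms is outside \<open>C\<close>, move to a smaller set missing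
    \<open>C\<close>.\<close>
  have "\<exists>b\<in>D ` R. b \<inter> atom x \<noteq> {} \<and> (\<forall>C\<in>G. b \<inter> ?H \<subseteq> C \<or> b \<inter> ?H \<inter> C = {})" if "finite G" "G \<subseteq> CC" for G
    using that
  proof (induction G rule: finite_induct)
    case empty
    obtain b where "b \<in> D ` R" "x \<in> b" using bs.B_cover[OF x(1)] by (elim bexE)
    then show ?case using atom_self[OF x(1)] by (intro bexI[of _ b]) auto
  next
    case (insert C G)
    then obtain b where b: "b \<in> D ` R" "b \<inter> atom x \<noteq> {}" "\<forall>C\<in>G. b \<inter> ?H \<subseteq> C \<or> b \<inter> ?H \<inter> C = {}" by auto
    show ?case
    proof (cases "b \<inter> ?H \<subseteq> C")
      case True
      then show ?thesis using b by (intro bexI[of _ b]) auto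
    next
      case False
      then obtain z where z: "z \<in> b" "z \<in> ?H" "z \<notin> C" by auto
      have zS: "z \<in> S" using z(1) bs.B_sub[OF b(1)] by auto
      have "C \<in> CC" using insert.prems by simp
      from closed_nbhd[OF CC_sclosed[OF this] zS z(3)] obtain c where
        c: "c \<in> D ` R" "z \<in> c" "c \<inter> C = {}" by blast
      have bc: "b \<inter> c \<in> D ` R" by (rule bs.B_Int[OF b(1) c(1)])
      \<comment> \<open>The new centre \<open>z\<close> may come from the second atom, but it is
        then a limit point of the first one.\<close>
      have "b \<inter> c \<inter> atom x \<noteq> {}"
      proof (cases "z \<in> atom x")
        case False
        then have "z \<in> der (atom x)" using z(2) s(2) by auto
        then have "\<exists>w\<in>atom x \<inter> (b \<inter> c). w \<noteq> z" by (rule bs.sderivedD[OF _ bc]) (use z c in simp)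
        then show ?thesis by auto
      qed (use z c in auto)
      then show ?thesis using b(3) c(3) bc by (intro bexI[of _ "b \<inter> c"]) auto
    qed
  qed
  from this[OF fin_CC subset_refl] obtain b where b: "b \<in> D ` R" "b \<inter> atom x \<noteq> {}"
    "\<forall>C\<in>CC. b \<inter> ?H \<subseteq> C \<or> b \<inter> ?H \<inter> C = {}" by (elim bexE conjE)
  obtain u where u: "u \<in> b" "u \<in> atom x" using b(2) by auto
  have "\<exists>w\<in>atom y \<inter> b. w \<noteq> u" by (rule bs.sderivedD[OF _ b(1) u(1)]) (use s(1) u(2) in auto)
  then obtain w where w: "w \<in> atom y" "w \<in> b" by auto
  have "sig u = sig w" unfolding sig_def using b(3) u w by blast
  moreover have "w \<in> S" using w(2) bs.B_sub[OF b(1)] by auto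
  ultimately have "w \<in> atom x" using AA_Sat[OF atom_AA[of x]] u(2) unfolding Sat_def by simp
  then have "atom x \<subseteq> atom y" by (intro atom_meets[OF atom_AA x(1) _ w(1)])
  moreover have "atom y \<subseteq> atom x" by (rule atom_meets[OF atom_AA x(2) w(1) \<open>w \<in> atom x\<close>])
  ultimately show ?thesis by simp
qed

text \<open>The labels are names for the atoms, ordered by inclusion in derived sets. An atom is
  contained in every member of the algebra that it meets, so all conditions on the tuple can be
  tested at single points.\<close>

theorem oc_represents:
  assumes inf: "infinite (UNIV :: 'p set)"
  shows "\<exists>T :: 'p potuple. T \<in> po_tuples n \<and> represents T M"
proof -
  let ?At = "atom ` S"
  have "?At \<subseteq> AA" using atom_AA by auto
  then have finAt: "finite ?At" using fin_AA finite_subset by auto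
  \<comment> \<open>The finitely many atoms are renamed by elements of the prescribed label
    type.\<close>
  obtain P :: "'p set" where P: "finite P" "card P = card ?At" using infinite_arbitrarily_large[OF inf] by metis
  obtain X where X: "bij_betw X P ?At" using finite_same_card_bij[OF P(1) finAt P(2)] by (elim exE)
  have XI: "X ` P = ?At" "inj_on X P" using X by (simp_all add: bij_betw_def)
  have Xat: "\<exists>x\<in>S. X p = atom x" if "p \<in> P" for p
  proof -
    have "X p \<in> atom ` S" unfolding XI(1)[symmetric] using that by (rule imageI)
    then show ?thesis by auto
  qed
  have Xex: "\<exists>p\<in>P. X p = atom x" if "x \<in> S" for x
  proof -
    have "atom x \<in> X ` P" unfolding XI(1) using that by simp
    then show ?thesis by auto
  qed
  have XA: "X p \<in> AA" if "p \<in> P" for p using Xat[OF that] atom_AA by auto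
  have XS: "X p \<subseteq> S" if "p \<in> P" for p by (rule AA_sub[OF XA[OF that]])
  have Xne: "X p \<noteq> {}" if "p \<in> P" for p using Xat[OF that] atom_self by auto
  have Xm: "X p \<subseteq> A" if p: "p \<in> P" and A: "A \<in> AA" "X p \<inter> A \<noteq> {}" for p A
  proof -
    obtain x where x: "x \<in> S" "X p = atom x" using Xat[OF p] by (elim bexE)
    obtain y where "y \<in> X p" "y \<in> A" using A(2) by auto
    then show ?thesis using atom_meets[OF A(1) x(1), of y] x(2) by simp
  qed
  have Xq: "p = q" if p: "p \<in> P" "q \<in> P" "X p \<inter> X q \<noteq> {}" for p q
  proof -
    have "X p = X q" using Xm[OF p(1) XA[OF p(2)]] Xm[OF p(2) XA[OF p(1)]] p(3) by auto
    then show ?thesis using XI(2) p by (auto dest: inj_onD)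
  qed
  have Xun: "A = (\<Union>p\<in>{p \<in> P. X p \<subseteq> A}. X p)" if A: "A \<in> AA" for A
  proof (intro equalityI subsetI)
    fix x assume x: "x \<in> A"
    then have xS: "x \<in> S" using AA_sub[OF A] by auto
    then obtain p where "p \<in> P" "X p = atom x" using Xex by auto
    then show "x \<in> (\<Union>p\<in>{p \<in> P. X p \<subseteq> A}. X p)" using atom_sub[OF A x] atom_self[OF xS] by auto
  qed auto
  define r where "r = {(q, p). q \<in> P \<and> p \<in> P \<and> X q \<subseteq> der (X p)}"
  define L where "L = {p \<in> P. \<exists>b\<in>D ` R. X p \<subseteq> b}"
  define cs where "cs = closed_set_of_ideal M"
  define Q where "Q J = {p \<in> P. X p \<subseteq> cs J}" for J
  define T where "T = \<lparr>po_points = P, po_less = r, po_L = L, po_f = (\<lambda>p. card (X p)), po_Qs = map Q (sys_preds M)\<rparr>"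
  have T: "po_points T = P" "po_less T = r" "po_L T = L" "po_f T = (\<lambda>p. card (X p))" "po_Qs T = map Q (sys_preds M)"
    by (simp_all add: T_def)
  have dcl: "der (der A) \<subseteq> der A" if "A \<subseteq> S" for A
    by (rule bs.sclosedD[OF bs.sclosed_sderived[OF that]])
  have low: "X q \<subseteq> H" if qp: "(q, p) \<in> r" and H: "sclosed S (D ` R) H" "X p \<subseteq> H" for q p H
  proof -
    have "X q \<subseteq> der (X p)" using qp by (simp add: r_def)
    also have "\<dots> \<subseteq> der H" by (rule bs.sderived_mono[OF H(2)])
    also have "\<dots> \<subseteq> H" by (rule bs.sclosedD[OF H(1)])
    finally show ?thesis .
  qed
  have po: "po_system P r" unfolding po_system_def
  proof (intro conjI)
    show "r \<subseteq> P \<times> P" by (auto simp: r_def)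
    show "antisym r"
    proof (rule antisymI)
      fix p q assume pq: "(p, q) \<in> r" "(q, p) \<in> r"
      then have P': "p \<in> P" "q \<in> P" by (simp_all add: r_def)
      obtain x where x: "x \<in> S" "X p = atom x" using Xat[OF P'(1)] by (elim bexE)
      obtain y where y: "y \<in> S" "X q = atom y" using Xat[OF P'(2)] by (elim bexE)
      have "atom x = atom y" by (rule atom_antisym[OF x(1) y(1)]) (use pq x y in \<open>simp_all add: r_def\<close>)
      then show "p = q" using Xq[OF P'] Xne[OF P'(1)] x y by simp
    qed
    show "trans r"
    proof (rule transI)
      fix p q s assume pq: "(p, q) \<in> r" "(q, s) \<in> r"
      then have s: "s \<in> P" "p \<in> P" "X q \<subseteq> der (X s)" by (simp_all add: r_def)
      have "X p \<subseteq> der (X s)" by (rule low[OF pq(1) bs.sclosed_sderived[OF XS[OF s(1)]] s(3)])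
      then show "(p, s) \<in> r" using s by (simp add: r_def)
    qed
  qed
  have disc: "finite (X p) \<and> p \<in> L \<and> der (X p) = {}" if p: "p \<in> P" "(p, p) \<notin> r" for p
  proof -
    \<comment> \<open>An atom lies inside its derived set or is disjoint from it. Irreflexivity
      leaves the second case, in which the atom is finite.\<close>
    have "X p \<inter> der (X p) = {}"
      using Xm[OF p(1) AA_der[OF XA[OF p(1)]]] p by (auto simp: r_def)
    then have f: "finite (X p)" by (rule discrete_finite[OF AA_Sat[OF XA[OF p(1)]]])
    have "\<exists>b\<in>D ` R. (\<Union>x\<in>X p. {x}) \<subseteq> b"
      by (rule bs.B_bound[OF f]) (use bs.B_cover XS[OF p(1)] in auto)
    then show ?thesis using f p(1) bs.sderived_finite[OF f XS[OF p(1)]] by (simp add: L_def)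
  qed
  have lowL: "lower_subset P r L" unfolding lower_subset_def
  proof (intro conjI ballI impI)
    show "L \<subseteq> P" by (auto simp: L_def)
    fix p q assume p: "p \<in> L" "q \<in> P" "(q, p) \<in> r"
    then obtain b where b: "b \<in> D ` R" "X p \<subseteq> b" by (auto simp: L_def)
    have "X q \<subseteq> b" by (rule low[OF p(3) bs.clopen_sclosed b(2)]) (use b(1) in simp)
    then show "q \<in> L" using p(2) b(1) by (auto simp: L_def)
  qed
  have Lm: "p \<in> L_min T" if p: "p \<in> P" "(p, p) \<notin> r" for p
    unfolding L_min_def minimal_elements_def T po_le_def
  proof (intro CollectI conjI ballI impI)
    show "p \<in> L" using disc[OF p] by simp
    fix q assume q: "q \<in> L" "(q, p) \<in> r \<or> q = p"
    show "q = p"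
    proof (rule ccontr)
      assume "q \<noteq> p"
      then have "X q \<subseteq> {}" "q \<in> P" using q(2) disc[OF p] by (auto simp: r_def)
      then show False using Xne by auto
    qed
  qed
  have Lmd: "p \<in> P" "(p, p) \<notin> r" if "p \<in> L_min_d T" for p
    using that by (simp_all add: L_min_d_def discrete_part_def T)
  have cscl: "sclosed S (D ` R) (cs J)" if "J \<in> set (sys_preds M)" for J
    unfolding cs_def by (rule closed_set_sclosed[OF idl[OF that]])
  have csA: "cs J \<in> AA" if "J \<in> set (sys_preds M)" for J unfolding cs_def by (rule AA_pred[OF that])
  have gen: "generated_algebra P r (set (po_Qs T)) = Pow P"
  proof
    have "algebra P (Pow P)" unfolding algebra_iff_Un by auto
    moreover have "set (po_Qs T) \<subseteq> Pow P" by (auto simp: T Q_def)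
    moreover have "\<forall>Q\<in>Pow P. po_derivative P r Q \<in> Pow P" by (auto simp: po_derivative_def)
    ultimately show "generated_algebra P r (set (po_Qs T)) \<subseteq> Pow P"
      unfolding generated_algebra_def by (intro Inter_lower) simp
    show "Pow P \<subseteq> generated_algebra P r (set (po_Qs T))"
      unfolding generated_algebra_def
    proof (rule Inter_greatest)
      fix G assume "G \<in> {\<A>. algebra P \<A> \<and> set (po_Qs T) \<subseteq> \<A> \<and> (\<forall>Q\<in>\<A>. po_derivative P r Q \<in> \<A>)}"
      then have G: "algebra P G" "set (po_Qs T) \<subseteq> G" "\<And>Q. Q \<in> G \<Longrightarrow> po_derivative P r Q \<in> G" by simp_all
      have GU: "{} \<in> G" "\<And>a. a \<in> G \<Longrightarrow> P - a \<in> G" "\<And>a b. a \<in> G \<Longrightarrow> b \<in> G \<Longrightarrow> a \<union> b \<in> G"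
        using G(1) unfolding algebra_iff_Un by simp_all
      define pts where "pts A = {p \<in> P. X p \<subseteq> A}" for A
      have ptsU: "(\<Union>p\<in>pts A. X p) = A" if "A \<in> AA" for A using Xun[OF that] by (simp add: pts_def)
      \<comment> \<open>The sets whose label sets lie in \<open>G\<close> satisfy all closure
        conditions, so by minimality of \<open>AA\<close> they exhaust it. Every set of labels is
        then in \<open>G\<close>, as the union of its parts belongs to \<open>AA\<close>.\<close>
      have "closed_fam {A \<in> AA. pts A \<in> G}" unfolding closed_fam_def
      proof (intro conjI ballI)
        show "{A \<in> AA. pts A \<in> G} \<subseteq> Pow S" using AA_sub by auto
        have "pts {} = {}" using Xne by (auto simp: pts_def)
        then show "{} \<in> {A \<in> AA. pts A \<in> G}" using AA_empty GU(1) by simp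
        show "S - A \<in> {A \<in> AA. pts A \<in> G}" if A: "A \<in> {A \<in> AA. pts A \<in> G}" for A
        proof -
          have "pts (S - A) = P - pts A"
          proof (intro equalityI subsetI)
            fix p assume "p \<in> pts (S - A)"
            then show "p \<in> P - pts A" using Xne[of p] by (auto simp: pts_def)
          next
            fix p assume p: "p \<in> P - pts A"
            then have "X p \<inter> A = {}" using Xm[of p A] A by (auto simp: pts_def)
            then show "p \<in> pts (S - A)" using p XS[of p] by (auto simp: pts_def)
          qed
          then show ?thesis using A AA_compl GU(2) by simp
        qed
        show "A \<union> C \<in> {A \<in> AA. pts A \<in> G}" if A: "A \<in> {A \<in> AA. pts A \<in> G}" "C \<in> {A \<in> AA. pts A \<in> G}" for A C
        proof -
          have "pts (A \<union> C) = pts A \<union> pts C"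
          proof (intro equalityI subsetI)
            fix p assume p: "p \<in> pts (A \<union> C)"
            then have "p \<in> P" "X p \<inter> A \<noteq> {} \<or> X p \<inter> C \<noteq> {}" using Xne[of p] by (auto simp: pts_def)
            then show "p \<in> pts A \<union> pts C" using Xm[of p A] Xm[of p C] A by (auto simp: pts_def)
          qed (auto simp: pts_def)
          then show ?thesis using A AA_Un GU(3) by simp
        qed
        show "der A \<in> {A \<in> AA. pts A \<in> G}" if A: "A \<in> {A \<in> AA. pts A \<in> G}" for A
        proof -
          have AA': "A \<in> AA" "pts A \<in> G" using A by simp_all
          have fp: "finite (X ` pts A)" using P(1) by (simp add: pts_def)
          have "der A = der (\<Union>(X ` pts A))" using ptsU[OF AA'(1)] by simp
          also have "\<dots> = (\<Union>p\<in>pts A. der (X p))" using bs.sderived_UN[OF fp] by simp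
          finally have dA: "der A = (\<Union>p\<in>pts A. der (X p))" .
          have "pts (der A) = po_derivative P r (pts A)"
          proof (intro equalityI subsetI)
            fix q assume q: "q \<in> pts (der A)"
            then have qP: "q \<in> P" by (simp add: pts_def)
            obtain y where y: "y \<in> X q" using Xne[OF qP] by auto
            then obtain p where p: "p \<in> pts A" "y \<in> der (X p)" using q dA by (auto simp: pts_def)
            then have pP: "p \<in> P" by (simp add: pts_def)
            have "X q \<subseteq> der (X p)" by (rule Xm[OF qP AA_der[OF XA[OF pP]]]) (use y p(2) in auto)
            then show "q \<in> po_derivative P r (pts A)" using qP pP p(1) by (auto simp: po_derivative_def r_def)
          next
            fix q assume "q \<in> po_derivative P r (pts A)"
            then obtain p where "q \<in> P" "p \<in> pts A" "X q \<subseteq> der (X p)" by (auto simp: po_derivative_def r_def)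
            then show "q \<in> pts (der A)" unfolding pts_def mem_Collect_eq dA by (auto simp: pts_def)
          qed
          then show ?thesis using AA' AA_der G(3) by simp
        qed
        show "closed_set_of_ideal M J \<in> {A \<in> AA. pts A \<in> G}" if J: "J \<in> set (sys_preds M)" for J
        proof -
          have "pts (cs J) \<in> G" using G(2) J unfolding T by (auto simp: Q_def pts_def)
          then show ?thesis using AA_pred[OF J] by (simp add: cs_def)
        qed
      qed
      then have sub: "AA \<subseteq> {A \<in> AA. pts A \<in> G}" by (rule AA_min)
      have UA: "(\<Union>p\<in>E. X p) \<in> AA" if "finite E" "E \<subseteq> P" for E
        using that
      proof (induction E rule: finite_induct)
        case empty
        then show ?case using AA_empty by simp
      next
        case (insert p E)
        then show ?case using AA_Un[OF XA[of p]] by simp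
      qed
      show "Pow P \<subseteq> G"
      proof
        fix E assume "E \<in> Pow P"
        then have E: "E \<subseteq> P" "finite E" using P(1) finite_subset by auto
        have "pts (\<Union>p\<in>E. X p) = E"
        proof (intro equalityI subsetI)
          fix p assume "p \<in> pts (\<Union>p\<in>E. X p)"
          then have p: "p \<in> P" "X p \<subseteq> (\<Union>p\<in>E. X p)" by (simp_all add: pts_def)
          obtain y where "y \<in> X p" using Xne[OF p(1)] by auto
          then obtain q where q: "q \<in> E" "y \<in> X q" "y \<in> X p" using p(2) by auto
          then have "p = q" using E(1) by (intro Xq[OF p(1)]) auto
          then show "p \<in> E" using q(1) by simp
        qed (use E(1) in \<open>auto simp: pts_def\<close>)
        then show "E \<in> G" using sub UA[OF E(2,1)] by auto
      qed
    qed
  qed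
  have "T \<in> po_tuples n"
    unfolding po_tuples_def mem_Collect_eq extended_po_system_def finite_crowded_def
  proof (intro conjI)
    show "po_system (po_points T) (po_less T)" using po by (simp add: T)
    show "lower_subset (po_points T) (po_less T) (po_L T)" using lowL by (simp add: T)
    show "\<forall>p\<in>L_min_d T. 0 < po_f T p"
    proof
      fix p assume p: "p \<in> L_min_d T"
      show "0 < po_f T p" using disc[OF Lmd[OF p]] Xne[OF Lmd(1)[OF p]] by (simp add: T card_gt_0_iff)
    qed
    show "finite (po_points T)" using P(1) by (simp add: T)
    show "discrete_part (po_points T) (po_less T) \<subseteq> L_min T" using Lm by (auto simp: discrete_part_def T)
    show "length (po_Qs T) = n" by (simp add: T len)
    show "\<forall>Q\<in>set (po_Qs T). lower_subset (po_points T) (po_less T) Q"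
    proof
      fix Q' assume "Q' \<in> set (po_Qs T)"
      then obtain J where J: "J \<in> set (sys_preds M)" "Q' = Q J" by (auto simp: T)
      have "q \<in> Q J" if "p \<in> Q J" "q \<in> P" "(q, p) \<in> r" for p q
        using low[OF that(3) cscl[OF J(1)]] that by (simp add: Q_def)
      then show "lower_subset (po_points T) (po_less T) Q'"
        unfolding lower_subset_def T J(2) by (auto simp: Q_def)
    qed
    show "generated_algebra (po_points T) (po_less T) (set (po_Qs T)) = Pow (po_points T)" using gen by (simp add: T)
  qed
  moreover have "sreal S (D ` R) T X" unfolding sreal_def T(1-4)
  proof (intro conjI ballI)
    show "X p \<noteq> {}" if "p \<in> P" for p by (rule Xne[OF that])
    show "disjoint_family_on X P" using Xq by (auto simp: disjoint_family_on_def)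
    show "(\<Union>p\<in>P. X p) = S"
    proof (intro equalityI subsetI)
      fix x assume x: "x \<in> S"
      then obtain p where "p \<in> P" "X p = atom x" using Xex by auto
      then show "x \<in> (\<Union>p\<in>P. X p)" using atom_self[OF x] by auto
    qed (use XS in auto)
    show "der (X p) = (\<Union>q\<in>{q \<in> P. (q, p) \<in> r}. X q)" if p: "p \<in> P" for p
    proof -
      have "{q \<in> P. (q, p) \<in> r} = {q \<in> P. X q \<subseteq> der (X p)}" using p by (auto simp: r_def)
      then show ?thesis using Xun[OF AA_der[OF XA[OF p]]] by simp
    qed
    show "L = {p \<in> P. \<exists>b\<in>D ` R. X p \<subseteq> b}" by (rule L_def)
    show "finite (X p)" "card (X p) = card (X p)" if "p \<in> L_min_d T" for p using disc[OF Lmd[OF that]] by simp_all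
  qed
  moreover have "map (closed_set_of_ideal M) (sys_preds M) = map (\<lambda>Q. \<Union>p\<in>Q. X p) (po_Qs T)"
  proof -
    have "cs J = (\<Union>p\<in>Q J. X p)" if "J \<in> set (sys_preds M)" for J unfolding Q_def by (rule Xun[OF csA[OF that]])
    then show ?thesis unfolding T by (simp add: cs_def)
  qed
  ultimately have "realises M T X" unfolding realises_iff by simp
  then have "represents T M" unfolding represents_def by (rule exI[of _ X])
  then show ?thesis using \<open>T \<in> po_tuples n\<close> by auto
qed

end

section \<open>The bijection\<close>

lemma system_iso_id: "system_iso M M id"
  by (simp add: system_iso_def)

lemma equiv_system_iso_rel: "equiv (omega_categorical_systems n) (system_iso_rel n :: 'a bsystem rel)"
proof (rule equivI)
  show "system_iso_rel n \<subseteq> omega_categorical_systems n \<times> (omega_categorical_systems n :: 'a bsystem set)"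
    by (auto simp: system_iso_rel_def)
  show "refl_on (omega_categorical_systems n) (system_iso_rel n :: 'a bsystem rel)"
    using system_iso_id by (auto simp: refl_on_def system_iso_rel_def systems_isomorphic_def)
  show "sym (system_iso_rel n :: 'a bsystem rel)"
  proof (rule symI)
    fix M N :: "'a bsystem" assume "(M, N) \<in> system_iso_rel n"
    then have MN: "M \<in> omega_categorical_systems n" "N \<in> omega_categorical_systems n" "systems_isomorphic M N"
      by (simp_all add: system_iso_rel_def)
    then obtain h where h: "system_iso M N h" by (auto simp: systems_isomorphic_def)
    have "is_structure n M" using MN(1) by (simp add: omega_categorical_systems_def)
    then have "system_iso N M (inv_into (sys_carrier M) h)" by (rule system_iso_inv[OF h])
    then show "(N, M) \<in> system_iso_rel n" using MN by (auto simp: system_iso_rel_def systems_isomorphic_def)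
  qed
  show "trans (system_iso_rel n :: 'a bsystem rel)"
  proof (rule transI)
    fix M N K :: "'a bsystem" assume "(M, N) \<in> system_iso_rel n" "(N, K) \<in> system_iso_rel n"
    then have MN: "M \<in> omega_categorical_systems n" "K \<in> omega_categorical_systems n"
      "systems_isomorphic M N" "systems_isomorphic N K"
      by (simp_all add: system_iso_rel_def)
    then obtain g h where "system_iso M N h" "system_iso N K g" by (auto simp: systems_isomorphic_def)
    then have "system_iso M K (g \<circ> h)" by (rule system_iso_comp)
    then show "(M, K) \<in> system_iso_rel n" using MN by (auto simp: system_iso_rel_def systems_isomorphic_def)
  qed
qed

text \<open>One representing tuple determines the whole image: representation passes along
  isomorphisms on both sides, and two tuples representing one system are isomorphic.\<close>

lemma image_class:
  fixes M :: "'a bsystem" and T :: "'p potuple"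
  assumes M: "M \<in> omega_categorical_systems n" and T: "T \<in> po_tuples n" "represents T M"
  shows "natural_map n (system_iso_rel n `` {M}) = potuple_iso_rel n `` {T}"
proof (intro equalityI subsetI)
  fix T' :: "'p potuple" assume "T' \<in> natural_map n (system_iso_rel n `` {M})"
  then obtain N where N: "T' \<in> po_tuples n" "(M, N) \<in> system_iso_rel n" "represents T' N"
    by (auto simp: natural_map_def)
  then have NM: "N \<in> omega_categorical_systems n" "systems_isomorphic M N" by (simp_all add: system_iso_rel_def)
  have "is_structure n N" using NM(1) by (simp add: omega_categorical_systems_def)
  then have "represents T N" by (rule represents_system_iso[OF T(1) M T(2) _ NM(2)])
  then have "\<exists>h. potuple_iso T T' h" by (rule represents_unique[OF T(1) N(1) NM(1) _ N(3)])
  then show "T' \<in> potuple_iso_rel n `` {T}" using T(1) N(1) by (simp add: potuple_iso_rel_def)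
next
  fix T' :: "'p potuple" assume "T' \<in> potuple_iso_rel n `` {T}"
  then obtain h where T': "T' \<in> po_tuples n" "potuple_iso T T' h" by (auto simp: potuple_iso_rel_def)
  have "represents T' M" by (rule represents_potuple_iso[OF T(1) T' M T(2)])
  moreover have "(M, M) \<in> system_iso_rel n"
    using M system_iso_id[of M] unfolding system_iso_rel_def systems_isomorphic_def by blast
  ultimately show "T' \<in> natural_map n (system_iso_rel n `` {M})" using T'(1) by (auto simp: natural_map_def)
qed

lemma potuple_iso_id: "potuple_iso T T id"
  by (simp add: potuple_iso_def)

text \<open>The two infinity assumptions leave room for countably infinite rings on
  \<open>'a\<close> and for finite orders of every size on \<open>'p\<close>.\<close>

theorem theorem5:
  fixes n :: nat
  assumes "infinite (UNIV :: 'a set)" and "infinite (UNIV :: 'p set)"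
  shows "bij_betw (natural_map n :: 'a bsystem set \<Rightarrow> 'p potuple set)
           (omega_categorical_systems n // system_iso_rel n)
           (po_tuples n // potuple_iso_rel n)"
proof -
  let ?\<Omega> = "omega_categorical_systems n :: 'a bsystem set" and ?R = "system_iso_rel n :: 'a bsystem rel"
  have ex: "\<exists>T :: 'p potuple. T \<in> po_tuples n \<and> represents T M" if M: "M \<in> ?\<Omega>" for M
  proof -
    have "boolean_ring M" using M by (simp add: omega_categorical_systems_def)
    then interpret oc_system M n using M by unfold_locales
    show ?thesis by (rule oc_represents[OF assms(2)])
  qed
  show ?thesis
  proof (rule bij_betw_imageI)
    show "inj_on (natural_map n :: 'a bsystem set \<Rightarrow> 'p potuple set) (?\<Omega> // ?R)"
    proof (rule inj_onI)
      fix C C' assume C: "C \<in> ?\<Omega> // ?R" "C' \<in> ?\<Omega> // ?R"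
        and eq: "(natural_map n C :: 'p potuple set) = natural_map n C'"
      obtain M where M: "M \<in> ?\<Omega>" "C = ?R `` {M}" using C(1) by (rule quotientE)
      obtain M' where M': "M' \<in> ?\<Omega>" "C' = ?R `` {M'}" using C(2) by (rule quotientE)
      obtain T :: "'p potuple" where T: "T \<in> po_tuples n" "represents T M" using ex[OF M(1)] by (elim exE conjE)
      have "T \<in> potuple_iso_rel n `` {T}"
        using T(1) potuple_iso_id[of T] by (auto simp: potuple_iso_rel_def)
      moreover have "natural_map n C' = potuple_iso_rel n `` {T}"
        unfolding eq[symmetric] M(2) by (rule image_class[OF M(1) T])
      ultimately have "T \<in> natural_map n C'" by simp
      \<comment> \<open>Equal images share the tuple \<open>T\<close>, so it represents a system in
        the second class too, and \<open>T\<close> determines the system up to isomorphism.\<close>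
      then obtain N where N: "(M', N) \<in> ?R" "represents T N" unfolding M'(2) natural_map_def by auto
      have NO: "N \<in> ?\<Omega>" using N(1) by (simp add: system_iso_rel_def)
      have "systems_isomorphic M N" by (rule represents_isomorphic[OF T(1) M(1) T(2) NO N(2)])
      then have "(M, N) \<in> ?R" using M(1) NO by (simp add: system_iso_rel_def)
      then have "?R `` {M} = ?R `` {N}" by (rule equiv_class_eq[OF equiv_system_iso_rel])
      moreover have "?R `` {M'} = ?R `` {N}" by (rule equiv_class_eq[OF equiv_system_iso_rel N(1)])
      ultimately show "C = C'" using M(2) M'(2) by simp
    qed
    show "natural_map n ` (?\<Omega> // ?R) = (po_tuples n // potuple_iso_rel n :: 'p potuple set set)"
    proof (intro equalityI subsetI)
      fix c :: "'p potuple set" assume "c \<in> natural_map n ` (?\<Omega> // ?R)"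
      then obtain C where C: "C \<in> ?\<Omega> // ?R" "c = natural_map n C" by auto
      obtain M where M: "M \<in> ?\<Omega>" "C = ?R `` {M}" using C(1) by (rule quotientE)
      obtain T :: "'p potuple" where T: "T \<in> po_tuples n" "represents T M" using ex[OF M(1)] by (elim exE conjE)
      have "c = potuple_iso_rel n `` {T}" unfolding C(2) M(2) by (rule image_class[OF M(1) T])
      then show "c \<in> po_tuples n // potuple_iso_rel n" using T(1) by (simp add: quotientI)
    next
      fix c :: "'p potuple set" assume "c \<in> po_tuples n // potuple_iso_rel n"
      then obtain T where T: "T \<in> po_tuples n" "c = potuple_iso_rel n `` {T}" by (rule quotientE)
      obtain M :: "'a bsystem" where M: "M \<in> ?\<Omega>" "represents T M"
        using represents_exists[OF assms(1) T(1)] by (elim exE conjE)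
      have "c = natural_map n (?R `` {M})" unfolding T(2) by (rule image_class[OF M(1) T(1) M(2), symmetric])
      then show "c \<in> natural_map n ` (?\<Omega> // ?R)" using M(1) by (auto simp: quotientI)
    qed
  qed
qed

end
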